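(* Let $\alpha \in (\tfrac{4}{3}, 2]$ and let $X$ be a real-valued symmetric $\alpha$-stable process. Let $\hat\theta$ be the derivative of the self-intersection local time of $X$ on $[0,1]$, formally $$\hat\theta = \frac{i}{2\pi}\int_0^1\int_0^t\int_{\mathbb{R}} p\, e^{ip(X_t - X_s)}\,dp\,ds\,dt .$$ Let $\gamma \in [0, \tfrac{2\alpha}{6+\alpha})$. Then there exists a constant $M > 0$ such that $\mathbb{E}[\exp\{M|\hat\theta|^{\gamma}\}] < \infty$.
   Context: A symmetric $\alpha$-stable process ($\alpha\in(0,2]$) is a real-valued Lévy process $X$ with $X_0=0$ whose characteristic function is $\mathbb{E}[e^{iuX_t}] = e^{-t\sigma^\alpha |u|^\alpha}$ for some $\sigma>0$. The formal expression for $\hat\theta$ is made rigorous as the limit, as $\epsilon\downarrow 0$, of $\frac{i}{2\pi}\int_0^1\int_0^t\int_{\mathbb{R}} p\, e^{ip(X_t - X_s)} e^{-\epsilon p^2/2}\,dp\,ds\,dt$ (existence of this derivative of self-intersection local time is known from Rosen's work). *)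

theory Defs
  imports "HOL-Probability.Probability"
begin

definition sym_stable_process ::
  "'a measure \<Rightarrow> real \<Rightarrow> real \<Rightarrow> (real \<Rightarrow> 'a \<Rightarrow> real) \<Rightarrow> bool" where
  "sym_stable_process M \<alpha> \<sigma> X \<longleftrightarrow>
     prob_space M \<and> 0 < \<alpha> \<and> \<alpha> \<le> 2 \<and> 0 < \<sigma> \<and>
     (\<forall>t. X t \<in> borel_measurable M) \<and>
     (\<forall>\<omega>\<in>space M. X 0 \<omega> = 0) \<and>
     (\<forall>\<omega>\<in>space M. \<forall>t\<ge>0. continuous (at_right t) (\<lambda>s. X s \<omega>) \<and>
        (0 < t \<longrightarrow> (\<exists>l. ((\<lambda>s. X s \<omega>) \<longlongrightarrow> l) (at_left t)))) \<and>
     (\<forall>tt :: nat \<Rightarrow> real. 0 \<le> tt 0 \<longrightarrow> mono tt \<longrightarrow>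
        prob_space.indep_vars M (\<lambda>_. borel) (\<lambda>i \<omega>. X (tt (Suc i)) \<omega> - X (tt i) \<omega>) UNIV) \<and>
     (\<forall>s t u. 0 \<le> s \<longrightarrow> s \<le> t \<longrightarrow>
        (CLINT \<omega>|M. iexp (u * (X t \<omega> - X s \<omega>)))
          = complex_of_real (exp (- (t - s) * \<sigma> powr \<alpha> * \<bar>u\<bar> powr \<alpha>)))"

definition dsilt_approx :: "(real \<Rightarrow> 'a \<Rightarrow> real) \<Rightarrow> real \<Rightarrow> 'a \<Rightarrow> complex" where
  "dsilt_approx X \<epsilon> \<omega> =
     (\<i> / complex_of_real (2 * pi)) *
     (LINT t:{0..1}|lborel. LINT s:{0..t}|lborel. LINT p|lborel.
        complex_of_real p * iexp (p * (X t \<omega> - X s \<omega>)) * complex_of_real (exp (- \<epsilon> * p\<^sup>2 / 2)))"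

definition is_dsilt :: "'a measure \<Rightarrow> (real \<Rightarrow> 'a \<Rightarrow> real) \<Rightarrow> ('a \<Rightarrow> complex) \<Rightarrow> bool" where
  "is_dsilt M X \<theta> \<longleftrightarrow> \<theta> \<in> borel_measurable M \<and>
     (\<forall>\<delta>>0. ((\<lambda>\<epsilon>. measure M {\<omega>\<in>space M. \<delta> < cmod (dsilt_approx X \<epsilon> \<omega> - \<theta> \<omega>)})
               \<longlongrightarrow> 0) (at_right 0))"

end

theory Submission
  imports Defs
begin

text \<open>
  Discretise time: the regularised local time is a limit of double sums of a function
  \<open>f(S\<^sub>r - S\<^sub>i)\<close> along a random walk. Two applications of a good-lambda (John--Nirenberg)
  inequality need only conditional second moments of increments. Given the past, the increment of
  the double sum over the future has second moment at most a constant times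
  \<open>V\<^sub>\<epsilon>\<close> plus the squared \<open>L\<^sup>2\<close>-norm of the Fourier transform of the past
  occupation measure, with weight \<open>\<psi>\<^sup>2 R\<close> where \<open>R\<close> is the resolvent and
  \<open>\<psi>(p) = p exp (- \<epsilon> p\<^sup>2 / 2)\<close>. The increments of that norm themselves have conditional
  second moments of order \<open>V\<^sub>\<epsilon>\<close>, so it has an exponential tail.
  Together they give tails \<open>exp (- c \<surd>\<lambda>)\<close> on the scale
  \<open>\<surd>V\<^sub>\<epsilon>\<close>, \<open>V\<^sub>\<epsilon> = \<integral> p\<^sup>2 R\<^sup>2 exp (- \<epsilon> p\<^sup>2 / 2)\<close>, uniformly in \<open>\<epsilon>\<close>.
  Since \<open>2\<alpha> / (6 + \<alpha>) \<le> 1/2\<close>, this suffices when \<open>V\<^sub>\<epsilon>\<close> stays bounded, that is for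
  \<open>\<alpha> > 3/2\<close>. For \<open>\<alpha> \<le> 3/2\<close> the second moment of the regularisation is of the exact order
  \<open>V\<^sub>\<epsilon> \<longrightarrow> \<infinity>\<close>; with the same tails, Paley--Zygmund shows that the regularisation is not
  tight, so no limit in probability exists and the statement is vacuous there.
\<close>

section \<open>Gaussian frequency kernel and stable resolvent\<close>

text \<open>Why two rounds are needed: given the past up to \<open>j\<close>, the remaining sum
  consists of pairs after \<open>j\<close> and of pairs straddling \<open>j\<close>. The former have
  a deterministic second moment; the latter have none of the right order, since a past that lingers
  in one place makes them large. The past enters their second moment only through one norm of its
  occupation measure, and since that norm satisfies the triangle inequality in time, it can be
  treated first and without restrictions on the history. The second round allows this norm the size
  \<open>l * sqrt V\<close>, which fails with probability at most \<open>(1/2) ^ l\<close>. The band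
  width is then of order \<open>l * sqrt V\<close>, and \<open>l\<close> bands reach
  \<open>l^2 * sqrt V\<close>: this is where the square root in the tail comes from. Discrete time
  makes the past a finite vector of steps, so that conditioning is Fubini's theorem. Its price is a
  set of error terms of the form constant over \<open>N\<close>, which for fixed regularisation are
  absorbed by taking \<open>N\<close> large before the regularisation is removed. The kernel
  \<open>p\<close> is odd and grows, so absolute values inside frequency integrals are only
  affordable where three resolvents are available; elsewhere the cancellation has to be
  kept.\<close>

definition freq_kernel :: "real \<Rightarrow> real \<Rightarrow> real" where
  "freq_kernel e p = p * exp (- (e * p\<^sup>2 / 2))"

definition resolvent :: "real \<Rightarrow> real \<Rightarrow> real \<Rightarrow> real" where
  "resolvent a c p = 1 / (1 + c * \<bar>p\<bar> powr a)"

lemma integrable_gauss_moment: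
  assumes "0 < e"
  shows "integrable lborel (\<lambda>p::real. \<bar>p\<bar> ^ k * exp (- (e * p\<^sup>2 / 2)))"
proof -
  define s where "s = 1 / sqrt e"
  have s: "s > 0" "s\<^sup>2 = 1 / e" using assms by (auto simp: s_def power_divide)
  have "integrable lborel (\<lambda>p. sqrt (2 * pi * s\<^sup>2) * (normal_density 0 s p * \<bar>p - 0\<bar> ^ k))"
    by (intro integrable_mult_right integrable_normal_moment_abs s)
  also have "(\<lambda>p. sqrt (2 * pi * s\<^sup>2) * (normal_density 0 s p * \<bar>p - 0\<bar> ^ k)) =
    (\<lambda>p. \<bar>p\<bar> ^ k * exp (- (e * p\<^sup>2 / 2)))"
    using s assms by (auto simp: normal_density_def fun_eq_iff field_simps)
  finally show ?thesis .
qed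

lemma freq_kernel_measurable [measurable]: "freq_kernel e \<in> borel_measurable borel"
  unfolding freq_kernel_def[abs_def] by measurable

lemma freq_kernel_minus [simp]: "freq_kernel e (- p) = - freq_kernel e p"
  by (simp add: freq_kernel_def)

lemma abs_freq_kernel: "\<bar>freq_kernel e p\<bar> = \<bar>p\<bar> * exp (- (e * p\<^sup>2 / 2))"
  by (simp add: freq_kernel_def abs_mult)

lemma integrable_freq_kernel: "0 < e \<Longrightarrow> integrable lborel (freq_kernel e)"
  using integrable_gauss_moment[of e 1]
  by (rule Bochner_Integration.integrable_bound) (auto simp: abs_freq_kernel)

lemma freq_kernel_sq_le: assumes "0 \<le> e" shows "(freq_kernel e p)\<^sup>2 \<le> p\<^sup>2 * exp (- (e * p\<^sup>2 / 2))"
proof -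
  have "(freq_kernel e p)\<^sup>2 = p\<^sup>2 * (exp (- (e * p\<^sup>2 / 2)) * exp (- (e * p\<^sup>2 / 2)))"
    by (simp add: freq_kernel_def power2_eq_square)
  also have "\<dots> \<le> p\<^sup>2 * (exp (- (e * p\<^sup>2 / 2)) * 1)"
    using assms by (intro mult_left_mono) auto
  finally show ?thesis by simp
qed

text \<open>The constant 1 does not depend on \<open>e\<close>, as the bound for nested intervals
  requires. With \<open>b = e * p\<^sup>2\<close> the derivative is
  \<open>exp (- b / 2) * (1 - b)\<close>, and
  \<open>\<bar>1 - b\<bar> \<le> exp (b / 2)\<close>.\<close>

lemma freq_kernel_lipschitz: assumes "0 \<le> e" shows "\<bar>freq_kernel e x - freq_kernel e y\<bar> \<le> \<bar>x - y\<bar>"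
proof -
  have "norm (freq_kernel e x - freq_kernel e y) \<le> 1 * norm (x - y)"
  proof (rule field_differentiable_bound[where S=UNIV and f' =
      "\<lambda>p. exp (- (e * p\<^sup>2 / 2)) * (1 - e * p\<^sup>2)"])
    fix p :: real
    show "(freq_kernel e has_field_derivative exp (- (e * p\<^sup>2 / 2)) * (1 - e * p\<^sup>2))
        (at p within UNIV)"
      unfolding freq_kernel_def[abs_def]
      by (auto intro!: derivative_eq_intros simp: power2_eq_square algebra_simps)
    define b where "b = e * p\<^sup>2"
    have b: "b \<ge> 0" using assms by (simp add: b_def)
    have "1 + b/2 + (b/2)\<^sup>2 / 2 \<le> exp (b/2)" using exp_lower_Taylor_quadratic[of "b/2"] b by simp
    moreover have "\<bar>1 - b\<bar> \<le> 1 + b/2 + (b/2)\<^sup>2/2"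
    proof -
      \<comment> \<open>This is \<open>b\<^sup>2 - 4 * b + 16\<close>, eight times the gap between
        the two sides when \<open>1 \<le> b\<close>.\<close>
      have "0 \<le> (b - 2)\<^sup>2 + 12" by simp
      then show ?thesis using b by (auto simp: abs_if power2_eq_square algebra_simps)
    qed
    ultimately have "\<bar>1 - b\<bar> \<le> exp (b/2)" by linarith
    then have "exp (- (b/2)) * \<bar>1 - b\<bar> \<le> exp (-(b/2)) * exp (b/2)" by (intro mult_left_mono) auto
    also have "\<dots> = 1" by (simp flip: exp_add)
    finally show "norm (exp (- (e * p\<^sup>2 / 2)) * (1 - e * p\<^sup>2)) \<le> 1"
      by (simp add: abs_mult b_def)
  qed auto
  then show ?thesis by simp
qed

section \<open>Pointwise, integral and convolution bounds for the stable resolvent\<close>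

lemma resolvent_measurable [measurable]: "resolvent a c \<in> borel_measurable borel"
  unfolding resolvent_def[abs_def] by measurable

lemma resolvent_pos: "0 \<le> c \<Longrightarrow> 0 < resolvent a c p"
  by (auto simp: resolvent_def intro!: divide_pos_pos add_pos_nonneg)

lemma resolvent_le1: "0 \<le> c \<Longrightarrow> resolvent a c p \<le> 1"
  using mult_nonneg_nonneg[of c "\<bar>p\<bar> powr a"] by (simp add: resolvent_def divide_le_eq)

lemma resolvent_minus [simp]: "resolvent a c (- p) = resolvent a c p"
  by (simp add: resolvent_def)

lemma resolvent_antimono:
  assumes "0 \<le> c" "0 \<le> a" "\<bar>p\<bar> \<le> \<bar>q\<bar>" shows "resolvent a c q \<le> resolvent a c p"
proof -
  have "\<bar>p\<bar> powr a \<le> \<bar>q\<bar> powr a" using assms by (intro powr_mono2) auto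
  then have "c * \<bar>p\<bar> powr a \<le> c * \<bar>q\<bar> powr a" using assms by (intro mult_left_mono)
  then show ?thesis using assms unfolding resolvent_def
    by (intro divide_left_mono mult_pos_pos add_pos_nonneg) auto
qed

text \<open>Halving a frequency changes the exponent by the factor \<open>2 powr a\<close>, which is
  at most 4 for \<open>a \<le> 2\<close>.\<close>

lemma resolvent_half:
  assumes "0 \<le> c" "0 \<le> a" "a \<le> 2" shows "resolvent a c (p / 2) \<le> 4 * resolvent a c p"
proof -
  have "\<bar>p\<bar> powr a = 2 powr a * \<bar>p / 2\<bar> powr a" by (simp add: powr_divide)
  also have "\<dots> \<le> 4 * \<bar>p / 2\<bar> powr a"
    using powr_mono[of a 2 2] assms by (intro mult_right_mono) auto
  finally have "c * \<bar>p\<bar> powr a \<le> 4 * (c * \<bar>p / 2\<bar> powr a)"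
    using assms mult_left_mono[of "\<bar>p\<bar> powr a" "4 * \<bar>p / 2\<bar> powr a" c] by (simp add: algebra_simps)
  then have "1 + c * \<bar>p\<bar> powr a \<le> 4 * (1 + c * \<bar>p / 2\<bar> powr a)" by simp
  moreover have "0 < 1 + c * \<bar>p\<bar> powr a" "0 < 1 + c * \<bar>p/2\<bar> powr a"
    using assms by (auto intro!: add_pos_nonneg)
  ultimately show ?thesis unfolding resolvent_def by (simp add: divide_simps del: abs_divide)
qed

lemma integrable_abs_powr_tail:
  assumes "b < -1"
  shows "integrable lborel (\<lambda>p::real. indicator {p. 1 \<le> \<bar>p\<bar>} p * \<bar>p\<bar> powr b)"
proof -
  have "(\<lambda>x::real. x powr b) absolutely_integrable_on {1..}"
    using has_integral_powr_to_inf[of b 1] assms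
    by (intro nonnegative_absolutely_integrable_1) (auto simp: integrable_on_def)
  then have 1: "integrable lborel (\<lambda>x::real. indicator {1..} x * x powr b)"
    unfolding set_integrable_def
    by (subst (asm) integrable_completion) auto
  then have 2: "integrable lborel (\<lambda>x::real. indicator {1..} (-x) * (-x) powr b)"
    using lborel_integrable_real_affine[of "\<lambda>x::real. indicator {1..} x * x powr b" "-1" 0] by simp
  from Bochner_Integration.integrable_add[OF 1 2] show ?thesis
    by (rule Bochner_Integration.integrable_cong[THEN iffD1, rotated -1]) (auto simp: indicator_def)
qed

lemma resolvent_le_powr: assumes "0 < c" "p \<noteq> 0" shows "resolvent a c p \<le> \<bar>p\<bar> powr (- a) / c"
proof -
  have "c * \<bar>p\<bar> powr a \<le> 1 + c * \<bar>p\<bar> powr a" by simp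
  moreover have "0 < c * \<bar>p\<bar> powr a" using assms by simp
  ultimately have "1 / (1 + c * \<bar>p\<bar> powr a) \<le> 1 / (c * \<bar>p\<bar> powr a)"
    by (intro divide_left_mono mult_pos_pos[of _ "c * \<bar>p\<bar> powr a"]) auto
  then show ?thesis using assms unfolding resolvent_def by (simp add: powr_minus field_simps)
qed

lemma integrable_indicator_Icc: "integrable lborel (indicator {a..b::real} :: real \<Rightarrow> real)"
  by (rule integrable_real_indicator) (auto simp: emeasure_lborel_Icc_eq)

lemma integrable_resolvent:
  assumes "0 < c" "1 < a" shows "integrable lborel (resolvent a c)"
proof (rule Bochner_Integration.integrable_bound)
  show "integrable lborel (\<lambda>p. indicator {-1..1} p + (1 / c) * (indicator {p. 1 \<le>
      \<bar>p\<bar>} p * \<bar>p\<bar> powr (-a)))"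
    using assms by (intro Bochner_Integration.integrable_add integrable_indicator_Icc
        integrable_mult_right integrable_abs_powr_tail) auto
  show "AE p in lborel. norm (resolvent a c p) \<le> norm (indicator {-1..1} p + (1 / c) *
      (indicator {p. 1 \<le> \<bar>p\<bar>} p * \<bar>p\<bar> powr (-a)))"
  proof (rule AE_I2)
    fix p :: real
    have "resolvent a c p \<le> indicator {-1..1} p + (1 / c) * (indicator {p. 1 \<le>
        \<bar>p\<bar>} p * \<bar>p\<bar> powr (-a))"
      using resolvent_le1[of c a p] resolvent_le_powr[of c p a] assms
      by (auto simp: indicator_def abs_if split: if_splits)
    then show "norm (resolvent a c p) \<le> norm (indicator {-1..1} p + (1 / c) * (indicator {p. 1 \<le>
        \<bar>p\<bar>} p * \<bar>p\<bar> powr (-a)))"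
      using resolvent_pos[of c a p] assms by simp
  qed
qed simp

definition resolvent_mass :: "real \<Rightarrow> real \<Rightarrow> real" where "resolvent_mass a c =
    (LBINT p. resolvent a c p)"

lemma nn_integral_resolvent:
  assumes "0 < c" "1 < a" shows "(\<integral>\<^sup>+p. ennreal (resolvent a c p) \<partial>lborel) =
      ennreal (resolvent_mass a c)"
  unfolding resolvent_mass_def using assms resolvent_pos[of c a] integrable_resolvent
  by (intro nn_integral_eq_integral) (auto intro!: AE_I2 less_imp_le)

lemma resolvent_mass_nonneg: "0 < c \<Longrightarrow> 0 \<le> resolvent_mass a c"
  unfolding resolvent_mass_def by (intro Bochner_Integration.integral_nonneg) (simp add: less_imp_le
      resolvent_pos)

lemma nn_integral_translate:
  fixes g :: "real \<Rightarrow> ennreal"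
  assumes [measurable]: "g \<in> borel_measurable borel"
  shows "(\<integral>\<^sup>+p. g (t + p) \<partial>lborel) = (\<integral>\<^sup>+p. g p \<partial>lborel)"
    "(\<integral>\<^sup>+p. g (p + t) \<partial>lborel) = (\<integral>\<^sup>+p. g p \<partial>lborel)"
    "(\<integral>\<^sup>+p. g (t - p) \<partial>lborel) = (\<integral>\<^sup>+p. g p \<partial>lborel)"
    "(\<integral>\<^sup>+p. g (- p) \<partial>lborel) = (\<integral>\<^sup>+p. g p \<partial>lborel)"
  using nn_integral_real_affine[of g 1 t] nn_integral_real_affine[of g "-1"
      t] nn_integral_real_affine[of g "-1" 0]
  by (auto simp: add.commute)

text \<open>Of the two frequencies \<open>u\<close> and \<open>w - u\<close> one has modulus at
  least \<open>\<bar>w\<bar> / 2\<close>. The resolvent there is at most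
  \<open>4 * resolvent a c w\<close>, and the other factor integrates to
  \<open>resolvent_mass a c\<close>. Covering both cases by a sum gives the 8.\<close>

lemma resolvent_conv:
  assumes "0 < c" "1 < a" "a \<le> 2"
  shows "(\<integral>\<^sup>+u. ennreal (resolvent a c u * resolvent a c (w - u)) \<partial>lborel) \<le>
      ennreal (8 * resolvent_mass a c * resolvent a c w)"
proof -
  have "resolvent a c u * resolvent a c (w - u) \<le> 4 * resolvent a c w * (resolvent a c u +
      resolvent a c (w - u))" for u
  proof (cases "\<bar>w / 2\<bar> \<le> \<bar>u\<bar>")
    case True
    then have "resolvent a c u \<le> 4 * resolvent a c w"
      using resolvent_antimono[of c a "w/2" u] resolvent_half[of c a w] assms by linarith
    then have "resolvent a c u * resolvent a c (w - u) \<le> 4 * resolvent a c w * resolvent a c (w -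
        u)"
      using assms by (intro mult_right_mono) (auto intro!: less_imp_le resolvent_pos)
    also have "\<dots> \<le> 4 * resolvent a c w * (resolvent a c u + resolvent a c (w - u))"
      using resolvent_pos[of c a u] resolvent_pos[of c a w] assms by (intro mult_left_mono) auto
    finally show ?thesis .
  next
    case False
    then have "\<bar>w / 2\<bar> \<le> \<bar>w - u\<bar>" by linarith
    then have "resolvent a c (w - u) \<le> 4 * resolvent a c w"
      using resolvent_antimono[of c a "w/2" "w - u"] resolvent_half[of c a w] assms by linarith
    then have "resolvent a c u * resolvent a c (w - u) \<le> resolvent a c u * (4 * resolvent a c w)"
      using assms by (intro mult_left_mono) (auto intro!: less_imp_le resolvent_pos)
    also have "\<dots> = 4 * resolvent a c w * resolvent a c u" by simp
    also have "\<dots> \<le> 4 * resolvent a c w * (resolvent a c u + resolvent a c (w - u))"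
      using resolvent_pos[of c a "w - u"] resolvent_pos[of c a w] assms
      by (intro mult_left_mono) auto
    finally show ?thesis .
  qed
  then have "(\<integral>\<^sup>+u. ennreal (resolvent a c u * resolvent a c (w - u)) \<partial>lborel) \<le>
     (\<integral>\<^sup>+u. ennreal (4 * resolvent a c w) * (ennreal (resolvent a c u) +
         ennreal (resolvent a c (w - u))) \<partial>lborel)"
    using resolvent_pos[of c a] assms
    by (intro nn_integral_mono) (simp add: less_imp_le flip: ennreal_plus ennreal_mult')
  also have "\<dots> = ennreal (4 * resolvent a c w) * (ennreal (resolvent_mass a c) +
      ennreal (resolvent_mass a c))"
    using assms by (simp add: nn_integral_cmult nn_integral_add nn_integral_resolvent
        nn_integral_translate(3)[of "\<lambda>u. ennreal (resolvent a c u)"])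
  also have "\<dots> = ennreal (8 * resolvent_mass a c * resolvent a c w)"
    using resolvent_mass_nonneg[of c a] resolvent_pos[of c a w] assms
    by (simp add: less_imp_le flip: ennreal_plus ennreal_mult')
  finally show ?thesis .
qed

text \<open>A Riemann sum for the Laplace transform of a time interval of length at most 1. Each
  term is at most 1, so the average \<open>s / N\<close> is at most 1; summing the geometric series
  gives \<open>b * s / N \<le> 1\<close>; the 2 is the sum of these bounds. Uniformity in
  \<open>N\<close> lets the estimate survive refinement of the grid.\<close>

lemma geometric_average:
  fixes b :: real
  assumes "0 \<le> b" "m \<le> N" "0 < N"
  shows "(\<Sum>k=1..m. exp (- (real k / N) * b)) / N \<le> 2 / (1 + b)"
proof -
  define x where "x = exp (- (b / N))"
  define s where "s = (\<Sum>k=1..m. x ^ k)"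
  have x: "0 < x" "x \<le> 1" using assms by (auto simp: x_def)
  have es: "(\<Sum>k=1..m. exp (- (real k / N) * b)) = s"
    unfolding s_def x_def by (intro sum.cong) (auto simp flip: exp_of_nat_mult)
  have s0: "0 \<le> s" unfolding s_def using x by (intro sum_nonneg) auto
  have "s \<le> (\<Sum>k=1..m. 1)" unfolding s_def using x by (intro sum_mono) (auto intro!: power_le_one)
  then have sN: "s \<le> N" using assms by simp
  have tel: "(1 - x) * s = x - x ^ Suc m"
    unfolding s_def
  proof (induction m)
    case (Suc m)
    have "(1 - x) * (\<Sum>k=1..Suc m. x ^ k) = (1 - x) * (\<Sum>k=1..m. x ^ k) + (1 - x) * x ^ Suc m"
      by (simp add: distrib_left)
    also have "\<dots> = x - x ^ Suc (Suc m)" by (subst Suc) (simp add: left_diff_distrib)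
    finally show ?case .
  qed simp
  \<comment> \<open>Equivalent to \<open>1 + b / N \<le> exp (b / N)\<close>. It avoids dividing by
    \<open>1 - x\<close>, which vanishes for \<open>b = 0\<close>.\<close>
  have "(b / N) * x \<le> 1 - x"
  proof -
    have "(1 + b / N) * x \<le> exp (b / N) * x"
      using x by (intro mult_right_mono exp_ge_add_one_self) auto
    also have "\<dots> = 1" by (simp add: x_def flip: exp_add)
    finally show ?thesis by (simp add: algebra_simps)
  qed
  then have "(b / N) * x * s \<le> (1 - x) * s" using s0 by (intro mult_right_mono)
  also have "\<dots> \<le> x" using tel x by simp
  finally have "x * (b * s / N) \<le> x * 1" by (simp add: algebra_simps)
  then have "b * s / N \<le> 1" using x(1) by (rule mult_left_le_imp_le)
  moreover have "s / N \<le> 1" using sN assms by simp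
  ultimately have "(1 + b) * (s / N) \<le> 2" by (simp add: algebra_simps add_divide_distrib)
  then show ?thesis unfolding es using assms by (simp add: field_simps)
qed

section \<open>A good-lambda inequality\<close>

text \<open>
  After each exit from a band of width \<open>4 * k\<close> the path ends, with conditional probability at least
  \<open>3/4\<close>, within \<open>2 * k\<close> of the exit point, so it is then at distance more than \<open>2 * k\<close> from
  where it started; Chebyshev bounds the probability of that. The sets \<open>G j\<close> restrict to histories
  on which the conditional variance is controlled.
\<close>
lemma (in prob_space) good_lambda:
  fixes F :: "nat \<Rightarrow> 'a measure" and d :: "nat \<Rightarrow> nat \<Rightarrow> 'a \<Rightarrow> real" and G :: "nat \<Rightarrow> 'a set"
  assumes F: "\<And>j. space (F j) = space M" "\<And>j. sets (F j) \<subseteq> sets M"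
      "\<And>i j. i \<le> j \<Longrightarrow> sets (F i) \<subseteq> sets (F j)"
    and d_meas: "\<And>i j. i \<le> j \<Longrightarrow> j \<le> m \<Longrightarrow> d i j \<in> borel_measurable (F j)"
    and d_nonneg: "\<And>i j w. 0 \<le> d i j w"
    and d_refl: "\<And>i w. d i i w = 0"
    and d_tri: "\<And>i j k w. i \<le> j \<Longrightarrow> j \<le> k \<Longrightarrow> k \<le> m \<Longrightarrow> d i k w \<le> d i j w + d j k w"
    and d_tri': "\<And>i j k w. i \<le> j \<Longrightarrow> j \<le> k \<Longrightarrow> k \<le> m \<Longrightarrow> d i j w \<le> d i k w + d j k w"
    and d_step: "\<And>j w. j < m \<Longrightarrow> w \<in> space M \<Longrightarrow> d j (Suc j) w \<le> h"
    and G: "\<And>j. G j \<in> sets (F j)" "\<And>i j. i \<le> j \<Longrightarrow> G j \<subseteq> G i"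
    and k: "0 < k" and h: "0 \<le> h"
    and bound: "\<And>j E. j \<le> m \<Longrightarrow> E \<in> sets (F j) \<Longrightarrow> E \<subseteq> G j \<Longrightarrow>
        (\<integral>\<^sup>+w. ennreal ((d j m w)\<^sup>2) * indicator E w \<partial>M) \<le> ennreal (k\<^sup>2) * emeasure M E"
  shows "i \<le> m \<Longrightarrow> E \<in> sets (F i) \<Longrightarrow>
    prob {w\<in>E. \<exists>j. i \<le> j \<and> j \<le> m \<and> w \<in> G j \<and> real l * (4 * k + h) \<le> d i j w} \<le> (1/2) ^ l * prob E"
proof (induction l arbitrary: i E)
  case 0
  have "E \<in> sets M" using 0 F by blast
  then show ?case by (auto intro!: finite_measure_mono)
next
  case (Suc l)
  have FM: "A \<in> sets M" if "A \<in> sets (F j)" for A j using that F by blast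
  have subsp: "w \<in> space M" if "w \<in> A" "A \<in> sets (F j)" for A j w
    using that sets.sets_into_space[of A "F j"] F(1) by auto
  have dM [measurable]: "d i j \<in> borel_measurable M" if "i \<le> j" "j \<le> m" for i j
  proof -
    have "d i j \<in> borel_measurable (F j)" using d_meas that by auto
    then show ?thesis using F by (intro measurable_from_subalg[of M
        "F j"]) (auto simp: subalgebra_def)
  qed
  have EsM: "E \<subseteq> space M" using subsp Suc.prems(2) by blast
  \<comment> \<open>The first exit from the band of width \<open>4 * k\<close> around the value at
    \<open>i\<close> happens at \<open>r\<close>, with history in \<open>G r\<close>. Since
    \<open>E' r\<close> is known at time \<open>r\<close>, both \<open>bound\<close> and the
    induction hypothesis apply to it.\<close>
  define E' where "E' r = {w\<in>E. w \<in> G r \<and> 4 * k \<le> d i r w \<and> (\<forall>j. i \<le> j \<and> j < r \<longrightarrow> d i j w < 4 * k)}"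
      for r
  have E'F: "E' r \<in> sets (F r)" if r: "i \<le> r" "r \<le> m" for r
  proof -
    have "E \<in> sets (F r)" using Suc.prems F(3) r by blast
    have "{w\<in>space (F r). 4 * k \<le> d i r w} \<in> sets (F r)" 
      using d_meas[OF r] by (intro borel_measurable_le) auto
    moreover have "{w\<in>space (F r). d i j w < 4 * k} \<in> sets (F r)" if j: "j \<in> {i..<r}" for j
    proof -
      have "{w\<in>space (F j). d i j w < 4 * k} \<in> sets (F j)" 
        using d_meas[of i j] j r by (intro borel_measurable_less) auto
      then show ?thesis using F(3)[of j r] F(1) j by auto
    qed
    then have "{w\<in>space (F r). \<forall>j\<in>{i..<r}. d i j w < 4 * k} \<in> sets (F r)"
      by (intro sets.sets_Collect_finite_All) auto
    moreover have "E' r = E \<inter> G r \<inter> {w\<in>space (F r). 4 * k \<le>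
        d i r w} \<inter> {w\<in>space (F r). \<forall>j\<in>{i..<r}. d i j w < 4 * k}"
      using EsM unfolding E'_def F(1) by auto
    ultimately show ?thesis using G(1) \<open>E \<in> sets (F r)\<close> by auto
  qed
  have E'M: "E' r \<in> sets M" if "r \<in> {i..m}" for r using E'F[of r] FM that by auto
  have disj: "disjoint_family_on E' {i..m}"
    unfolding disjoint_family_on_def
  proof (intro ballI impI)
    fix r q assume rq: "r \<in> {i..m}" "q \<in> {i..m}" "r \<noteq> q"
    then consider "r < q" | "q < r" by linarith
    then show "E' r \<inter> E' q = {}" using rq unfolding E'_def by cases force+
  qed
  have EM: "E \<in> sets M" using FM Suc.prems by blast
  \<comment> \<open>One index before the exit the distance is below \<open>4 * k\<close>, and one
    step adds at most \<open>h\<close>. Hence the unit \<open>4 * k + h\<close> for each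
    level.\<close>
  have d_ir: "d i r w < 4 * k + h" if "w \<in> E' r" "i \<le> r" "r \<le> m" for r w
  proof (cases "r = i")
    case True
    then show ?thesis using that d_refl k unfolding E'_def by auto
  next
    case False
    then have "i < r" using that by simp
    then obtain r' where r': "r = Suc r'" "i \<le> r'" by (cases r) auto
    then have "d i r w \<le> d i r' w + d r' r w" using that d_tri[of i r' r w] by auto
    moreover have "d i r' w < 4 * k" using that r' unfolding E'_def by auto
    moreover have "d r' r w \<le> h" using d_step[of r' w] r' that E'F[of r] subsp by auto
    ultimately show ?thesis by linarith
  qed
  have step: "prob (E' r) \<le> (4/3) * prob (E' r \<inter> {w\<in>space M. 2 * k < d i m w})" if r: "r \<in> {i..m}"
      for r
  proof -
    let ?D = "{w\<in>E' r. 2 * k \<le> d r m w}"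
    have r': "i \<le> r" "r \<le> m" using r by auto
    have [measurable]: "E' r \<in> sets M" "d r m \<in> borel_measurable M" "d i m \<in> borel_measurable M"
      using E'M r r' by auto
    have D: "?D = E' r \<inter> {w\<in>space M. 2 * k \<le> d r m w}"
      using subsp E'F[OF r'] by blast
    have [measurable]: "?D \<in> sets M" unfolding D by measurable
    have "ennreal (4 * k\<^sup>2) * emeasure M ?D = (\<integral>\<^sup>+w. ennreal (4 * k\<^sup>2) * indicator ?D w \<partial>M)"
      by (subst nn_integral_cmult_indicator) auto
    also have "\<dots> \<le> (\<integral>\<^sup>+w. ennreal ((d r m w)\<^sup>2) * indicator (E' r) w \<partial>M)"
    proof (intro nn_integral_mono)
      fix w
      show "ennreal (4 * k\<^sup>2) * indicator ?D w \<le> ennreal ((d r m w)\<^sup>2) * indicator (E' r) w"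
        using power_mono[of "2 * k" "d r m w" 2] k
        by (auto simp: indicator_def power_mult_distrib intro!: ennreal_leI)
    qed
    also have "\<dots> \<le> ennreal (k\<^sup>2) * emeasure M (E' r)"
      by (intro bound E'F r') (auto simp: E'_def)
    finally have "4 * k\<^sup>2 * prob ?D \<le> k\<^sup>2 * prob (E' r)"
      using k by (simp add: emeasure_eq_measure flip: ennreal_mult')
    then have D4: "4 * prob ?D \<le> prob (E' r)" using k by (simp add: power2_eq_square)
    have "prob (E' r) \<le> prob (?D \<union> (E' r \<inter> {w\<in>space M. 2 * k < d i m w}))"
    proof (intro finite_measure_mono subsetI)
      fix w assume w: "w \<in> E' r"
      have "d i r w \<le> d i m w + d r m w" using d_tri' r' by auto
      then show "w \<in> ?D \<union> (E' r \<inter> {w\<in>space M. 2 * k < d i m w})"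
        using w subsp[OF w E'F[OF r']] unfolding E'_def by auto
    qed auto
    also have "\<dots> \<le> prob ?D + prob (E' r \<inter> {w\<in>space M. 2 * k < d i m w})"
      by (intro measure_Un_le) auto
    finally show ?thesis using D4 by simp
  qed
  let ?S = "real (Suc l) * (4 * k + h)"
  \<comment> \<open>The same problem restarted at the exit time, with one level fewer.\<close>
  let ?B = "\<lambda>r. {w\<in>E' r. \<exists>j. r \<le> j \<and> j \<le> m \<and> w \<in> G j \<and> real l * (4 * k + h) \<le> d r j w}"
  have Bm: "?B r \<in> sets M" if r: "r \<in> {i..m}" for r
  proof -
    have "?B r = E' r \<inter> (\<Union>j\<in>{r..m}. G j \<inter> {w\<in>space M. real l * (4 * k + h) \<le> d r j w})"
      using subsp[OF _ G(1)] by auto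
    also have "\<dots> \<in> sets M"
    proof (intro sets.Int E'M r sets.finite_UN)
      fix j assume j: "j \<in> {r..m}"
      show "G j \<in> sets M" using G(1) FM by blast
      have [measurable]: "d r j \<in> borel_measurable M" using j by auto
      show "{w\<in>space M. real l * (4 * k + h) \<le> d r j w} \<in> sets M" by measurable
    qed auto
    finally show ?thesis .
  qed
  have "{w\<in>E. \<exists>j. i \<le> j \<and> j \<le> m \<and> w \<in> G j \<and> ?S \<le> d i j w} \<subseteq> (\<Union>r\<in>{i..m}. ?B r)"
  proof safe
    fix w j assume w: "w \<in> E" and j: "i \<le> j" "j \<le> m" "w \<in> G j" "?S \<le> d i j w"
    have kh: "4 * k \<le> 4 * k + h" "0 \<le> 4 * k + h" using k h by auto
    have "4 * k + h \<le> real (Suc l) * (4 * k + h)"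
      using kh mult_right_mono[of 1 "real (Suc l)" "4 * k + h"] by simp
    then have ex: "4 * k \<le> d i j w" using j kh by linarith
    define P where "P r \<longleftrightarrow> i \<le> r \<and> 4 * k \<le> d i r w" for r
    define r where "r = Least P"
    have "P j" using ex j by (simp add: P_def)
    then have "P r" "r \<le> j" unfolding r_def by (auto intro: LeastI Least_le)
    then have r: "i \<le> r" "4 * k \<le> d i r w" "r \<le> j" by (auto simp: P_def)
    have rl: "d i q w < 4 * k" if "i \<le> q" "q < r" for q
    proof -
      have "\<not> P q" using not_less_Least[of q P] that by (simp add: r_def)
      then show ?thesis using that by (simp add: P_def)
    qed
    \<comment> \<open>Membership in \<open>G j\<close> passes down to the earlier index
      \<open>r\<close> because the sets \<open>G\<close> decrease.\<close>
    have wr: "w \<in> E' r"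
      unfolding E'_def using w r rl G(2)[of r j] j by auto
    have "d i j w \<le> d i r w + d r j w" using d_tri r j by auto
    moreover have "d i r w < 4 * k + h" using d_ir[OF wr] r j by auto
    ultimately have "real l * (4 * k + h) \<le> d r j w" using j by (simp add: algebra_simps)
    then have "w \<in> ?B r" using r j wr by blast
    moreover have "r \<in> {i..m}" using r j by simp
    ultimately show "w \<in> (\<Union>r\<in>{i..m}. ?B r)" by blast
  qed
  then have "prob {w\<in>E. \<exists>j. i \<le> j \<and> j \<le> m \<and> w \<in> G j \<and> ?S \<le> d i j w} \<le> prob (\<Union>r\<in>{i..m}. ?B r)"
    by (rule finite_measure_mono) (intro sets.finite_UN Bm finite_atLeastAtMost)
  also have "\<dots> \<le> (\<Sum>r\<in>{i..m}. prob (?B r))"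
    by (intro measure_UNION_le Bm finite_atLeastAtMost)
  also have "\<dots> \<le> (\<Sum>r\<in>{i..m}. (1/2) ^ l * ((4/3) * prob (E' r \<inter> {w\<in>space M. 2 * k < d i m w})))"
  proof (intro sum_mono)
    fix r assume r: "r \<in> {i..m}"
    have "prob (?B r) \<le> (1/2) ^ l * prob (E' r)" using r E'F[of r] by (intro Suc.IH) auto
    also have "\<dots> \<le> (1/2) ^ l * ((4/3) * prob (E' r \<inter> {w\<in>space M. 2 * k < d i m w}))"
      using step[OF r] by (intro mult_left_mono) auto
    finally show "prob (?B r) \<le> (1/2) ^ l * ((4/3) * prob (E' r \<inter> {w\<in>space M. 2 * k < d i m w}))" .
  qed
  also have "\<dots> = (1/2) ^ l * ((4/3) * (\<Sum>r\<in>{i..m}. prob (E' r \<inter> {w\<in>space M. 2 * k < d i m w})))"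
    by (simp add: sum_distrib_left)
  also have "(\<Sum>r\<in>{i..m}. prob (E' r \<inter> {w\<in>space M. 2 * k < d i m w})) =
      prob (\<Union>r\<in>{i..m}. E' r \<inter> {w\<in>space M. 2 * k < d i m w})"
  proof (intro finite_measure_finite_Union[symmetric])
    have [measurable]: "d i m \<in> borel_measurable M" using Suc.prems by auto
    have "{w\<in>space M. 2 * k < d i m w} \<in> sets M" by measurable
    then show "(\<lambda>r. E' r \<inter> {w\<in>space M. 2 * k < d i m w}) ` {i..m} \<subseteq> sets M"
      by (intro image_subsetI sets.Int E'M)
    show "disjoint_family_on (\<lambda>r. E' r \<inter> {w\<in>space M. 2 * k < d i m w}) {i..m}"
      using disj unfolding disjoint_family_on_def by blast
  qed auto
  also have "\<dots> \<le> prob ((E \<inter> G i) \<inter> {w\<in>space M. 2 * k < d i m w})"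
  proof (intro finite_measure_mono)
    have [measurable]: "d i m \<in> borel_measurable M" using Suc.prems by auto
    have "{w\<in>space M. 2 * k < d i m w} \<in> sets M" by measurable
    then show "E \<inter> G i \<inter> {w\<in>space M. 2 * k < d i m w} \<in> sets M"
      by (intro sets.Int EM FM[OF G(1)])
    show "(\<Union>r\<in>{i..m}. E' r \<inter> {w\<in>space M. 2 * k < d i m w}) \<subseteq> E \<inter> G i \<inter> {w\<in>space M. 2 * k < d i m w}"
    proof (intro UN_least subsetI)
      fix r w assume "r \<in> {i..m}" "w \<in> E' r \<inter> {w\<in>space M. 2 * k < d i m w}"
      then show "w \<in> E \<inter> G i \<inter> {w\<in>space M. 2 * k < d i m w}"
        using G(2)[of i r] unfolding E'_def by auto
    qed
  qed
  \<comment> \<open>Chebyshev from time \<open>i\<close>, with ratio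
    \<open>k\<^sup>2 / (2 * k)\<^sup>2\<close>. With the 4/3 from \<open>step\<close> each level
    costs 1/3, which is below the claimed 1/2.\<close>
  also have "\<dots> \<le> (1/4) * prob E"
  proof -
    have [measurable]: "E \<in> sets M" "G i \<in> sets M" "d i m \<in> borel_measurable M"
      using EM FM G(1) Suc.prems by auto
    let ?A = "(E \<inter> G i) \<inter> {w\<in>space M. 2 * k < d i m w}"
    have "ennreal (4 * k\<^sup>2) * emeasure M ?A = (\<integral>\<^sup>+w. ennreal (4 * k\<^sup>2) * indicator ?A w \<partial>M)"
      by (subst nn_integral_cmult_indicator) auto
    also have "\<dots> \<le> (\<integral>\<^sup>+w. ennreal ((d i m w)\<^sup>2) * indicator (E \<inter> G i) w \<partial>M)"
    proof (intro nn_integral_mono)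
      fix w
      show "ennreal (4 * k\<^sup>2) * indicator ?A w \<le> ennreal ((d i m w)\<^sup>2) * indicator (E \<inter> G i) w"
        using power_mono[of "2 * k" "d i m w" 2] k
        by (auto simp: indicator_def power_mult_distrib intro!: ennreal_leI)
    qed
    also have "\<dots> \<le> ennreal (k\<^sup>2) * emeasure M (E \<inter> G i)"
      using Suc.prems G(1) by (intro bound) auto
    also have "\<dots> \<le> ennreal (k\<^sup>2) * emeasure M E"
      by (intro mult_left_mono emeasure_mono) auto
    finally have "4 * k\<^sup>2 * prob ?A \<le> k\<^sup>2 * prob E"
      using k by (simp add: emeasure_eq_measure flip: ennreal_mult')
    then show ?thesis using k by (simp add: power2_eq_square)
  qed
  finally have "prob {w\<in>E. \<exists>j. i \<le> j \<and> j \<le> m \<and> w \<in> G j \<and> ?S \<le> d i j w} \<le>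
      (1/2) ^ l * ((4/3) * ((1/4) * prob E))"
    by simp
  also have "\<dots> \<le> (1/2) ^ l * ((1/2) * prob E)" by (intro mult_left_mono) auto
  finally show ?case by simp
qed

section \<open>Covariances of the regularised kernel\<close>

definition levy_exponent :: "real \<Rightarrow> real \<Rightarrow> real \<Rightarrow> real" where
  "levy_exponent a c p = c * \<bar>p\<bar> powr a"

lemma resolvent_levy_exponent: "resolvent a c p = 1 / (1 + levy_exponent a c p)"
  by (simp add: resolvent_def levy_exponent_def)

lemma levy_exponent_measurable [measurable]: "levy_exponent a c \<in> borel_measurable borel"
  unfolding levy_exponent_def[abs_def] by measurable

lemma levy_exponent_nonneg: "0 \<le> c \<Longrightarrow> 0 \<le> levy_exponent a c p"
  by (simp add: levy_exponent_def)

lemma levy_exponent_minus [simp]: "levy_exponent a c (- p) = levy_exponent a c p"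
  by (simp add: levy_exponent_def)

lemma levy_exponent_0 [simp]: "levy_exponent a c 0 = 0"
  by (simp add: levy_exponent_def)

lemma levy_exponent_mono: "0 \<le> c \<Longrightarrow> 0 \<le> a \<Longrightarrow> \<bar>p\<bar> \<le> \<bar>q\<bar> \<Longrightarrow> levy_exponent a c p \<le> levy_exponent a c q"
  unfolding levy_exponent_def by (intro mult_left_mono powr_mono2) auto

lemma levy_exponent_diff_commute: "levy_exponent a c (p - q) = levy_exponent a c (q - p)"
  by (metis levy_exponent_minus minus_diff_eq)

text \<open>Up to the factor \<open>- 1 / (2 * pi)\<close>, the derivative of the Gaussian approximation of the Dirac delta.\<close>
definition delta_deriv :: "real \<Rightarrow> real \<Rightarrow> real" where
  "delta_deriv e x = (LBINT p. freq_kernel e p * sin (p * x))"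

definition freq_kernel_norm :: "real \<Rightarrow> real" where
  "freq_kernel_norm e = (LBINT p. \<bar>freq_kernel e p\<bar>)"

lemma freq_kernel_norm_nonneg: "0 \<le> freq_kernel_norm e"
  unfolding freq_kernel_norm_def by simp

lemma integrable_freq_kernel_times:
  assumes "0 < e" and [measurable]: "g \<in> borel_measurable borel" and g: "\<And>p. \<bar>g p\<bar> \<le> 1"
  shows "integrable lborel (\<lambda>p. freq_kernel e p * g p)"
  by (rule Bochner_Integration.integrable_bound[OF integrable_freq_kernel[OF assms(1)]])
     (auto simp: abs_mult intro!: AE_I2 mult_left_le g)

lemma delta_deriv_bound: assumes "0 < e" shows "\<bar>delta_deriv e x\<bar> \<le> freq_kernel_norm e"
proof -
  have "\<bar>delta_deriv e x\<bar> \<le> (LBINT p. \<bar>freq_kernel e p * sin (p * x)\<bar>)"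
    unfolding delta_deriv_def by (rule integral_abs_bound)
  also have "\<dots> \<le> freq_kernel_norm e" unfolding freq_kernel_norm_def using assms
    by (intro integral_mono integrable_abs integrable_freq_kernel_times integrable_freq_kernel)
       (auto simp: abs_mult intro!: mult_left_le)
  finally show ?thesis .
qed

lemma delta_deriv_continuous: assumes "0 < e" shows "continuous_on UNIV (delta_deriv e)"
proof (rule continuous_on_sequentiallyI)
  fix u :: "nat \<Rightarrow> real" and x assume u: "u \<longlonglongrightarrow> x"
  show "(\<lambda>n. delta_deriv e (u n)) \<longlonglongrightarrow> delta_deriv e x"
    unfolding delta_deriv_def
    by (rule integral_dominated_convergence[where w = "\<lambda>p. \<bar>freq_kernel e p\<bar>"])
       (use u assms in \<open>auto intro!: tendsto_intros integrable_abs integrable_freq_kernel AE_I2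
           mult_left_le simp: abs_mult\<close>)
qed

lemma delta_deriv_measurable [measurable]: assumes "0 < e" shows "delta_deriv e \<in>
    borel_measurable borel"
  using delta_deriv_continuous[OF assms] by (rule borel_measurable_continuous_onI)

section \<open>Products of the kernel as integrals over pairs of frequencies\<close>

abbreviation "plane \<equiv> (lborel \<Otimes>\<^sub>M lborel :: (real \<times> real) measure)"

lemma integrable_freq_kernel_freq_kernel:
  assumes "0 < e" shows "integrable plane (\<lambda>z. freq_kernel e (fst z) * freq_kernel e (snd z))"
proof (rule lborel_pair.Fubini_integrable)
  show "integrable lborel (\<lambda>x. LBINT y. norm (freq_kernel e (fst (x, y)) *
      freq_kernel e (snd (x, y))))"
    using integrable_abs[OF integrable_freq_kernel[OF assms]] by (simp add: abs_mult)
  show "AE x in lborel. integrable lborel (\<lambda>y. freq_kernel e (fst (x, y)) *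
      freq_kernel e (snd (x, y)))"
    using integrable_freq_kernel[OF assms] by simp
qed simp

lemma integrable_freq_kernel_freq_kernel_times:
  assumes "0 < e" and [measurable]: "g \<in> borel_measurable (borel \<Otimes>\<^sub>M borel)" and g: "\<And>z. \<bar>g z\<bar> \<le> 1"
  shows "integrable plane (\<lambda>z. freq_kernel e (fst z) * freq_kernel e (snd z) * g z)"
  by (rule Bochner_Integration.integrable_bound[OF integrable_freq_kernel_freq_kernel[OF assms(1)]])
     (auto simp: abs_mult intro!: AE_I2 mult_left_le g)

lemma plane_integral: 
  fixes h :: "real \<times> real \<Rightarrow> real"
  assumes "integrable plane h" shows "(\<integral>z. h z \<partial>plane) = (LBINT p. LBINT q. h (p, q))"
  using lborel_pair.integral_fst'[OF assms] by simp

lemma delta_deriv_delta_deriv: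
  assumes "0 < e"
  shows "delta_deriv e x * delta_deriv e y = (\<integral>z. freq_kernel e (fst z) * freq_kernel e (snd z) *
      (sin (fst z * x) * sin (snd z * y)) \<partial>plane)"
proof -
  have "(\<integral>z. freq_kernel e (fst z) * freq_kernel e (snd z) * (sin (fst z * x) *
      sin (snd z * y)) \<partial>plane) =
    (LBINT p. LBINT q. freq_kernel e p * sin (p * x) * (freq_kernel e q * sin (q * y)))"
    by (subst plane_integral[OF integrable_freq_kernel_freq_kernel_times[OF assms]])
       (auto simp: abs_mult mult_ac intro!: mult_le_one)
  also have "\<dots> = delta_deriv e x * delta_deriv e y" by (simp add: delta_deriv_def)
  finally show ?thesis by simp
qed

text \<open>
  The expectation of \<open>f(X) f(Y)\<close> for increments \<open>X\<close>, \<open>Y\<close> of a walk over two index intervals;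
  \<open>A\<close>, \<open>B\<close>, \<open>C\<close> are the lengths of the first interval alone, the overlap, and the second
  interval alone. The difference of exponentials comes from \<open>sin x * sin y\<close> and makes the integrand nonnegative.
\<close>
definition kernel_cov :: "real \<Rightarrow> real \<Rightarrow> real \<Rightarrow> real \<Rightarrow> real \<Rightarrow> real \<Rightarrow> real" where
  "kernel_cov a c e A B C = (1/2) * (\<integral>z. freq_kernel e (fst z) * freq_kernel e (snd z) *
     (exp (- (A * levy_exponent a c (fst z) + C * levy_exponent a c (snd z))) *
      (exp (- (B * levy_exponent a c (fst z - snd z))) -
          exp (- (B * levy_exponent a c (fst z + snd z))))) \<partial>plane)"

lemma kernel_cov_kernel_bound:
  assumes "0 \<le> c" "0 \<le> A" "0 \<le> B" "0 \<le> C"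
  shows "\<bar>exp (- (A * levy_exponent a c p + C * levy_exponent a c q)) *
      (exp (- (B * levy_exponent a c (p - q))) - exp (- (B * levy_exponent a c (p + q))))\<bar> \<le> 1"
proof -
  have l: "0 \<le> x * levy_exponent a c p" if "0 \<le> x"
      for x p using that assms levy_exponent_nonneg[of c a p] by simp
  have "exp (- (A * levy_exponent a c p + C * levy_exponent a c q)) \<le> 1"
    using l[of A p] l[of C q] assms by simp
  moreover have "exp (- (B * levy_exponent a c (p - q))) \<le> 1"
      "exp (- (B * levy_exponent a c (p + q))) \<le> 1"
    "exp (- (B * levy_exponent a c (p - q))) > 0" "exp (- (B * levy_exponent a c (p + q))) > 0"
    using l[of B "p - q"] l[of B "p + q"] assms by auto
  then have "\<bar>exp (- (B * levy_exponent a c (p - q))) - exp (- (B * levy_exponent a c (p + q)))\<bar> \<le>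
      1" by linarith
  ultimately show ?thesis unfolding abs_mult by (intro mult_le_one) auto
qed

lemma kernel_cov_integrable:
  assumes "0 < e" "0 \<le> c" "0 \<le> A" "0 \<le> B" "0 \<le> C"
  shows "integrable plane (\<lambda>z. freq_kernel e (fst z) * freq_kernel e (snd z) *
     (exp (- (A * levy_exponent a c (fst z) + C * levy_exponent a c (snd z))) *
      (exp (- (B * levy_exponent a c (fst z - snd z))) -
          exp (- (B * levy_exponent a c (fst z + snd z))))))"
  using assms kernel_cov_kernel_bound by (intro integrable_freq_kernel_freq_kernel_times) auto

text \<open>The sign of \<open>p * q\<close> decides which of \<open>\<bar>p - q\<bar>\<close> and
  \<open>\<bar>p + q\<bar>\<close> is larger, and the exponent increases with the modulus.
  Nonnegative covariances allow sums over index tuples to be enlarged for upper bounds and thinned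
  out for the lower bound.\<close>

lemma kernel_cov_integrand_nonneg:
  assumes "0 \<le> c" "0 \<le> a" "0 \<le> B"
  shows "0 \<le> freq_kernel e p * freq_kernel e q *
      (exp (- (A * levy_exponent a c p + C * levy_exponent a c q)) *
      (exp (- (B * levy_exponent a c (p - q))) - exp (- (B * levy_exponent a c (p + q)))))"
proof -
  have eq: "freq_kernel e p * freq_kernel e q *
      (exp (- (A * levy_exponent a c p + C * levy_exponent a c q)) *
      (exp (- (B * levy_exponent a c (p - q))) - exp (- (B * levy_exponent a c (p + q))))) =
    exp (- (e * p\<^sup>2 / 2)) * exp (- (e * q\<^sup>2 / 2)) * exp (- (A * levy_exponent a c p + C *
        levy_exponent a c q)) *
     (p * q * (exp (- (B * levy_exponent a c (p - q))) - exp (- (B * levy_exponent a c (p + q)))))"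
    by (simp add: freq_kernel_def)
  have "0 \<le> p * q * (exp (- (B * levy_exponent a c (p - q))) -
      exp (- (B * levy_exponent a c (p + q))))"
  proof (cases "0 \<le> p * q")
    case True
    then have "\<bar>p - q\<bar> \<le> \<bar>p + q\<bar>" by (auto simp: zero_le_mult_iff)
    then have "B * levy_exponent a c (p - q) \<le> B * levy_exponent a c (p + q)"
      using assms by (intro mult_left_mono levy_exponent_mono)
    then show ?thesis using True by simp
  next
    case False
    then have "\<bar>p + q\<bar> \<le> \<bar>p - q\<bar>" by (auto simp: zero_le_mult_iff)
    then have "B * levy_exponent a c (p + q) \<le> B * levy_exponent a c (p - q)"
      using assms by (intro mult_left_mono levy_exponent_mono)
    then show ?thesis using False by (intro mult_nonpos_nonpos) auto
  qed
  then show ?thesis unfolding eq by (rule mult_nonneg_nonneg[rotated]) simp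
qed

lemma kernel_cov_nonneg:
  assumes "0 \<le> c" "0 \<le> a" "0 \<le> B" shows "0 \<le> kernel_cov a c e A B C"
  unfolding kernel_cov_def
  by (intro mult_nonneg_nonneg Bochner_Integration.integral_nonneg kernel_cov_integrand_nonneg
      assms) simp

lemma kernel_cov_0 [simp]: "kernel_cov a c e A 0 C = 0"
  by (simp add: kernel_cov_def)

lemma kernel_cov_commute: "kernel_cov a c e A B C = kernel_cov a c e C B A"
proof -
  define h where "h A C = (\<lambda>z. freq_kernel e (fst z) * freq_kernel e (snd z) *
     (exp (- (A * levy_exponent a c (fst z) + C * levy_exponent a c (snd z))) *
      (exp (- (B * levy_exponent a c (fst z - snd z))) -
          exp (- (B * levy_exponent a c (fst z + snd z))))))" for A C
  have [measurable]: "h A C \<in> borel_measurable plane" for A C unfolding h_def by measurable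
  have "(\<integral>z. h A C z \<partial>plane) = (\<integral>(x, y). h A C (y, x) \<partial>plane)"
    by (rule lborel_pair.integral_product_swap[symmetric]) measurable
  also have "\<dots> = (\<integral>z. h C A z \<partial>plane)"
  proof (intro Bochner_Integration.integral_cong refl)
    fix z :: "real \<times> real"
    show "(case z of (x, y) \<Rightarrow> h A C (y, x)) = h C A z"
      using levy_exponent_diff_commute[of a c "snd z" "fst z"]
      by (simp add: h_def case_prod_beta add.commute mult.commute)
  qed
  finally show ?thesis unfolding kernel_cov_def h_def by simp
qed

lemma plane_nn_integral:
  assumes [measurable]: "(\<lambda>z. h (fst z) (snd z)) \<in> borel_measurable (borel \<Otimes>\<^sub>M borel)"
  shows "(\<integral>\<^sup>+z. h (fst z) (snd z) \<partial>plane) = (\<integral>\<^sup>+p. \<integral>\<^sup>+q. h p q \<partial>lborel \<partial>lborel)"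
  using lborel.nn_integral_fst[of "\<lambda>z. h (fst z) (snd z)" lborel] by simp

text \<open>Absolute values are affordable here: once all three lengths are averaged, the integrand
  decays in \<open>p\<close>, in \<open>p + q\<close> and in \<open>q\<close>. Reflecting
  \<open>q\<close> turns the term with \<open>p - q\<close> into the one with \<open>p + q\<close>,
  which uses up the factor 1/2 in \<open>kernel_cov\<close>.\<close>

lemma kernel_cov_le_interleaved:
  assumes "0 < e" "0 \<le> c" "0 \<le> A" "0 \<le> B" "0 \<le> C"
  shows "ennreal (kernel_cov a c e A B C) \<le>
      (\<integral>\<^sup>+p. \<integral>\<^sup>+q. ennreal (\<bar>freq_kernel e p\<bar> * \<bar>freq_kernel e q\<bar> *
     exp (- (A * levy_exponent a c p + B * levy_exponent a c (p + q) + C *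
         levy_exponent a c q))) \<partial>lborel \<partial>lborel)"
proof -
  define I where "I p q = \<bar>freq_kernel e p\<bar> * \<bar>freq_kernel e q\<bar> *
     exp (- (A * levy_exponent a c p + B * levy_exponent a c (p + q) + C * levy_exponent a c q))"
         for p q
  have [measurable]: "(\<lambda>z. I (fst z) (snd z)) \<in> borel_measurable (borel \<Otimes>\<^sub>M borel)"
    unfolding I_def by measurable
  have [measurable]: "(\<lambda>z. I (fst z) (- snd z)) \<in> borel_measurable (borel \<Otimes>\<^sub>M borel)"
    unfolding I_def by measurable
  have [measurable]: "I p \<in> borel_measurable borel" for p
    unfolding I_def by measurable
  let ?h = "\<lambda>z. freq_kernel e (fst z) * freq_kernel e (snd z) *
     (exp (- (A * levy_exponent a c (fst z) + C * levy_exponent a c (snd z))) *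
      (exp (- (B * levy_exponent a c (fst z - snd z))) -
          exp (- (B * levy_exponent a c (fst z + snd z)))))"
  have I0: "0 \<le> I p q" for p q by (simp add: I_def)
  have hI: "\<bar>?h (p, q)\<bar> \<le> I p (- q) + I p q" for p q
  proof -
    have "\<bar>?h (p, q)\<bar> = \<bar>freq_kernel e p\<bar> * \<bar>freq_kernel e q\<bar> * exp (- (A * levy_exponent a c p +
        C * levy_exponent a c q)) *
      \<bar>exp (- (B * levy_exponent a c (p - q))) - exp (- (B * levy_exponent a c (p + q)))\<bar>"
      by (simp add: abs_mult)
    also have "\<dots> \<le> \<bar>freq_kernel e p\<bar> * \<bar>freq_kernel e q\<bar> * exp (- (A * levy_exponent a c p + C *
        levy_exponent a c q)) *
      (exp (- (B * levy_exponent a c (p - q))) + exp (- (B * levy_exponent a c (p + q))))"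
      by (intro mult_left_mono order_trans[OF abs_triangle_ineq4]) auto
    also have "\<dots> = I p (- q) + I p q"
      unfolding I_def by (simp add: exp_add exp_diff exp_minus field_simps)
    finally show ?thesis .
  qed
  have "ennreal (kernel_cov a c e A B C) \<le> ennreal (1/2) * ennreal (norm (\<integral>z. ?h z \<partial>plane))"
    unfolding kernel_cov_def by (subst ennreal_mult'[symmetric]) (auto intro!: ennreal_leI)
  also have "\<dots> \<le> ennreal (1/2) * (\<integral>\<^sup>+z. ennreal (norm (?h z)) \<partial>plane)"
    using kernel_cov_integrable[OF assms] by (intro mult_left_mono integral_norm_bound_ennreal) auto
  also have "\<dots> \<le> ennreal (1/2) * (\<integral>\<^sup>+z. ennreal (I (fst z) (- snd z)) +
      ennreal (I (fst z) (snd z)) \<partial>plane)"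
  proof (intro mult_left_mono nn_integral_mono)
    fix z :: "real \<times> real"
    show "ennreal (norm (?h z)) \<le> ennreal (I (fst z) (- snd z)) + ennreal (I (fst z) (snd z))"
      using hI[of "fst z" "snd z"] I0
      by (subst ennreal_plus[symmetric]) (auto simp del: ennreal_plus intro!: ennreal_leI)
  qed auto
  also have "\<dots> = ennreal (1/2) * ((\<integral>\<^sup>+p. \<integral>\<^sup>+q. ennreal (I p (- q)) \<partial>lborel \<partial>lborel) +
      (\<integral>\<^sup>+p. \<integral>\<^sup>+q. ennreal (I p q) \<partial>lborel \<partial>lborel))"
    using plane_nn_integral[of "\<lambda>p q. ennreal (I p (- q))"] plane_nn_integral[of
        "\<lambda>p q. ennreal (I p q)"]
    by (subst nn_integral_add) auto
  also have "(\<integral>\<^sup>+p. \<integral>\<^sup>+q. ennreal (I p (- q)) \<partial>lborel \<partial>lborel) =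
      (\<integral>\<^sup>+p. \<integral>\<^sup>+q. ennreal (I p q) \<partial>lborel \<partial>lborel)"
    using nn_integral_translate(4)[of "\<lambda>q. ennreal (I p q)" for p] by simp
  also have "ennreal (1/2) * (x + x) = x" for x :: ennreal
  proof -
    have "ennreal (1/2) * (x + x) = (ennreal (1/2) * 2) * x"
      by (simp only: mult_2[symmetric] mult.assoc)
    also have "ennreal (1/2) * 2 = 1"
      by (metis ennreal_1 ennreal_mult' ennreal_numeral nonzero_eq_divide_eq zero_le_numeral
        zero_neq_numeral mult.commute)
    finally show ?thesis by simp
  qed
  finally show ?thesis unfolding I_def .
qed

text \<open>
  Taking absolute values inside the integral would be too lossy for nested intervals; the Lipschitz
  bound on the frequency kernel exploits the cancellation between \<open>q\<close> and \<open>- q\<close>.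
\<close>
lemma kernel_cov_le_nested:
  assumes "0 < e" "0 \<le> c" "0 \<le> A" "0 \<le> B"
  shows "ennreal (kernel_cov a c e A B 0) \<le> (\<integral>\<^sup>+p. \<integral>\<^sup>+q. ennreal (\<bar>freq_kernel e p\<bar> * \<bar>p\<bar> *
     exp (- (A * levy_exponent a c p + B * levy_exponent a c q))) \<partial>lborel \<partial>lborel)"
proof -
  let ?h = "\<lambda>z. freq_kernel e (fst z) * freq_kernel e (snd z) *
     (exp (- (A * levy_exponent a c (fst z) + 0 * levy_exponent a c (snd z))) *
      (exp (- (B * levy_exponent a c (fst z - snd z))) -
          exp (- (B * levy_exponent a c (fst z + snd z)))))"
  define k where "k v = exp (- (B * levy_exponent a c v))" for v
  have [measurable]: "k \<in> borel_measurable borel" unfolding k_def by measurable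
  have k: "0 < k v" "k v \<le> 1" "k (- v) = k v" for v
    using levy_exponent_nonneg[of c a v] assms by (auto simp: k_def)
  define inn where "inn p = (LBINT q. freq_kernel e q * (k (p - q) - k (p + q)))" for p
  have inn: "ennreal \<bar>inn p\<bar> \<le> ennreal (2 * \<bar>p\<bar>) * (\<integral>\<^sup>+q. ennreal (k q) \<partial>lborel)" for p
  proof -
    have i1: "integrable lborel (\<lambda>q. freq_kernel e q * k (p - q))"
        "integrable lborel (\<lambda>q. freq_kernel e q * k (p + q))"
      using k by (auto intro!: integrable_freq_kernel_times assms simp: abs_of_pos)
    \<comment> \<open>Both substitutions put the exponential weight on the variable \<open>v\<close>
      alone. The two arguments of \<open>freq_kernel\<close> then differ by \<open>2 * p\<close>,
      whatever \<open>v\<close> is.\<close>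
    have "(LBINT q. freq_kernel e q * k (p - q)) = (LBINT v. freq_kernel e (p - v) * k v)"
      using lborel_integral_real_affine[of "-1" "\<lambda>q. freq_kernel e q * k (p - q)" p] by simp
    moreover have "(LBINT q. freq_kernel e q * k (p + q)) =
        (LBINT v. freq_kernel e (- v - p) * k v)"
      using lborel_integral_real_affine[of "-1" "\<lambda>q. freq_kernel e q * k (p + q)" "-p"] k(3)
      by (simp add: algebra_simps)
    ultimately have "inn p = (LBINT v. freq_kernel e (p - v) * k v) - (LBINT v. freq_kernel e (- v -
        p) * k v)"
      unfolding inn_def using i1 by (simp add: algebra_simps)
    moreover have i2: "integrable lborel (\<lambda>v. freq_kernel e (p - v) * k v)"
      using lborel_integrable_real_affine[OF i1(1), of "-1" p] by simp
    moreover have i3: "integrable lborel (\<lambda>v. freq_kernel e (- v - p) * k v)"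
      using lborel_integrable_real_affine[OF i1(2), of "-1" "-p"] k(3) by (simp add: algebra_simps)
    ultimately have "inn p = (LBINT v. freq_kernel e (p - v) * k v - freq_kernel e (- v - p) * k v)"
      by simp
    then have "ennreal \<bar>inn p\<bar> \<le> (\<integral>\<^sup>+v. ennreal (norm (freq_kernel e (p - v) * k v -
        freq_kernel e (- v - p) * k v)) \<partial>lborel)"
      using i2 i3 integral_norm_bound_ennreal[of lborel "\<lambda>v. freq_kernel e (p - v) * k v -
          freq_kernel e (- v - p) * k v"] by simp
    also have "\<dots> \<le> (\<integral>\<^sup>+v. ennreal (2 * \<bar>p\<bar>) * ennreal (k v) \<partial>lborel)"
    proof (intro nn_integral_mono)
      fix v
      have "\<bar>freq_kernel e (p - v) - freq_kernel e (- v - p)\<bar> \<le> \<bar>(p - v) - (- v - p)\<bar>"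
        using assms by (intro freq_kernel_lipschitz) auto
      then have "\<bar>(freq_kernel e (p - v) - freq_kernel e (- v - p)) * k v\<bar> \<le> 2 * \<bar>p\<bar> * k v"
        using k(1)[of v] by (auto simp: abs_mult intro!: mult_right_mono)
      then show "ennreal (norm (freq_kernel e (p - v) * k v - freq_kernel e (- v - p) * k v)) \<le>
          ennreal (2 * \<bar>p\<bar>) * ennreal (k v)"
        by (subst ennreal_mult'[symmetric]) (auto simp: algebra_simps intro!: ennreal_leI)
    qed
    also have "\<dots> = ennreal (2 * \<bar>p\<bar>) * (\<integral>\<^sup>+q. ennreal (k q) \<partial>lborel)"
      by (intro nn_integral_cmult) auto
    finally show ?thesis .
  qed
  have int: "integrable plane ?h" using kernel_cov_integrable[of e c A B 0 a] assms by simp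
  have "(\<integral>z. ?h z \<partial>plane) = (LBINT p. LBINT q. ?h (p, q))"
    by (rule plane_integral[OF int])
  also have "\<dots> = (LBINT p. freq_kernel e p * exp (- (A * levy_exponent a c p)) * inn p)"
    unfolding inn_def by (simp add: k_def mult_ac flip: integral_mult_right_zero)
  finally have Q: "kernel_cov a c e A B 0 =
      (LBINT p. (1/2) * (freq_kernel e p * exp (- (A * levy_exponent a c p)) * inn p))"
    unfolding kernel_cov_def by simp
  have "ennreal (kernel_cov a c e A B 0) \<le>
      (\<integral>\<^sup>+p. ennreal (norm ((1/2) * (freq_kernel e p * exp (- (A * levy_exponent a c p)) *
      inn p))) \<partial>lborel)"
  proof (cases "integrable lborel (\<lambda>p. (1/2) * (freq_kernel e p * exp (- (A * levy_exponent a c p))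
      * inn p))")
    case True
    have "ennreal (kernel_cov a c e A B 0) \<le> ennreal (norm (kernel_cov a c e A B 0))"
      by (intro ennreal_leI) simp
    then show ?thesis unfolding Q using integral_norm_bound_ennreal[OF True] by (rule order_trans)
  next
    \<comment> \<open>A function that is not integrable has Bochner integral 0, so the bound is
      trivial.\<close>
    case False
    then show ?thesis unfolding Q by (subst not_integrable_integral_eq[OF False]) simp
  qed
  also have "\<dots> \<le> (\<integral>\<^sup>+p. (\<integral>\<^sup>+q. ennreal (\<bar>freq_kernel e p\<bar> * \<bar>p\<bar> *
     exp (- (A * levy_exponent a c p + B * levy_exponent a c q))) \<partial>lborel) \<partial>lborel)"
  proof (intro nn_integral_mono)
    fix p
    let ?w = "\<bar>freq_kernel e p\<bar> * exp (- (A * levy_exponent a c p))"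
    have "ennreal (norm ((1/2) * (freq_kernel e p * exp (- (A * levy_exponent a c p)) * inn p))) =
        ennreal ((1/2) * ?w) * ennreal \<bar>inn p\<bar>"
      by (simp add: abs_mult mult_ac flip: ennreal_mult)
    also have "\<dots> \<le> ennreal ((1/2) * ?w) * (ennreal (2 * \<bar>p\<bar>) * (\<integral>\<^sup>+q. ennreal (k q) \<partial>lborel))"
      by (intro mult_left_mono inn) auto
    also have "\<dots> = (ennreal ((1/2) * ?w) * ennreal (2 * \<bar>p\<bar>)) * (\<integral>\<^sup>+q. ennreal (k q) \<partial>lborel)"
      by (simp only: mult.assoc)
    also have "ennreal ((1/2) * ?w) * ennreal (2 * \<bar>p\<bar>) = ennreal (?w * \<bar>p\<bar>)"
      by (subst ennreal_mult[symmetric]) auto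
    also have "ennreal (?w * \<bar>p\<bar>) * (\<integral>\<^sup>+q. ennreal (k q) \<partial>lborel) =
        (\<integral>\<^sup>+q. ennreal (?w * \<bar>p\<bar>) * ennreal (k q) \<partial>lborel)"
      by (intro nn_integral_cmult[symmetric]) auto
    also have "\<dots> = (\<integral>\<^sup>+q. ennreal (\<bar>freq_kernel e p\<bar> * \<bar>p\<bar> * exp (- (A * levy_exponent a c p + B *
        levy_exponent a c q))) \<partial>lborel)"
      by (intro nn_integral_cong) (simp add: k_def exp_diff exp_minus divide_inverse mult_ac flip:
          ennreal_mult)
    finally show "ennreal (norm ((1/2) * (freq_kernel e p * exp (- (A * levy_exponent a c p)) *
        inn p))) \<le>
      (\<integral>\<^sup>+q. ennreal (\<bar>freq_kernel e p\<bar> * \<bar>p\<bar> * exp (- (A * levy_exponent a c p + B *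
          levy_exponent a c q))) \<partial>lborel)" .
  qed
  finally show ?thesis .
qed

text \<open>The order of the second moment of the regularised local time, and the square of the unit
  in which all tails are measured. The Gaussian factor cuts the frequencies off near
  \<open>1 / sqrt e\<close>.\<close>

definition variance_scale :: "real \<Rightarrow> real \<Rightarrow> real \<Rightarrow> real" where
  "variance_scale a c e = (LBINT p. p\<^sup>2 * exp (- (e * p\<^sup>2 / 2)) * (resolvent a c p)\<^sup>2)"

lemma integrable_variance_scale:
  assumes "0 < e" "0 \<le> c"
  shows "integrable lborel (\<lambda>p. p\<^sup>2 * exp (- (e * p\<^sup>2 / 2)) * (resolvent a c p)\<^sup>2)"
proof (rule Bochner_Integration.integrable_bound[OF integrable_gauss_moment[OF assms(1), of 2]])
  show "AE p in lborel. norm (p\<^sup>2 * exp (- (e * p\<^sup>2 / 2)) * (resolvent a c p)\<^sup>2) \<le>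
      norm (\<bar>p\<bar>\<^sup>2 * exp (- (e * p\<^sup>2 / 2)))"
  proof (rule AE_I2)
    fix p
    have "(resolvent a c p)\<^sup>2 \<le> 1" using resolvent_pos[of c a p] resolvent_le1[of c a p] assms
      by (intro power_le_one) auto
    then have "p\<^sup>2 * exp (- (e * p\<^sup>2 / 2)) * (resolvent a c p)\<^sup>2 \<le> p\<^sup>2 * exp (- (e * p\<^sup>2 / 2)) * 1"
      by (intro mult_left_mono) auto
    then show "norm (p\<^sup>2 * exp (- (e * p\<^sup>2 / 2)) * (resolvent a c p)\<^sup>2) \<le>
        norm (\<bar>p\<bar>\<^sup>2 * exp (- (e * p\<^sup>2 / 2)))"
      by simp
  qed
qed simp

lemma nn_integral_variance_scale:
  assumes "0 < e" "0 \<le> c"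
  shows "(\<integral>\<^sup>+p. ennreal (p\<^sup>2 * exp (- (e * p\<^sup>2 / 2)) * (resolvent a c p)\<^sup>2) \<partial>lborel) =
      ennreal (variance_scale a c e)"
  unfolding variance_scale_def by (intro nn_integral_eq_integral integrable_variance_scale assms)
      auto

lemma variance_scale_pos:
  assumes "0 < e" "0 \<le> c" shows "0 < variance_scale a c e"
proof -
  have "0 \<le> variance_scale a c e" unfolding variance_scale_def
    by (intro Bochner_Integration.integral_nonneg) auto
  moreover have "variance_scale a c e \<noteq> 0"
  proof
    assume "variance_scale a c e = 0"
    then have "AE p in lborel. p\<^sup>2 * exp (- (e * p\<^sup>2 / 2)) * (resolvent a c p)\<^sup>2 = 0"
      unfolding variance_scale_def using integrable_variance_scale[OF assms]
      by (subst (asm) integral_nonneg_eq_0_iff_AE) auto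
    then have "AE p in lborel. p = (0::real)"
      by (rule AE_mp) (use resolvent_pos[of c a] assms(2) in \<open>auto intro!: AE_I2 simp: less_le\<close>)
    then have "emeasure lborel {p::real. p \<noteq> 0} = 0"
      by (subst (asm) AE_iff_measurable[OF _ refl]) auto
    moreover have "emeasure lborel {1..2::real} \<le> emeasure lborel {p::real. p \<noteq> 0}"
      by (intro emeasure_mono) auto
    ultimately show False by simp
  qed
  ultimately show ?thesis by simp
qed

text \<open>Carries termwise bounds by double integrals over to a weighted sum. In
  \<open>ennreal\<close> the exchange of sum and integral needs no integrability of the dominating
  functions.\<close>

lemma ennreal_sum_le_nn_integral2:
  fixes x :: "'i \<Rightarrow> real" and y :: "'i \<Rightarrow> real \<Rightarrow> real \<Rightarrow> real"
  assumes "finite T" "0 \<le> w"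
    and x: "\<And>t. t \<in> T \<Longrightarrow> 0 \<le> x t"
    and y: "\<And>t p q. t \<in> T \<Longrightarrow> 0 \<le> y t p q"
    and [measurable]: "\<And>t. t \<in> T \<Longrightarrow> (\<lambda>z. y t (fst z) (snd z)) \<in> borel_measurable (borel \<Otimes>\<^sub>M borel)"
    and xy: "\<And>t. t \<in> T \<Longrightarrow> ennreal (x t) \<le> (\<integral>\<^sup>+p. \<integral>\<^sup>+q. ennreal (y t p q) \<partial>lborel \<partial>lborel)"
    and z: "\<And>p q. w * (\<Sum>t\<in>T. y t p q) \<le> z p q"
  shows "ennreal (w * (\<Sum>t\<in>T. x t)) \<le> (\<integral>\<^sup>+p. \<integral>\<^sup>+q. ennreal (z p q) \<partial>lborel \<partial>lborel)"
proof -
  have "ennreal (w * (\<Sum>t\<in>T. x t)) = ennreal w * (\<Sum>t\<in>T. ennreal (x t))"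
    using assms(2) x by (simp add: ennreal_mult sum_nonneg)
  also have "\<dots> \<le> ennreal w * (\<Sum>t\<in>T. \<integral>\<^sup>+v. ennreal (y t (fst v) (snd v)) \<partial>plane)"
  proof (intro mult_left_mono sum_mono)
    fix t assume t: "t \<in> T"
    show "ennreal (x t) \<le> (\<integral>\<^sup>+v. ennreal (y t (fst v) (snd v)) \<partial>plane)"
      using xy[OF t] plane_nn_integral[of "\<lambda>p q. ennreal (y t p q)"] t by simp
  qed auto
  also have "\<dots> = ennreal w * (\<integral>\<^sup>+v. (\<Sum>t\<in>T. ennreal (y t (fst v) (snd v))) \<partial>plane)"
    by (subst nn_integral_sum) auto
  also have "\<dots> = (\<integral>\<^sup>+v. ennreal w * (\<Sum>t\<in>T. ennreal (y t (fst v) (snd v))) \<partial>plane)"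
    by (intro nn_integral_cmult[symmetric]) auto
  also have "\<dots> = (\<integral>\<^sup>+v. ennreal (w * (\<Sum>t\<in>T. y t (fst v) (snd v))) \<partial>plane)"
    using y assms(2) by (intro nn_integral_cong) (simp add: ennreal_mult sum_nonneg)
  also have "\<dots> = (\<integral>\<^sup>+p. \<integral>\<^sup>+q. ennreal (w * (\<Sum>t\<in>T. y t p q)) \<partial>lborel \<partial>lborel)"
    by (intro plane_nn_integral[of "\<lambda>p q. ennreal (w * (\<Sum>t\<in>T. y t p q))"]) auto
  also have "\<dots> \<le> (\<integral>\<^sup>+p. \<integral>\<^sup>+q. ennreal (z p q) \<partial>lborel \<partial>lborel)"
    by (intro nn_integral_mono ennreal_leI z)
  finally show ?thesis .
qed

lemma geometric_average_resolvent:
  assumes "0 \<le> c" "m \<le> N" "0 < N"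
  shows "(\<Sum>k=1..m. exp (- (real k / N * levy_exponent a c p))) / N \<le> 2 * resolvent a c p"
  using geometric_average[of "levy_exponent a c p" m N] levy_exponent_nonneg[of c a p] assms
  by (simp add: resolvent_levy_exponent)

section \<open>Averages of covariances over triples of interval lengths\<close>

abbreviation "cube N \<equiv> {1..N} \<times> {1..N} \<times> {1..N::nat}"

lemma sum_triple_product:
  fixes f g h :: "nat \<Rightarrow> real"
  shows "(\<Sum>t\<in>S \<times> T \<times> U. K * (f (fst t) * (g (fst (snd t)) * h (snd (snd t))))) =
      K * (sum f S * (sum g T * sum h U))"
proof -
  have "(\<Sum>t\<in>S \<times> T \<times> U. K * (f (fst t) * (g (fst (snd t)) * h (snd (snd t))))) =
    K * (\<Sum>A\<in>S. \<Sum>B\<in>T. \<Sum>C\<in>U. f A * (g B * h C))"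
    by (simp add: sum.cartesian_product case_prod_beta sum_distrib_left)
  also have "\<dots> = K * (sum f S * (sum g T * sum h U))"
    by (simp only: sum_distrib_left[symmetric] sum_distrib_right[symmetric])
  finally show ?thesis .
qed

text \<open>Averaging over the lengths leaves three resolvents and a factor 8. The inequality
  between arithmetic and geometric mean replaces the product of the two factors
  \<open>\<bar>freq_kernel\<bar> * resolvent\<close> by their squares and so decouples the
  frequencies: one of them yields \<open>variance_scale\<close>, the other occurs only in the
  resolvent at \<open>p + q\<close> and integrates to \<open>resolvent_mass\<close>.\<close>

lemma sum_kernel_cov_interleaved:
  assumes "0 < e" "0 < c" "1 < a" "a \<le> 2" "0 < N"
  shows "1 / real N ^ 3 * (\<Sum>(A,B,C)\<in>cube N. kernel_cov a c e (real A / N) (real B / N) (real C / N))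
      \<le> 8 * variance_scale a c e * resolvent_mass a c"
proof -
  define G where "G p = (\<Sum>k=1..N. exp (- (real k / N * levy_exponent a c p))) / N" for p
  have G: "0 \<le> G p" "G p \<le> 2 * resolvent a c p" for p
    unfolding G_def using assms geometric_average_resolvent[of c N N a p]
    by (auto intro!: divide_nonneg_nonneg sum_nonneg simp del: One_nat_def)
  have r: "0 \<le> resolvent a c p" for p using resolvent_pos[of c a p] assms by simp
  define y where "y = (\<lambda>(A,B,C) p q. \<bar>freq_kernel e p\<bar> * \<bar>freq_kernel e q\<bar> *
     exp (- (real A / N * levy_exponent a c p + real B / N * levy_exponent a c (p + q) +
         real C / N * levy_exponent a c q)))"
  define u where "u p = p\<^sup>2 * exp (- (e * p\<^sup>2 / 2)) * (resolvent a c p)\<^sup>2" for p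
  have [measurable]: "u \<in> borel_measurable borel" unfolding u_def by measurable
  have u0: "0 \<le> u p" for p unfolding u_def by simp
  have uV: "(\<integral>\<^sup>+p. ennreal (u p) \<partial>lborel) = ennreal (variance_scale a c e)"
    unfolding u_def using assms by (intro nn_integral_variance_scale) auto
  have "ennreal (1 / real N ^ 3 * (\<Sum>t\<in>cube N. (\<lambda>(A,B,C). kernel_cov a c e (real A / N) (real B / N)
      (real C / N)) t)) \<le>
    (\<integral>\<^sup>+p. \<integral>\<^sup>+q. ennreal (4 * (u p + u q) * resolvent a c (p + q)) \<partial>lborel \<partial>lborel)"
  proof (rule ennreal_sum_le_nn_integral2[where y = y])
    fix t :: "nat \<times> nat \<times> nat"
    obtain A B C where t: "t = (A, B, C)" by (cases t)
    show "0 \<le> (\<lambda>(A,B,C). kernel_cov a c e (real A / N) (real B / N) (real C / N)) t"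
      using assms unfolding t by (auto intro!: kernel_cov_nonneg)
    show "0 \<le> y t p q" for p q unfolding t y_def by simp
    show "(\<lambda>z. y t (fst z) (snd z)) \<in> borel_measurable (borel \<Otimes>\<^sub>M borel)"
      unfolding t y_def by simp
    show "ennreal ((\<lambda>(A,B,C). kernel_cov a c e (real A / N) (real B / N) (real C / N)) t) \<le>
        (\<integral>\<^sup>+p. \<integral>\<^sup>+q. ennreal (y t p q) \<partial>lborel \<partial>lborel)"
      using assms unfolding t y_def prod.case by (intro kernel_cov_le_interleaved) auto
  next
    fix p q
    let ?E = "\<lambda>p k. exp (- (real k / N * levy_exponent a c p))"
    have "(\<Sum>t\<in>cube N. y t p q) = (\<Sum>t\<in>cube N. \<bar>freq_kernel e p\<bar> * \<bar>freq_kernel e q\<bar> *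
        (?E p (fst t) * (?E (p + q) (fst (snd t)) * ?E q (snd (snd t)))))"
    proof (intro sum.cong refl)
      fix t :: "nat \<times> nat \<times> nat"
      obtain A B C where t: "t = (A, B, C)" by (cases t)
      have "exp (- (real A / N * levy_exponent a c p + real B / N * levy_exponent a c (p + q) +
          real C / N * levy_exponent a c q)) = ?E p A * (?E (p + q) B * ?E q C)"
        by (simp only: exp_add[symmetric]) (simp add: add_divide_distrib algebra_simps)
      then show "y t p q = \<bar>freq_kernel e p\<bar> * \<bar>freq_kernel e q\<bar> * (?E p (fst t) *
          (?E (p + q) (fst (snd t)) * ?E q (snd (snd t))))"
        by (simp add: t y_def)
    qed
    also have "\<dots> = \<bar>freq_kernel e p\<bar> * \<bar>freq_kernel e q\<bar> * (sum (?E p) {1..N} *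
        (sum (?E (p + q)) {1..N} * sum (?E q) {1..N}))"
      by (rule sum_triple_product)
    finally have "1 / real N ^ 3 * (\<Sum>t\<in>cube N. y t p q) = \<bar>freq_kernel e p\<bar> * \<bar>freq_kernel e q\<bar> *
        (G p * (G (p + q) * G q))"
      using assms unfolding G_def by (simp add: power3_eq_cube)
    also have "\<dots> \<le> \<bar>freq_kernel e p\<bar> * \<bar>freq_kernel e q\<bar> * ((2 * resolvent a c p) *
        ((2 * resolvent a c (p + q)) * (2 * resolvent a c q)))"
      using G r by (intro mult_left_mono mult_mono) auto
    also have "\<dots> = 4 * (2 * (\<bar>freq_kernel e p\<bar> * resolvent a c p) * (\<bar>freq_kernel e q\<bar> *
        resolvent a c q)) * resolvent a c (p + q)"
      by simp
    also have "\<dots> \<le> 4 * ((\<bar>freq_kernel e p\<bar> * resolvent a c p)\<^sup>2 + (\<bar>freq_kernel e q\<bar> *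
        resolvent a c q)\<^sup>2) * resolvent a c (p + q)"
      by (intro mult_left_mono mult_right_mono sum_squares_bound r) auto
    also have "\<dots> \<le> 4 * (u p + u q) * resolvent a c (p + q)"
      unfolding u_def power_mult_distrib power2_abs using assms r
      by (intro mult_left_mono mult_right_mono add_mono freq_kernel_sq_le) auto
    finally show "1 / real N ^ 3 * (\<Sum>t\<in>cube N. y t p q) \<le> 4 * (u p + u q) * resolvent a c (p + q)" .
  qed (use assms in auto)
  also have "(\<integral>\<^sup>+p. \<integral>\<^sup>+q. ennreal (4 * (u p + u q) * resolvent a c (p + q)) \<partial>lborel \<partial>lborel) =
    (\<integral>\<^sup>+p. \<integral>\<^sup>+q. ennreal (4 * u p) * ennreal (resolvent a c (p + q)) + ennreal (4 * u q) *
        ennreal (resolvent a c (p + q)) \<partial>lborel \<partial>lborel)"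
    using u0 r by (intro nn_integral_cong) (simp add: algebra_simps flip: ennreal_mult ennreal_plus)
  also have "\<dots> = (\<integral>\<^sup>+p. \<integral>\<^sup>+q. ennreal (4 * u p) * ennreal (resolvent a c (p + q)) \<partial>lborel \<partial>lborel) +
     (\<integral>\<^sup>+p. \<integral>\<^sup>+q. ennreal (4 * u q) * ennreal (resolvent a c (p + q)) \<partial>lborel \<partial>lborel)"
    by (simp add: nn_integral_add)
  also have "(\<integral>\<^sup>+p. \<integral>\<^sup>+q. ennreal (4 * u q) * ennreal (resolvent a c (p + q)) \<partial>lborel \<partial>lborel) =
     (\<integral>\<^sup>+q. \<integral>\<^sup>+p. ennreal (4 * u q) * ennreal (resolvent a c (p + q)) \<partial>lborel \<partial>lborel)"
    by (rule lborel_pair.Fubini') simp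
  also have "(\<integral>\<^sup>+p. \<integral>\<^sup>+q. ennreal (4 * u p) * ennreal (resolvent a c (p + q)) \<partial>lborel \<partial>lborel) =
      ennreal (variance_scale a c e) * ennreal (4 * resolvent_mass a c)"
    using assms u0 resolvent_mass_nonneg[of c a]
    by (simp add: nn_integral_cmult nn_integral_translate(1)[of
        "\<lambda>u. ennreal (resolvent a c u)"] nn_integral_resolvent nn_integral_multc
      ennreal_mult mult_ac uV)
  also have "(\<integral>\<^sup>+q. \<integral>\<^sup>+p. ennreal (4 * u q) * ennreal (resolvent a c (p + q)) \<partial>lborel \<partial>lborel) =
      ennreal (variance_scale a c e) * ennreal (4 * resolvent_mass a c)"
    using assms u0 resolvent_mass_nonneg[of c a]
    by (simp add: nn_integral_cmult nn_integral_translate(2)[of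
        "\<lambda>u. ennreal (resolvent a c u)"] nn_integral_resolvent nn_integral_multc
      ennreal_mult mult_ac uV)
  also have "ennreal (variance_scale a c e) * ennreal (4 * resolvent_mass a c) +
      ennreal (variance_scale a c e) * ennreal (4 * resolvent_mass a c) =
      ennreal (8 * variance_scale a c e * resolvent_mass a c)"
    using assms variance_scale_pos[of e c a] resolvent_mass_nonneg[of c a]
    by (simp flip: ennreal_mult ennreal_plus)
  finally show ?thesis
    using assms variance_scale_pos[of e c a] resolvent_mass_nonneg[of c a]
    by (subst (asm) ennreal_le_iff) auto
qed

text \<open>The gaps \<open>A\<close> and \<open>C\<close> on either side of the inner interval
  carry the same frequency \<open>p\<close> and supply the squared resolvent that
  \<open>variance_scale\<close> needs. The inner length \<open>B\<close> supplies the resolvent at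
  \<open>q\<close>, which is integrable since \<open>1 < a\<close>.\<close>

lemma sum_kernel_cov_nested:
  assumes "0 < e" "0 < c" "1 < a" "a \<le> 2" "0 < N"
  shows "1 / real N ^ 3 * (\<Sum>(A,B,C)\<in>cube N. kernel_cov a c e (real (A + C) / N) (real B / N) 0) \<le>
      8 * variance_scale a c e * resolvent_mass a c"
proof -
  define G where "G p = (\<Sum>k=1..N. exp (- (real k / N * levy_exponent a c p))) / N" for p
  have G: "0 \<le> G p" "G p \<le> 2 * resolvent a c p" for p
    unfolding G_def using assms geometric_average_resolvent[of c N N a p]
    by (auto intro!: divide_nonneg_nonneg sum_nonneg simp del: One_nat_def)
  have r: "0 \<le> resolvent a c p" for p using resolvent_pos[of c a p] assms by simp
  define y where "y = (\<lambda>(A,B,C) p q. \<bar>freq_kernel e p\<bar> * \<bar>p\<bar> *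
     exp (- (real (A + C) / N * levy_exponent a c p + real B / N * levy_exponent a c q)))"
  define u where "u p = p\<^sup>2 * exp (- (e * p\<^sup>2 / 2)) * (resolvent a c p)\<^sup>2" for p
  have [measurable]: "u \<in> borel_measurable borel" unfolding u_def by measurable
  have u0: "0 \<le> u p" for p unfolding u_def by simp
  have uV: "(\<integral>\<^sup>+p. ennreal (u p) \<partial>lborel) = ennreal (variance_scale a c e)"
    unfolding u_def using assms by (intro nn_integral_variance_scale) auto
  have "ennreal (1 / real N ^ 3 * (\<Sum>t\<in>cube N. (\<lambda>(A,B,C). kernel_cov a c e (real (A + C) / N)
      (real B / N) 0) t)) \<le>
    (\<integral>\<^sup>+p. \<integral>\<^sup>+q. ennreal (8 * u p * resolvent a c q) \<partial>lborel \<partial>lborel)"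
  proof (rule ennreal_sum_le_nn_integral2[where y = y])
    fix t :: "nat \<times> nat \<times> nat"
    obtain A B C where t: "t = (A, B, C)" by (cases t)
    show "0 \<le> (\<lambda>(A,B,C). kernel_cov a c e (real (A + C) / N) (real B / N) 0) t"
      using assms unfolding t by (auto intro!: kernel_cov_nonneg)
    show "0 \<le> y t p q" for p q unfolding t y_def by simp
    show "(\<lambda>z. y t (fst z) (snd z)) \<in> borel_measurable (borel \<Otimes>\<^sub>M borel)"
      unfolding t y_def by simp
    show "ennreal ((\<lambda>(A,B,C). kernel_cov a c e (real (A + C) / N) (real B / N) 0) t) \<le>
        (\<integral>\<^sup>+p. \<integral>\<^sup>+q. ennreal (y t p q) \<partial>lborel \<partial>lborel)"
      using assms unfolding t y_def prod.case by (intro kernel_cov_le_nested) auto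
  next
    fix p q
    let ?E = "\<lambda>p k. exp (- (real k / N * levy_exponent a c p))"
    have "(\<Sum>t\<in>cube N. y t p q) = (\<Sum>t\<in>cube N. \<bar>freq_kernel e p\<bar> * \<bar>p\<bar> *
        (?E p (fst t) * (?E q (fst (snd t)) * ?E p (snd (snd t)))))"
    proof (intro sum.cong refl)
      fix t :: "nat \<times> nat \<times> nat"
      obtain A B C where t: "t = (A, B, C)" by (cases t)
      have "exp (- (real (A + C) / N * levy_exponent a c p + real B / N * levy_exponent a c q)) =
          ?E p A * (?E q B * ?E p C)"
        by (simp only: exp_add[symmetric]) (simp add: add_divide_distrib algebra_simps)
      then show "y t p q = \<bar>freq_kernel e p\<bar> * \<bar>p\<bar> * (?E p (fst t) * (?E q (fst (snd t)) *
          ?E p (snd (snd t))))"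
        by (simp add: t y_def)
    qed
    also have "\<dots> = \<bar>freq_kernel e p\<bar> * \<bar>p\<bar> * (sum (?E p) {1..N} * (sum (?E q) {1..N} *
        sum (?E p) {1..N}))"
      by (rule sum_triple_product)
    finally have "1 / real N ^ 3 * (\<Sum>t\<in>cube N. y t p q) = \<bar>freq_kernel e p\<bar> * \<bar>p\<bar> *
        (G p * (G q * G p))"
      using assms unfolding G_def by (simp add: power3_eq_cube)
    also have "\<dots> \<le> \<bar>freq_kernel e p\<bar> * \<bar>p\<bar> * ((2 * resolvent a c p) * ((2 * resolvent a c q) *
        (2 * resolvent a c p)))"
      using G r by (intro mult_left_mono mult_mono) auto
    also have "\<dots> = 8 * u p * resolvent a c q"
    proof -
      have "\<bar>p\<bar> * \<bar>p\<bar> = p\<^sup>2" by (simp add: power2_eq_square)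
      then show ?thesis unfolding u_def abs_freq_kernel by (simp add: power2_eq_square[of
          "resolvent a c p"] mult_ac)
    qed
    finally show "1 / real N ^ 3 * (\<Sum>t\<in>cube N. y t p q) \<le> 8 * u p * resolvent a c q" .
  qed (use assms in auto)
  also have "(\<integral>\<^sup>+p. \<integral>\<^sup>+q. ennreal (8 * u p * resolvent a c q) \<partial>lborel \<partial>lborel) =
    (\<integral>\<^sup>+p. \<integral>\<^sup>+q. ennreal (8 * u p) * ennreal (resolvent a c q) \<partial>lborel \<partial>lborel)"
    using u0 r by (intro nn_integral_cong) (simp flip: ennreal_mult)
  also have "\<dots> = ennreal (variance_scale a c e) * ennreal (8 * resolvent_mass a c)"
    using assms u0 resolvent_mass_nonneg[of c a]
    by (simp add: nn_integral_cmult nn_integral_resolvent nn_integral_multc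
      ennreal_mult mult_ac uV)
  also have "\<dots> = ennreal (8 * variance_scale a c e * resolvent_mass a c)"
    using assms variance_scale_pos[of e c a] resolvent_mass_nonneg[of c a]
    by (simp flip: ennreal_mult ennreal_plus)
  finally show ?thesis
    using assms variance_scale_pos[of e c a] resolvent_mass_nonneg[of c a]
    by (subst (asm) ennreal_le_iff) auto
qed

section \<open>Second moments for a random walk\<close>

lemma sum_inj_le:
  fixes h :: "'b \<Rightarrow> real"
  assumes "finite T'" "inj_on \<phi> T" "\<phi> ` T \<subseteq> T'" "\<And>s. s \<in> T' \<Longrightarrow> 0 \<le> h s"
  shows "(\<Sum>t\<in>T. h (\<phi> t)) \<le> (\<Sum>s\<in>T'. h s)"
proof -
  have "(\<Sum>t\<in>T. h (\<phi> t)) = (\<Sum>s\<in>\<phi> ` T. h s)" using assms by (simp add: sum.reindex)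
  also have "\<dots> \<le> (\<Sum>s\<in>T'. h s)" using assms by (intro sum_mono2) auto
  finally show ?thesis .
qed

lemma square_sum_ordered:
  fixes g :: "nat \<Rightarrow> real"
  shows "(\<Sum>r\<in>{j<..n}. g r)\<^sup>2 = (\<Sum>r\<in>{j<..n}. (g r)\<^sup>2) + 2 * (\<Sum>t\<in>Sigma {j<..n} (\<lambda>q. {j<..<q}). g
      (snd t) * g (fst t))"
proof -
  have "(\<Sum>r\<in>{j<..n}. g r)\<^sup>2 = (\<Sum>r\<in>{j<..n}. (g r)\<^sup>2) + 2 * (\<Sum>q\<in>{j<..n}. \<Sum>r\<in>{j<..<q}. g r * g q)"
  proof (induction n)
    case (Suc n)
    show ?case
    proof (cases "j \<le> n")
      case True
      then have *: "{j<..Suc n} = insert (Suc n) {j<..n}" "{j<..<Suc n} = {j<..n}" by auto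
      have "(\<Sum>r\<in>{j<..Suc n}. g r)\<^sup>2 = (g (Suc n))\<^sup>2 + (\<Sum>r\<in>{j<..n}. g r)\<^sup>2 + 2 * ((\<Sum>r\<in>{j<..n}. g r) *
          g (Suc n))"
        unfolding * by (simp add: power2_eq_square algebra_simps)
      then show ?thesis unfolding Suc unfolding *(1) by (simp add: sum_distrib_right *(2))
    next
      case False
      then show ?thesis by simp
    qed
  qed simp
  then show ?thesis by (simp add: sum.Sigma case_prod_beta)
qed

lemma (in prob_space) weighted_kernel_exchange:
  assumes w: "integrable plane w" and k [measurable]: "(\<lambda>(\<omega>, z). k \<omega> z) \<in>
      borel_measurable (M \<Otimes>\<^sub>M plane)"
    and k1: "\<And>\<omega> z. \<bar>k \<omega> z :: real\<bar> \<le> 1"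
  shows "expectation (\<lambda>\<omega>. \<integral>z. w z * k \<omega> z \<partial>plane) = (\<integral>z. w z * expectation (\<lambda>\<omega>. k \<omega> z) \<partial>plane)"
proof -
  interpret L: sigma_finite_measure plane by (simp add: lborel_prod sigma_finite_lborel)
  interpret P: pair_sigma_finite M plane ..
  have wm [measurable]: "w \<in> borel_measurable plane" using w by (rule borel_measurable_integrable)
  have "integrable (M \<Otimes>\<^sub>M plane) (\<lambda>v. w (snd v))"
  proof (rule P.Fubini_integrable)
    show "integrable M (\<lambda>x. \<integral>y. norm (w (snd (x, y))) \<partial>plane)" by simp
    show "AE x in M. integrable plane (\<lambda>y. w (snd (x, y)))" using w by simp
  qed measurable
  then have "integrable (M \<Otimes>\<^sub>M plane) (\<lambda>(\<omega>, z). w z * k \<omega> z)"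
    by (rule Bochner_Integration.integrable_bound)
       (auto simp: abs_mult split_beta' intro!: AE_I2 mult_left_le k1)
  from P.Fubini_integral[OF this] show ?thesis by simp
qed

text \<open>The process sampled at multiples of \<open>1 / N\<close> is seen only through
  independent steps with a known characteristic function. One step has exponent
  \<open>levy_exponent / N\<close>, so \<open>N\<close> steps fill the unit time interval.\<close>

locale walk = prob_space M for M :: "'a measure" +
  fixes \<xi> :: "nat \<Rightarrow> 'a \<Rightarrow> real" and N :: nat and a c e :: real
  assumes N0: "0 < N" and a1: "1 < a" and a2: "a \<le> 2" and c0: "0 < c" and e0: "0 < e"
    and indep: "indep_vars (\<lambda>_. borel) \<xi> UNIV"
    and cf: "\<And>k u. (CLINT \<omega>|M. iexp (u * \<xi> k \<omega>)) =
        complex_of_real (exp (- (levy_exponent a c u / N)))"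
begin

lemma xi_measurable [measurable]: "\<xi> k \<in> borel_measurable M"
  using indep by (auto simp: indep_vars_def)

lemma cf_sum:
  assumes "finite K"
  shows "(CLINT \<omega>|M. iexp (\<Sum>k\<in>K. l k * \<xi> k \<omega>)) =
      complex_of_real (exp (- ((\<Sum>k\<in>K. levy_exponent a c (l k)) / N)))"
proof -
  have interval_ind: "indep_vars (\<lambda>_. borel) (\<lambda>k \<omega>. iexp (l k * \<xi> k \<omega>)) K"
    by (rule indep_vars_compose2[OF indep_vars_subset[OF indep], where Y =
        "\<lambda>k x. iexp (l k * x)"]) auto
  have "(CLINT \<omega>|M. iexp (\<Sum>k\<in>K. l k * \<xi> k \<omega>)) = (CLINT \<omega>|M. (\<Prod>k\<in>K. iexp (l k * \<xi> k \<omega>)))"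
    by (simp add: exp_sum sum_distrib_left assms)
  also have "\<dots> = (\<Prod>k\<in>K. CLINT \<omega>|M. iexp (l k * \<xi> k \<omega>))"
    by (intro indep_vars_lebesgue_integral assms interval_ind integrable_iexp) auto
  also have "\<dots> = (\<Prod>k\<in>K. complex_of_real (exp (- (levy_exponent a c (l k) / N))))"
    by (intro prod.cong refl cf)
  also have "\<dots> = complex_of_real (exp (- ((\<Sum>k\<in>K. levy_exponent a c (l k)) / N)))"
    by (simp add: exp_sum assms sum_divide_distrib flip: sum_negf of_real_prod)
  finally show ?thesis .
qed

lemma expectation_cos:
  assumes "finite K"
  shows "expectation (\<lambda>\<omega>. cos (z + (\<Sum>k\<in>K. l k * \<xi> k \<omega>))) =
      cos z * exp (- ((\<Sum>k\<in>K. levy_exponent a c (l k)) / N))"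
proof -
  have int: "integrable M (\<lambda>\<omega>. iexp z * iexp (\<Sum>k\<in>K. l k * \<xi> k \<omega>))"
    by (intro integrable_mult_right integrable_iexp) auto
  have "expectation (\<lambda>\<omega>. cos (z + (\<Sum>k\<in>K. l k * \<xi> k \<omega>))) =
      expectation (\<lambda>\<omega>. Re (iexp z * iexp (\<Sum>k\<in>K. l k * \<xi> k \<omega>)))"
    by (simp add: cos_add Re_exp Im_exp)
  also have "\<dots> = Re (iexp z * (CLINT \<omega>|M. iexp (\<Sum>k\<in>K. l k * \<xi> k \<omega>)))"
    by (subst integral_Re[OF int]) simp
  also have "\<dots> = cos z * exp (- ((\<Sum>k\<in>K. levy_exponent a c (l k)) / N))"
    unfolding cf_sum[OF assms] by (simp add: Re_exp)
  finally show ?thesis .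
qed

text \<open>The joint characteristic function at \<open>(p, q)\<close> of the linear forms with
  coefficients \<open>l\<close> and \<open>m\<close> in the steps indexed by
  \<open>K\<close>.\<close>

definition pair_cf :: "nat set \<Rightarrow> (nat \<Rightarrow> real) \<Rightarrow> (nat \<Rightarrow> real) \<Rightarrow> real \<Rightarrow> real \<Rightarrow> real" where
  "pair_cf K l m p q = exp (- ((\<Sum>k\<in>K. levy_exponent a c (p * l k + q * m k)) / N))"

lemma pair_cf_measurable [measurable]:
  "(\<lambda>z. pair_cf K l m (fst z) (snd z)) \<in> borel_measurable (borel \<Otimes>\<^sub>M borel)"
  "(\<lambda>z. pair_cf K l m (fst z) (- snd z)) \<in> borel_measurable (borel \<Otimes>\<^sub>M borel)"
  unfolding pair_cf_def by measurable

lemma pair_cf_bounds: "0 < pair_cf K l m p q" "pair_cf K l m p q \<le> 1"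
  using N0 levy_exponent_nonneg[of c a] c0
  by (auto simp: pair_cf_def intro!: divide_nonneg_nonneg sum_nonneg)

lemma delta_deriv_meas [measurable]: "delta_deriv e \<in> borel_measurable borel"
  using e0 by (rule delta_deriv_measurable)

lemma integrable_pair_cf_kernel:
  "integrable plane (\<lambda>z. freq_kernel e (fst z) * freq_kernel e (snd z) *
    ((cos (fst z * x - snd z * y) * pair_cf K l m (fst z) (- snd z) - cos (fst z * x + snd z * y) *
        pair_cf K l m (fst z) (snd z)) / 2))"
proof (rule integrable_freq_kernel_freq_kernel_times[OF e0])
  have half_diff: "\<bar>u\<bar> \<le> 1 \<Longrightarrow> \<bar>v\<bar> \<le> 1 \<Longrightarrow> \<bar>(u - v) / 2\<bar> \<le> 1" for u v :: real by (auto simp: abs_le_iff)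
  fix z :: "real \<times> real"
  have "\<bar>cos u * pair_cf K l m p q\<bar> \<le> 1" for u p q
    using pair_cf_bounds[of K l m p q] by (auto simp: abs_mult intro!: mult_le_one)
  from this[of "fst z * x - snd z * y" "fst z" "- snd z"] this[of "fst z * x + snd z * y" "fst z"
      "snd z"]
  show "\<bar>(cos (fst z * x - snd z * y) * pair_cf K l m (fst z) (- snd z) - cos (fst z * x + snd z *
      y) * pair_cf K l m (fst z) (snd z)) / 2\<bar> \<le> 1"
    by (rule half_diff)
qed measurable

text \<open>A product of sines is a difference of cosines of linear forms in independent steps. The
  offsets \<open>x\<close> and \<open>y\<close> are there for the cross term, where they are
  positions fixed by a frozen past.\<close>

lemma expectation_delta_deriv_delta_deriv:
  assumes "finite K"
  shows "expectation (\<lambda>\<omega>. delta_deriv e (x + (\<Sum>k\<in>K. l k * \<xi> k \<omega>)) * delta_deriv e (y +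
      (\<Sum>k\<in>K. m k * \<xi> k \<omega>))) =
    (\<integral>z. freq_kernel e (fst z) * freq_kernel e (snd z) *
      ((cos (fst z * x - snd z * y) * pair_cf K l m (fst z) (- snd z) - cos (fst z * x + snd z *
          y) * pair_cf K l m (fst z) (snd z)) / 2) \<partial>plane)"
proof -
  let ?X = "\<lambda>\<omega>. x + (\<Sum>k\<in>K. l k * \<xi> k \<omega>)" and ?Y = "\<lambda>\<omega>. y + (\<Sum>k\<in>K. m k * \<xi> k \<omega>)"
  have "expectation (\<lambda>\<omega>. delta_deriv e (?X \<omega>) * delta_deriv e (?Y \<omega>)) =
    expectation (\<lambda>\<omega>. \<integral>z. freq_kernel e (fst z) * freq_kernel e (snd z) * (sin (fst z * ?X \<omega>) *
        sin (snd z * ?Y \<omega>)) \<partial>plane)"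
    unfolding delta_deriv_delta_deriv[OF e0] ..
  also have "\<dots> = (\<integral>z. freq_kernel e (fst z) * freq_kernel e (snd z) *
      expectation (\<lambda>\<omega>. sin (fst z * ?X \<omega>) * sin (snd z * ?Y \<omega>)) \<partial>plane)"
    by (intro weighted_kernel_exchange integrable_freq_kernel_freq_kernel e0) (auto simp: abs_mult
        intro!: mult_le_one)
  also have "\<dots> = (\<integral>z. freq_kernel e (fst z) * freq_kernel e (snd z) *
      ((cos (fst z * x - snd z * y) * pair_cf K l m (fst z) (- snd z) - cos (fst z * x + snd z *
          y) * pair_cf K l m (fst z) (snd z)) / 2) \<partial>plane)"
  proof (intro Bochner_Integration.integral_cong refl arg_cong2[where f = "(*)"])
    fix z :: "real \<times> real"
    obtain p q where z: "z = (p, q)" by (cases z)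
    have 1: "p * ?X \<omega> - q * ?Y \<omega> = (p * x - q * y) + (\<Sum>k\<in>K. (p * l k + (- q) * m k) * \<xi> k \<omega>)"
         "p * ?X \<omega> + q * ?Y \<omega> = (p * x + q * y) + (\<Sum>k\<in>K. (p * l k + q * m k) * \<xi> k \<omega>)" for \<omega>
      by (simp_all add: algebra_simps sum.distrib sum_subtractf sum_distrib_left)
    have "expectation (\<lambda>\<omega>. sin (p * ?X \<omega>) * sin (q * ?Y \<omega>)) =
      expectation (\<lambda>\<omega>. (cos ((p * x - q * y) + (\<Sum>k\<in>K. (p * l k + (- q) * m k) * \<xi> k \<omega>)) -
         cos ((p * x + q * y) + (\<Sum>k\<in>K. (p * l k + q * m k) * \<xi> k \<omega>))) / 2)"
      unfolding sin_times_sin 1 ..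
    also have "\<dots> = (expectation (\<lambda>\<omega>. cos ((p * x - q * y) + (\<Sum>k\<in>K. (p * l k + (- q) * m k) *
        \<xi> k \<omega>))) -
         expectation (\<lambda>\<omega>. cos ((p * x + q * y) + (\<Sum>k\<in>K. (p * l k + q * m k) * \<xi> k \<omega>)))) / 2"
    proof -
      have "integrable M (\<lambda>\<omega>. cos (u + (\<Sum>k\<in>K. v k * \<xi> k \<omega>)))" for u v
        by (rule integrable_const_bound[where B=1]) auto
      then show ?thesis by simp
    qed
    also have "\<dots> = (cos (p * x - q * y) * pair_cf K l m p (- q) - cos (p * x + q * y) *
        pair_cf K l m p q) / 2"
      unfolding expectation_cos[OF assms] pair_cf_def ..
    finally show "expectation (\<lambda>\<omega>. sin (fst z * ?X \<omega>) * sin (snd z * ?Y \<omega>)) =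
      (cos (fst z * x - snd z * y) * pair_cf K l m (fst z) (- snd z) - cos (fst z * x + snd z * y) *
          pair_cf K l m (fst z) (snd z)) / 2"
      by (simp add: z)
  qed
  finally show ?thesis .
qed

lemma integrable_delta_deriv_delta_deriv:
  assumes [measurable]: "X \<in> borel_measurable M" "Y \<in> borel_measurable M"
  shows "integrable M (\<lambda>\<omega>. delta_deriv e (X \<omega>) * delta_deriv e (Y \<omega>))"
proof (rule integrable_const_bound[where B="freq_kernel_norm e * freq_kernel_norm e"])
  show "AE \<omega> in M. norm (delta_deriv e (X \<omega>) * delta_deriv e (Y \<omega>)) \<le>
      freq_kernel_norm e * freq_kernel_norm e"
    using delta_deriv_bound[OF e0] freq_kernel_norm_nonneg
    by (auto simp: abs_mult intro!: AE_I2 mult_mono)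
qed measurable

text \<open>Coefficients that present an increment as a linear form in the steps, the shape that
  \<open>pair_cf\<close> expects.\<close>

definition interval_ind :: "nat \<times> nat \<Rightarrow> nat \<Rightarrow> real" where
  "interval_ind t k = of_bool (k \<in> {fst t..<snd t})"

definition step_sum :: "'a \<Rightarrow> nat \<times> nat \<Rightarrow> real" where
  "step_sum \<omega> t = (\<Sum>k\<in>{fst t..<snd t}. \<xi> k \<omega>)"

lemma step_sum_measurable [measurable]: "(\<lambda>\<omega>. step_sum \<omega> t) \<in> borel_measurable M"
  unfolding step_sum_def by measurable

lemma step_sum_interval_ind:
  assumes "finite K" "{fst t..<snd t} \<subseteq> K"
  shows "step_sum \<omega> t = (\<Sum>k\<in>K. interval_ind t k * \<xi> k \<omega>)"
proof -
  have "(\<Sum>k\<in>K. interval_ind t k * \<xi> k \<omega>) = (\<Sum>k\<in>K. if k \<in> {fst t..<snd t} then \<xi> k \<omega> else 0)"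
    by (intro sum.cong) (auto simp: interval_ind_def)
  also have "\<dots> = (\<Sum>k\<in>K \<inter> {fst t..<snd t}. \<xi> k \<omega>)"
    by (rule sum.inter_restrict[OF assms(1), symmetric])
  also have "K \<inter> {fst t..<snd t} = {fst t..<snd t}" using assms by auto
  finally show ?thesis by (simp add: step_sum_def)
qed

text \<open>A step is weighted by \<open>p\<close>, \<open>p + q\<close> or \<open>q\<close>
  according to whether it belongs to the first interval alone, to both, or to the second
  alone.\<close>

lemma pair_cf_interval_ind:
  assumes "finite K" "{fst s..<snd s} \<subseteq> K" "{fst t..<snd t} \<subseteq> K"
  defines "I \<equiv> {fst s..<snd s}" and "J \<equiv> {fst t..<snd t}"
  shows "pair_cf K (interval_ind s) (interval_ind t) p q =
    exp (- (real (card (I - J)) / N * levy_exponent a c p + real (card (I \<inter> J)) / N *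
        levy_exponent a c (p + q) + real (card (J - I)) / N * levy_exponent a c q))"
proof -
  have "(\<Sum>k\<in>K. levy_exponent a c (p * interval_ind s k + q * interval_ind t k)) =
      (\<Sum>k\<in>K. (if k \<in> I - J then levy_exponent a c p else 0) +
     (if k \<in> I \<inter> J then levy_exponent a c (p + q) else 0) + (if k \<in>
         J - I then levy_exponent a c q else 0))"
  proof (intro sum.cong refl)
    fix k
    have "interval_ind s k = of_bool (k \<in> I)" "interval_ind t k = of_bool (k \<in> J)"
      by (simp_all only: interval_ind_def I_def J_def)
    then show "levy_exponent a c (p * interval_ind s k + q * interval_ind t k) =
        (if k \<in> I - J then levy_exponent a c p else 0) +
      (if k \<in> I \<inter> J then levy_exponent a c (p + q) else 0) + (if k \<in>
          J - I then levy_exponent a c q else 0)"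
      by (cases "k \<in> I"; cases "k \<in> J") simp_all
  qed
  also have "\<dots> = real (card (I - J)) * levy_exponent a c p + real (card (I \<inter> J)) *
      levy_exponent a c (p + q) + real (card (J - I)) * levy_exponent a c q"
  proof -
    have "(\<Sum>k\<in>K. if k \<in> A then v else 0) = real (card A) * v" if "A \<subseteq> K" for A and v :: real
      using that sum.inter_restrict[OF assms(1), of "\<lambda>_. v" A] by (simp add: Int_absorb1)
    moreover have "I - J \<subseteq> K" "I \<inter> J \<subseteq> K" "J - I \<subseteq> K" using assms by auto
    ultimately show ?thesis unfolding sum.distrib by presburger
  qed
  finally show ?thesis by (simp add: pair_cf_def add_divide_distrib)
qed

lemma expectation_delta_deriv_kernel_cov:
  defines "I \<equiv> \<lambda>t. {fst t..<snd t :: nat}"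
  shows "expectation (\<lambda>\<omega>. delta_deriv e (step_sum \<omega> s) * delta_deriv e (step_sum \<omega> t)) =
    kernel_cov a c e (real (card (I s - I t)) / N) (real (card (I s \<inter> I t)) / N)
        (real (card (I t - I s)) / N)"
proof -
  let ?K = "I s \<union> I t"
  have K: "finite ?K" "{fst s..<snd s} \<subseteq> ?K" "{fst t..<snd t} \<subseteq> ?K" by (auto simp: I_def)
  have "expectation (\<lambda>\<omega>. delta_deriv e (step_sum \<omega> s) * delta_deriv e (step_sum \<omega> t)) =
    expectation (\<lambda>\<omega>. delta_deriv e (0 + (\<Sum>k\<in>?K. interval_ind s k * \<xi> k \<omega>)) * delta_deriv e (0 +
        (\<Sum>k\<in>?K. interval_ind t k * \<xi> k \<omega>)))"
    using step_sum_interval_ind[OF K(1,2)] step_sum_interval_ind[OF K(1,3)] by simp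
  also have "\<dots> = (\<integral>z. (1/2) * (freq_kernel e (fst z) * freq_kernel e (snd z) *
      (pair_cf ?K (interval_ind s) (interval_ind t) (fst z) (- snd z) - pair_cf ?K (interval_ind s)
      (interval_ind t) (fst z) (snd z))) \<partial>plane)"
    unfolding expectation_delta_deriv_delta_deriv[OF K(1)]
    by (intro Bochner_Integration.integral_cong) auto
  also have "\<dots> = kernel_cov a c e (real (card (I s - I t)) / N) (real (card (I s \<inter> I t)) / N)
      (real (card (I t - I s)) / N)"
  proof -
    have split: "exp (- (A * x + B * y + C * z)) - exp (- (A * x + B * y' + C * z)) =
      exp (- (A * x + C * z)) * (exp (- (B * y)) - exp (- (B * y')))" for A B C x y y' z :: real
      by (simp add: exp_add exp_minus exp_diff field_simps)
    have eeq: "pair_cf ?K (interval_ind s) (interval_ind t) p q =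
        exp (- (real (card (I s - I t)) / N * levy_exponent a c p +
        real (card (I s \<inter> I t)) / N * levy_exponent a c (p + q) + real (card (I t - I s)) / N *
            levy_exponent a c q))" for p q
      unfolding pair_cf_interval_ind[OF K] by (simp only: I_def)
    show ?thesis
      unfolding kernel_cov_def eeq integral_mult_right_zero levy_exponent_minus split by simp
  qed
  finally show ?thesis .
qed

lemma expectation_delta_deriv_delta_deriv_nonneg: "0 \<le>
    expectation (\<lambda>\<omega>. delta_deriv e (step_sum \<omega> s) * delta_deriv e (step_sum \<omega> t))"
  unfolding expectation_delta_deriv_kernel_cov using c0 a1 by (intro kernel_cov_nonneg) auto

lemma expectation_delta_deriv_delta_deriv_le: 
  assumes [measurable]: "X \<in> borel_measurable M" "Y \<in> borel_measurable M"
  shows "\<bar>expectation (\<lambda>\<omega>. delta_deriv e (X \<omega>) * delta_deriv e (Y \<omega>))\<bar> \<le> (freq_kernel_norm e)\<^sup>2"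
proof -
  have "\<bar>expectation (\<lambda>\<omega>. delta_deriv e (X \<omega>) * delta_deriv e (Y \<omega>))\<bar> \<le>
      expectation (\<lambda>\<omega>. \<bar>delta_deriv e (X \<omega>) * delta_deriv e (Y \<omega>)\<bar>)"
    by (rule integral_abs_bound)
  also have "\<dots> \<le> (freq_kernel_norm e)\<^sup>2"
    using delta_deriv_bound[OF e0] freq_kernel_norm_nonneg
    by (intro integral_le_const integrable_abs integrable_delta_deriv_delta_deriv AE_I2)
       (auto simp: abs_mult power2_eq_square intro!: mult_mono)
  finally show ?thesis .
qed

section \<open>Second moment of the double sum over pairs after a given time\<close>

definition pairs :: "nat \<Rightarrow> (nat \<times> nat) set" where
  "pairs j = {(i, r). j < i \<and> i < r \<and> r \<le> N}"

lemma finite_pairs [simp]: "finite (pairs j)"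
  by (rule finite_subset[of _ "{..N} \<times> {..N}"]) (auto simp: pairs_def)

lemma second_moment_expand:
  "expectation (\<lambda>\<omega>. ((\<Sum>t\<in>pairs j. delta_deriv e (step_sum \<omega> t)) / real N ^ 2)\<^sup>2) =
   1 / real N ^ 4 * (\<Sum>t\<in>pairs j \<times> pairs j. expectation (\<lambda>\<omega>. delta_deriv e (step_sum \<omega> (fst t)) *
       delta_deriv e (step_sum \<omega> (snd t))))"
proof -
  have "((\<Sum>t\<in>pairs j. delta_deriv e (step_sum \<omega> t)) / real N ^ 2)\<^sup>2 =
    1 / real N ^ 4 * (\<Sum>t\<in>pairs j \<times> pairs j. delta_deriv e (step_sum \<omega> (fst t)) *
        delta_deriv e (step_sum \<omega> (snd t)))" for \<omega>
    by (simp add: power_divide power2_eq_square sum_product sum.cartesian_product case_prod_beta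
        flip: power_mult)
      (simp add: power4_eq_xxxx)
  then show ?thesis by (simp add: integrable_delta_deriv_delta_deriv)
qed

text \<open>Disjoint intervals have covariance 0. A coincidence of two endpoints leaves only three
  free indices, which after division by \<open>N ^ 4\<close> is an error of order
  \<open>1 / N\<close>. In the two interleaved and two nested orders the smallest endpoint is free
  and the three gaps range over \<open>cube N\<close>, so each order contributes at most 8 units:
  \<open>32 = 4 * 8\<close>.\<close>

lemma pairs_second_moment:
  "expectation (\<lambda>\<omega>. ((\<Sum>t\<in>pairs j. delta_deriv e (step_sum \<omega> t)) / real N ^ 2)\<^sup>2) \<le>
    4 * (freq_kernel_norm e)\<^sup>2 / N + 32 * variance_scale a c e * resolvent_mass a c"
proof -
  define q where "q = (\<lambda>((i, r), (i', r')). expectation (\<lambda>\<omega>. delta_deriv e (step_sum \<omega> (i, r)) *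
      delta_deriv e (step_sum \<omega> (i', r'))))"
  have q0: "0 \<le> q t" for t unfolding q_def
    by (cases t) (auto intro!: expectation_delta_deriv_delta_deriv_nonneg)
  have qF: "q t \<le> (freq_kernel_norm e)\<^sup>2" for t unfolding q_def
    using expectation_delta_deriv_delta_deriv_le[of "\<lambda>\<omega>. step_sum \<omega> (fst t)"
        "\<lambda>\<omega>. step_sum \<omega> (snd t)"]
    by (auto simp: case_prod_beta)
  have qQ: "q ((i, r), (i', r')) = kernel_cov a c e (real (card ({i..<r} - {i'..<r'})) / N)
      (real (card ({i..<r} \<inter> {i'..<r'})) / N) (real (card ({i'..<r'} - {i..<r})) / N)" for i r i' r'
    unfolding q_def using expectation_delta_deriv_kernel_cov[of "(i, r)" "(i', r')"] by simp
  let ?U = "pairs j \<times> pairs j"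
  \<comment> \<open>Cases 0 to 3 are coinciding endpoints, 4 and 5 interleaved, 6 and 7 nested
    intervals. Cases may overlap, because every \<open>q t\<close> is nonnegative.\<close>
  define P :: "nat \<Rightarrow> (nat \<times> nat) \<times> (nat \<times> nat) \<Rightarrow> bool" where
    "P k = (\<lambda>((i, r), (i', r')). [i = i', i = r', r = i', r = r', i < i' \<and> i' < r \<and> r < r',
        i' < i \<and> i < r' \<and> r' < r,
       i < i' \<and> r' < r, i' < i \<and> r < r'] ! k)" for k
  have "(\<Sum>t\<in>?U. q t) \<le> (\<Sum>t\<in>?U. \<Sum>k<8. if P k t then q t else 0)"
  proof (intro sum_mono)
    fix t assume "t \<in> ?U"
    obtain i r i' r' where t: "t = ((i, r), (i', r'))" by (metis prod.exhaust)
    have o: "i < r" "i' < r'" using \<open>t \<in> ?U\<close> unfolding t pairs_def by auto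
    show "q t \<le> (\<Sum>k<8. if P k t then q t else 0)"
    proof (cases "\<exists>k<8. P k t")
      case True
      then obtain k where k: "k < 8" "P k t" by auto
      then have "q t = (if P k t then q t else 0)" by simp
      also have "\<dots> \<le> (\<Sum>k<8. if P k t then q t else 0)"
        using k q0 by (intro member_le_sum) auto
      finally show ?thesis .
    next
      case False
      then have n: "\<not> P 0 t" "\<not> P 1 t" "\<not> P 2 t" "\<not> P 3 t" "\<not> P 4 t" "\<not> P 5 t" "\<not> P 6 t" "\<not> P 7 t"
        by auto
      \<comment> \<open>Excluding all eight cases leaves separated intervals, whose overlap has
        length 0.\<close>
      have "r < i' \<or> r' < i" using n o unfolding P_def t by (simp add: numeral_eq_Suc) arith
      then have "{i..<r} \<inter> {i'..<r'} = {}" by auto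
      then have "q t = 0" unfolding t qQ by (simp only: card.empty) simp
      then show ?thesis using q0 by (auto intro!: sum_nonneg)
    qed
  qed
  also have "\<dots> = (\<Sum>k<8. \<Sum>t\<in>{t\<in>?U. P k t}. q t)"
    by (subst sum.swap) (simp add: sum.inter_filter)
  finally have split: "(\<Sum>t\<in>?U. q t) \<le> (\<Sum>k<8. \<Sum>t\<in>{t\<in>?U. P k t}. q t)" .
  have coinc: "(\<Sum>t\<in>{t\<in>?U. P k t}. q t) \<le> (freq_kernel_norm e)\<^sup>2 * real N ^ 3" if "k < 4" for k
  proof -
    have k: "k = 0 \<or> k = 1 \<or> k = 2 \<or> k = 3" using that by auto
    \<comment> \<open>Drops the endpoint that the equation recovers: \<open>i\<close> for
      \<open>k \<le> 1\<close>, otherwise \<open>r\<close>.\<close>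
    define \<phi> :: "(nat \<times> nat) \<times> (nat \<times> nat) \<Rightarrow> nat \<times> nat \<times> nat" where
      "\<phi> = (\<lambda>((i, r), (i', r')). if k \<le> 1 then (r, i', r') else (i, i', r'))"
    have "(\<Sum>t\<in>{t\<in>?U. P k t}. q t) \<le> (\<Sum>t\<in>{t\<in>?U. P k t}. (\<lambda>_. (freq_kernel_norm e)\<^sup>2) (\<phi> t))"
      by (intro sum_mono qF)
    also have "\<dots> \<le> (\<Sum>s\<in>cube N. (freq_kernel_norm e)\<^sup>2)"
    proof (intro sum_inj_le)
      show "inj_on \<phi> {t\<in>?U. P k t}"
        using k by (auto simp: inj_on_def \<phi>_def P_def numeral_eq_Suc)
      show "\<phi> ` {t\<in>?U. P k t} \<subseteq> cube N"
        by (auto simp: \<phi>_def pairs_def split: if_splits)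
    qed auto
    also have "\<dots> = (freq_kernel_norm e)\<^sup>2 * real N ^ 3"
      by (simp add: card_cartesian_product power3_eq_cube)
    finally show ?thesis .
  qed
  have swap: "(\<Sum>t\<in>{1..N} \<times> cube N. h (snd t)) = real N * (\<Sum>s\<in>cube N. h s)"
      for h :: "nat \<times> nat \<times> nat \<Rightarrow> real"
    by (subst sum.cartesian_product'[of _ "{1..N}"]) simp
  have inter: "(\<Sum>t\<in>{t\<in>?U. P k t}. q t) \<le>
      real N * (real N ^ 3 * (8 * variance_scale a c e * resolvent_mass a c))" if k: "k = 4 \<or> k = 5"
      for k
  proof -
    \<comment> \<open>The smallest endpoint, followed by the three gaps between consecutive
      endpoints.\<close>
    define \<phi> :: "(nat \<times> nat) \<times> (nat \<times> nat) \<Rightarrow> nat \<times> nat \<times> nat \<times> nat" where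
      "\<phi> = (\<lambda>((i, r), (i', r')). if k = 4 then (i, i' - i, r - i', r' - r) else (i', i - i', r' - i,
          r - r'))"
    define h where "h = (\<lambda>(A,B,C). kernel_cov a c e (real A / N) (real B / N) (real C / N))"
    note Qs = kernel_cov_commute[of a c e]
    have "(\<Sum>t\<in>{t\<in>?U. P k t}. q t) = (\<Sum>t\<in>{t\<in>?U. P k t}. (\<lambda>s. h (snd s)) (\<phi> t))"
    proof (intro sum.cong refl)
      fix t assume t': "t \<in> {t\<in>?U. P k t}"
      obtain i r i' r' where t: "t = ((i, r), (i', r'))" by (metis prod.exhaust)
      show "q t = h (snd (\<phi> t))"
      proof (cases "k = 4")
        case True
        then have o: "i < i'" "i' < r" "r < r'"
          using t' unfolding t P_def by (auto simp: numeral_eq_Suc)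
        then have "{i..<r} - {i'..<r'} = {i..<i'}" "{i..<r} \<inter> {i'..<r'} = {i'..<r}"
            "{i'..<r'} - {i..<r} = {r..<r'}" by auto
        then show ?thesis unfolding t qQ using True by (simp add: h_def \<phi>_def)
      next
        case False
        then have o: "i' < i" "i < r'" "r' < r"
          using t' k unfolding t P_def by (auto simp: numeral_eq_Suc)
        then have "{i..<r} - {i'..<r'} = {r'..<r}" "{i..<r} \<inter> {i'..<r'} = {i..<r'}"
            "{i'..<r'} - {i..<r} = {i'..<i}" by auto
        then show ?thesis unfolding t qQ using False Qs[of "real (i - i') / N"]
          by (simp add: h_def \<phi>_def)
      qed
    qed
    also have "\<dots> \<le> (\<Sum>t\<in>{1..N} \<times> cube N. h (snd t))"
    proof (intro sum_inj_le)
      show "inj_on \<phi> {t\<in>?U. P k t}"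
        using k by (auto simp: inj_on_def \<phi>_def P_def numeral_eq_Suc)
      show "\<phi> ` {t\<in>?U. P k t} \<subseteq> {1..N} \<times> cube N"
        using k by (auto simp: \<phi>_def pairs_def P_def numeral_eq_Suc)
      show "0 \<le> h (snd s)" for s unfolding h_def using c0 a1
        by (cases s) (auto intro!: kernel_cov_nonneg)
    qed auto
    also have "\<dots> = real N * (real N ^ 3 * (1 / real N ^ 3 * (\<Sum>s\<in>cube N. h s)))"
      unfolding swap using N0 by simp
    also have "\<dots> \<le> real N * (real N ^ 3 * (8 * variance_scale a c e * resolvent_mass a c))"
      unfolding h_def using e0 c0 a1 a2 N0 by (intro mult_left_mono sum_kernel_cov_interleaved) auto
    finally show ?thesis .
  qed
  have nest: "(\<Sum>t\<in>{t\<in>?U. P k t}. q t) \<le>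
      real N * (real N ^ 3 * (8 * variance_scale a c e * resolvent_mass a c))" if k: "k = 6 \<or> k = 7"
      for k
  proof -
    define \<phi> :: "(nat \<times> nat) \<times> (nat \<times> nat) \<Rightarrow> nat \<times> nat \<times> nat \<times> nat" where
      "\<phi> = (\<lambda>((i, r), (i', r')). if k = 6 then (i, i' - i, r' - i', r - r') else (i', i - i', r - i,
          r' - r))"
    \<comment> \<open>Both outer gaps belong to the longer interval, hence the length
      \<open>A + C\<close>; the shorter interval has nothing outside it, hence the 0.\<close>
    define h where "h = (\<lambda>(A,B,C). kernel_cov a c e (real (A + C) / N) (real B / N) 0)"
    note Qs = kernel_cov_commute[of a c e]
    have "(\<Sum>t\<in>{t\<in>?U. P k t}. q t) = (\<Sum>t\<in>{t\<in>?U. P k t}. (\<lambda>s. h (snd s)) (\<phi> t))"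
    proof (intro sum.cong refl)
      fix t assume t': "t \<in> {t\<in>?U. P k t}"
      obtain i r i' r' where t: "t = ((i, r), (i', r'))" by (metis prod.exhaust)
      have o: "i < r" "i' < r'" using t' unfolding t pairs_def by auto
      have c: "card ({x..<y} - {x'..<y'}) = (x' - x) + (y - y')" "{x..<y} \<inter> {x'..<y'} = {x'..<y'}"
        "{x'..<y'} - {x..<y} = {}" if "x < x'" "x' < y'" "y' < y" for x y x' y' :: nat
      proof -
        have "{x..<y} - {x'..<y'} = {x..<x'} \<union> {y'..<y}" using that by auto
        then show "card ({x..<y} - {x'..<y'}) = (x' - x) + (y - y')"
          by (simp, subst card_Un_disjoint) (use that in auto)
      qed (use that in auto)
      show "q t = h (snd (\<phi> t))"
      proof (cases "k = 6")
        case True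
        then have o2: "i < i'" "r' < r" using t' unfolding t P_def by (auto simp: numeral_eq_Suc)
        have z: "card ({i'..<r'} - {i..<r}) = 0" "card ({i..<r} \<inter> {i'..<r'}) = r' - i'"
          "card ({i..<r} - {i'..<r'}) = (i' - i) + (r - r')"
          using c[OF o2(1) o(2) o2(2)] by auto
        show ?thesis unfolding t qQ z using True by (simp add: h_def \<phi>_def)
      next
        case False
        then have o2: "i' < i" "r < r'" using t' k unfolding t P_def by (auto simp: numeral_eq_Suc)
        have z: "card ({i..<r} - {i'..<r'}) = 0" "card ({i..<r} \<inter> {i'..<r'}) = r - i"
          "card ({i'..<r'} - {i..<r}) = (i - i') + (r' - r)"
          using c[OF o2(1) o(1) o2(2)] by (auto simp: Int_commute)
        show ?thesis unfolding t qQ z using False by (simp add: h_def \<phi>_def Qs[of 0])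
      qed
    qed
    also have "\<dots> \<le> (\<Sum>t\<in>{1..N} \<times> cube N. h (snd t))"
    proof (intro sum_inj_le)
      show "inj_on \<phi> {t\<in>?U. P k t}"
      proof (rule inj_onI)
        fix s t assume st: "s \<in> {t\<in>?U. P k t}" "t \<in> {t\<in>?U. P k t}" "\<phi> s = \<phi> t"
        obtain i r i' r' where s: "s = ((i, r), (i', r'))" by (metis prod.exhaust)
        obtain u v u' v' where t: "t = ((u, v), (u', v'))" by (metis prod.exhaust)
        have o: "i < r" "i' < r'" "u < v" "u' < v'" using st unfolding s t pairs_def by auto
        show "s = t"
        proof (cases "k = 6")
          case True
          then have "i < i'" "r' < r" "u < u'" "v' < v"
            using st unfolding s t P_def by (auto simp: numeral_eq_Suc)
          moreover have "i = u" "i' - i = u' - u" "r' - i' = v' - u'" "r - r' = v - v'"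
            using st(3) True by (auto simp: \<phi>_def s t)
          ultimately have "i = u" "i' = u'" "r' = v'" "r = v" using o by linarith+
          then show ?thesis by (simp add: s t)
        next
          case False
          then have "i' < i" "r < r'" "u' < u" "v < v'"
            using st k unfolding s t P_def by (auto simp: numeral_eq_Suc)
          moreover have "i' = u'" "i - i' = u - u'" "r - i = v - u" "r' - r = v' - v"
            using st(3) False by (auto simp: \<phi>_def s t)
          ultimately have "i' = u'" "i = u" "r = v" "r' = v'" using o by linarith+
          then show ?thesis by (simp add: s t)
        qed
      qed
      show "\<phi> ` {t\<in>?U. P k t} \<subseteq> {1..N} \<times> cube N"
        using k by (auto simp: \<phi>_def pairs_def P_def numeral_eq_Suc)
      show "0 \<le> h (snd s)" for s unfolding h_def using c0 a1
        by (cases s) (auto intro!: kernel_cov_nonneg)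
    qed auto
    also have "\<dots> = real N * (real N ^ 3 * (1 / real N ^ 3 * (\<Sum>s\<in>cube N. h s)))"
      unfolding swap using N0 by simp
    also have "\<dots> \<le> real N * (real N ^ 3 * (8 * variance_scale a c e * resolvent_mass a c))"
      unfolding h_def using e0 c0 a1 a2 N0 by (intro mult_left_mono sum_kernel_cov_nested) auto
    finally show ?thesis .
  qed
  have "(\<Sum>t\<in>?U. q t) \<le> 4 * ((freq_kernel_norm e)\<^sup>2 * real N ^ 3) + 4 *
      (real N * (real N ^ 3 * (8 * variance_scale a c e * resolvent_mass a c)))"
    using split coinc[of 0] coinc[of 1] coinc[of 2] coinc[of 3] inter[of 4] inter[of 5] nest[of 6]
        nest[of 7]
    by (simp add: numeral_eq_Suc)
  then have "1 / real N ^ 4 * (\<Sum>t\<in>?U. q t) \<le>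
      1 / real N ^ 4 * (4 * ((freq_kernel_norm e)\<^sup>2 * real N ^ 3) + 4 *
      (real N * (real N ^ 3 * (8 * variance_scale a c e * resolvent_mass a c))))"
    by (intro mult_left_mono) auto
  also have "\<dots> = 4 * (freq_kernel_norm e)\<^sup>2 / N + 32 * variance_scale a c e * resolvent_mass a c"
    using N0 by (simp add: field_simps power_numeral_reduce)
  finally show ?thesis
    unfolding second_moment_expand q_def by (simp add: case_prod_beta)
qed

end

section \<open>Occupation energy\<close>

text \<open>The squared modulus of the exponential sum with phases \<open>y\<close>, in a real form
  that expands into cosines of differences.\<close>

definition phase_power :: "nat set \<Rightarrow> (nat \<Rightarrow> real) \<Rightarrow> real" where
  "phase_power I y = (\<Sum>i\<in>I. cos (y i))\<^sup>2 + (\<Sum>i\<in>I. sin (y i))\<^sup>2"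

lemma phase_power_alt: "phase_power I y = (\<Sum>i\<in>I. \<Sum>j\<in>I. cos (y i - y j))"
  by (simp add: phase_power_def cos_diff sum.distrib power2_eq_square sum_product)

lemma phase_power_nonneg: "0 \<le> phase_power I y"
  by (simp add: phase_power_def)

lemma phase_power_le: "phase_power I y \<le> (real (card I))\<^sup>2"
proof -
  have "phase_power I y \<le> (\<Sum>i\<in>I. \<Sum>j\<in>I. 1)" unfolding phase_power_alt by (intro sum_mono) auto
  then show ?thesis by (simp add: power2_eq_square)
qed

lemma phase_power_shift: "phase_power I (\<lambda>i. p * (z + x i)) = phase_power I (\<lambda>i. p * x i)"
  by (simp add: phase_power_alt algebra_simps)

text \<open>Lets the past be viewed backwards from its last position.\<close>

lemma phase_power_reflect: "phase_power I (\<lambda>i. p * (z - x i)) = phase_power I (\<lambda>i. p * x i)"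
proof -
  have "cos (p * (z - x i) - p * (z - x j)) = cos (p * x i - p * x j)" for i j
  proof -
    have "p * (z - x i) - p * (z - x j) = - (p * x i - p * x j)" by (simp add: algebra_simps)
    then show ?thesis by (simp only: cos_minus)
  qed
  then show ?thesis by (simp add: phase_power_alt)
qed

lemma phase_power_minus: "phase_power I (\<lambda>i. - (y i)) = phase_power I y"
  by (simp add: phase_power_def sum_negf)

lemma sqrt_phase_power: "sqrt (phase_power I y) = cmod (\<Sum>i\<in>I. cis (y i))"
  by (simp add: phase_power_def cmod_def)

lemma sqrt_phase_power_tri:
  assumes "i \<le> j" "j \<le> k"
  shows "sqrt (phase_power {i<..k} y) \<le> sqrt (phase_power {i<..j} y) + sqrt (phase_power {j<..k} y)"
    "sqrt (phase_power {i<..j} y) \<le> sqrt (phase_power {i<..k} y) + sqrt (phase_power {j<..k} y)"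
proof -
  have "{i<..k} = {i<..j} \<union> {j<..k}" using assms by auto
  then have s: "(\<Sum>r\<in>{i<..k}. cis (y r)) = (\<Sum>r\<in>{i<..j}. cis (y r)) + (\<Sum>r\<in>{j<..k}. cis (y r))"
    by (simp add: sum.union_disjoint)
  show "sqrt (phase_power {i<..k} y) \<le> sqrt (phase_power {i<..j} y) + sqrt (phase_power {j<..k} y)"
    unfolding sqrt_phase_power s by (rule norm_triangle_ineq)
  have "(\<Sum>r\<in>{i<..j}. cis (y r)) = (\<Sum>r\<in>{i<..k}. cis (y r)) - (\<Sum>r\<in>{j<..k}. cis (y r))"
    using s by simp
  then show "sqrt (phase_power {i<..j} y) \<le> sqrt (phase_power {i<..k} y) +
      sqrt (phase_power {j<..k} y)"
    unfolding sqrt_phase_power using norm_triangle_ineq4 by metis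
qed

text \<open>Minkowski's inequality for a weighted square norm, obtained by integrating \<open>(u +
  v)\<^sup>2 \<le> (1 + s) * u\<^sup>2 + (1 + 1 / s) * v\<^sup>2\<close> and choosing
  \<open>s\<close> afterwards.\<close>

lemma integral_minkowski:
  fixes u v w wt :: "'b \<Rightarrow> real"
  assumes wt: "\<And>x. 0 \<le> wt x" and w: "\<And>x. 0 \<le> w x" "\<And>x. w x \<le> u x + v x"
    and u: "\<And>x. 0 \<le> u x" and v: "\<And>x. 0 \<le> v x"
    and int: "integrable K (\<lambda>x. wt x * (u x)\<^sup>2)" "integrable K (\<lambda>x. wt x * (v x)\<^sup>2)"
        "integrable K (\<lambda>x. wt x * (w x)\<^sup>2)"
  shows "sqrt (\<integral>x. wt x * (w x)\<^sup>2 \<partial>K) \<le> sqrt (\<integral>x. wt x * (u x)\<^sup>2 \<partial>K) + sqrt (\<integral>x. wt x * (v x)\<^sup>2 \<partial>K)"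
proof -
  define A where "A = (\<integral>x. wt x * (u x)\<^sup>2 \<partial>K)"
  define B where "B = (\<integral>x. wt x * (v x)\<^sup>2 \<partial>K)"
  define C where "C = (\<integral>x. wt x * (w x)\<^sup>2 \<partial>K)"
  have A0: "0 \<le> A" and B0: "0 \<le> B" unfolding A_def B_def
    using wt by (auto intro!: Bochner_Integration.integral_nonneg)
  have key: "C \<le> (1 + s) * A + (1 + 1 / s) * B" if s: "0 < s" for s
  proof -
    have "C \<le> (\<integral>x. (1 + s) * (wt x * (u x)\<^sup>2) + (1 + 1 / s) * (wt x * (v x)\<^sup>2) \<partial>K)"
      unfolding C_def
    proof (intro integral_mono int Bochner_Integration.integrable_add integrable_mult_right)
      fix x
      have "(w x)\<^sup>2 \<le> (u x + v x)\<^sup>2" using w by (intro power_mono) auto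
      also have "\<dots> = (u x)\<^sup>2 + (v x)\<^sup>2 + 2 * (sqrt s * u x) * (v x / sqrt s)"
        using s by (simp add: power2_sum)
      also have "\<dots> \<le> (u x)\<^sup>2 + (v x)\<^sup>2 + ((sqrt s * u x)\<^sup>2 + (v x / sqrt s)\<^sup>2)"
        by (intro add_left_mono sum_squares_bound)
      also have "\<dots> = (1 + s) * (u x)\<^sup>2 + (1 + 1 / s) * (v x)\<^sup>2"
        using s by (simp add: power_mult_distrib power_divide algebra_simps)
      finally have "wt x * (w x)\<^sup>2 \<le> wt x * ((1 + s) * (u x)\<^sup>2 + (1 + 1 / s) * (v x)\<^sup>2)"
        using wt by (intro mult_left_mono)
      then show "wt x * (w x)\<^sup>2 \<le> (1 + s) * (wt x * (u x)\<^sup>2) + (1 + 1 / s) * (wt x * (v x)\<^sup>2)"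
        by (simp add: algebra_simps)
    qed
    also have "\<dots> = (1 + s) * A + (1 + 1 / s) * B"
      unfolding A_def B_def using int by (subst Bochner_Integration.integral_add) auto
    finally show ?thesis .
  qed
  have "C \<le> (sqrt A + sqrt B)\<^sup>2"
  proof (rule ccontr)
    assume n: "\<not> C \<le> (sqrt A + sqrt B)\<^sup>2"
    consider "A = 0" | "B = 0" | "0 < A" "0 < B" using A0 B0 by linarith
    then show False
    proof cases
      case 1
      then have CB: "B < C" using n B0 by simp
      \<comment> \<open>There is no optimal \<open>s\<close> when \<open>A = 0\<close>; this one is
        large enough to push \<open>B / s\<close> below the gap \<open>C - B\<close>.\<close>
      define s where "s = (2 * B + 1) / (C - B)"
      have "0 < s" using CB B0 by (simp add: s_def)
      from key[OF this] 1 have "C \<le> B + B / s" by (simp add: algebra_simps)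
      moreover have "B / s < C - B"
      proof -
        have "B * (C - B) < (C - B) * (2 * B + 1)"
          using CB B0 by (subst mult.commute) (intro mult_strict_left_mono, auto)
        then show ?thesis using CB B0 by (simp add: s_def pos_divide_less_eq)
      qed
      ultimately show False by simp
    next
      case 2
      then have CA: "A < C" using n A0 by simp
      \<comment> \<open>The mirror case: small enough to push \<open>s * A\<close> below the gap
        \<open>C - A\<close>.\<close>
      define s where "s = (C - A) / (2 * A + 1)"
      have "0 < s" using CA A0 by (simp add: s_def)
      from key[OF this] 2 have "C \<le> A + s * A" by (simp add: algebra_simps)
      moreover have "s * A < C - A"
      proof -
        have "(C - A) * A < (C - A) * (2 * A + 1)" using CA A0 by (intro mult_strict_left_mono) auto
        then show ?thesis using CA A0 by (simp add: s_def pos_divide_less_eq)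
      qed
      ultimately show False by simp
    next
      case 3
      define x where "x = sqrt A"
      define y where "y = sqrt B"
      have xy: "0 < x" "0 < y" "A = x\<^sup>2" "B = y\<^sup>2" using 3 by (auto simp: x_def y_def)
      \<comment> \<open>The minimiser \<open>s = sqrt B / sqrt A\<close> makes the bound a perfect
        square.\<close>
      have "C \<le> (1 + y / x) * x\<^sup>2 + (1 + 1 / (y / x)) * y\<^sup>2" using key[of "y / x"] xy by simp
      also have "\<dots> = (x + y)\<^sup>2" using xy(1,2) by (simp add: field_simps power2_eq_square)
      finally show False using n by (simp add: x_def y_def)
    qed
  qed
  then show ?thesis
    unfolding A_def[symmetric] B_def[symmetric] C_def[symmetric]
    using A0 B0 by (intro real_le_lsqrt) auto
qed

section \<open>Energy of the occupation measure and the cross term between past and future\<close>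

context walk
begin

text \<open>The squared Fourier transform of the counting measure on the points \<open>x\<close>,
  multiplied by the square of the kernel that defines \<open>delta_deriv\<close>.\<close>

definition occupation_spectrum :: "nat set \<Rightarrow> (nat \<Rightarrow> real) \<Rightarrow> real \<Rightarrow> real" where
  "occupation_spectrum I x p = (freq_kernel e p)\<^sup>2 * phase_power I (\<lambda>i. p * x i)"

lemma occupation_spectrum_measurable [measurable]: "occupation_spectrum I x \<in>
    borel_measurable borel"
  unfolding occupation_spectrum_def phase_power_def by measurable

lemma occupation_spectrum_nonneg: "0 \<le> occupation_spectrum I x p"
  by (simp add: occupation_spectrum_def phase_power_nonneg)

lemma occupation_spectrum_minus: "occupation_spectrum I x (- p) = occupation_spectrum I x p"
  using phase_power_minus[of I "\<lambda>i. p * x i"] by (simp add: occupation_spectrum_def)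

lemma resolvent_nonneg: "0 \<le> resolvent a c p"
  using resolvent_pos[of c a p] c0 by simp

lemma integrable_gauss2: "integrable lborel (\<lambda>p. p\<^sup>2 * exp (- (e * p\<^sup>2 / 2)))"
  using integrable_gauss_moment[OF e0, of 2] by simp

lemma resolvent_occupation_spectrum_le: "resolvent a c p * occupation_spectrum I x p \<le>
    (real (card I))\<^sup>2 * (p\<^sup>2 * exp (- (e * p\<^sup>2 / 2)))"
proof -
  have "resolvent a c p * occupation_spectrum I x p \<le> 1 * ((p\<^sup>2 * exp (- (e * p\<^sup>2 / 2))) *
      (real (card I))\<^sup>2)"
    unfolding occupation_spectrum_def
    using resolvent_nonneg resolvent_le1[of c a p] c0 phase_power_nonneg e0
    by (intro mult_mono freq_kernel_sq_le phase_power_le mult_nonneg_nonneg) auto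
  then show ?thesis by (simp add: mult_ac)
qed

lemma integrable_resolvent_occupation_spectrum: "integrable lborel (\<lambda>p. resolvent a c p *
    occupation_spectrum I x p)"
proof (rule Bochner_Integration.integrable_bound)
  show "integrable lborel (\<lambda>p. (real (card I))\<^sup>2 * (p\<^sup>2 * exp (- (e * p\<^sup>2 / 2))))"
    by (intro integrable_mult_right integrable_gauss2)
  show "AE p in lborel. norm (resolvent a c p * occupation_spectrum I x p) \<le>
      norm ((real (card I))\<^sup>2 * (p\<^sup>2 * exp (- (e * p\<^sup>2 / 2))))"
    using resolvent_occupation_spectrum_le[of _ I x] resolvent_nonneg occupation_spectrum_nonneg
    by (intro AE_I2) simp
qed measurable

text \<open>The resolvent weight is what remains after averaging over the times of the future walk.
  The square root of the energy is a seminorm of the occupation measure, which supplies both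
  triangle inequalities required by \<open>good_lambda\<close>.\<close>

definition occupation_energy :: "nat set \<Rightarrow> (nat \<Rightarrow> real) \<Rightarrow> real" where
  "occupation_energy I x = (LBINT p. resolvent a c p * occupation_spectrum I x p)"

lemma occupation_energy_nonneg: "0 \<le> occupation_energy I x"
  unfolding occupation_energy_def using resolvent_nonneg occupation_spectrum_nonneg
  by (intro Bochner_Integration.integral_nonneg) auto

lemma occupation_energy_shift: "occupation_energy I (\<lambda>i. z + x i) = occupation_energy I x"
  unfolding occupation_energy_def occupation_spectrum_def phase_power_shift ..

lemma occupation_energy_reflect: "occupation_energy I (\<lambda>i. z - x i) = occupation_energy I x"
  unfolding occupation_energy_def occupation_spectrum_def phase_power_reflect ..

lemma occupation_energy_cong: "(\<And>i. i \<in> I \<Longrightarrow> x i = y i) \<Longrightarrow> occupation_energy I x =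
    occupation_energy I y"
  unfolding occupation_energy_def occupation_spectrum_def phase_power_def by simp

lemma occupation_energy_measurable:
  assumes "\<And>i. i \<in> I \<Longrightarrow> (\<lambda>\<omega>. X i \<omega>) \<in> borel_measurable K"
  shows "(\<lambda>\<omega>. occupation_energy I (\<lambda>i. X i \<omega>)) \<in> borel_measurable K"
proof -
  have [measurable]: "(\<lambda>z. cos (snd z * X i (fst z))) \<in> borel_measurable (K \<Otimes>\<^sub>M lborel)"
     "(\<lambda>z. sin (snd z * X i (fst z))) \<in> borel_measurable (K \<Otimes>\<^sub>M lborel)" if "i \<in> I" for i
    using assms[OF that] by measurable
  show ?thesis unfolding occupation_energy_def occupation_spectrum_def phase_power_def
    by (intro lborel.borel_measurable_lebesgue_integral) (simp add: case_prod_beta)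
qed

lemma occupation_energy_tri:
  assumes "i \<le> j" "j \<le> k"
  shows "sqrt (occupation_energy {i<..k} x) \<le> sqrt (occupation_energy {i<..j} x) +
      sqrt (occupation_energy {j<..k} x)"
    "sqrt (occupation_energy {i<..j} x) \<le> sqrt (occupation_energy {i<..k} x) +
        sqrt (occupation_energy {j<..k} x)"
proof -
  have L: "occupation_energy I x = (LBINT p. resolvent a c p * (freq_kernel e p)\<^sup>2 *
      (sqrt (phase_power I (\<lambda>i. p * x i)))\<^sup>2)" for I
    unfolding occupation_energy_def occupation_spectrum_def
    by (simp add: phase_power_nonneg mult_ac)
  have int: "integrable lborel (\<lambda>p. resolvent a c p * (freq_kernel e p)\<^sup>2 *
      (sqrt (phase_power I (\<lambda>i. p * x i)))\<^sup>2)" for I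
    using integrable_resolvent_occupation_spectrum[of I x] unfolding occupation_spectrum_def
    by (simp add: phase_power_nonneg mult_ac)
  show "sqrt (occupation_energy {i<..k} x) \<le> sqrt (occupation_energy {i<..j} x) +
      sqrt (occupation_energy {j<..k} x)"
    unfolding L by (intro integral_minkowski int sqrt_phase_power_tri assms)
        (auto simp: resolvent_nonneg phase_power_nonneg)
  show "sqrt (occupation_energy {i<..j} x) \<le> sqrt (occupation_energy {i<..k} x) +
      sqrt (occupation_energy {j<..k} x)"
    unfolding L by (intro integral_minkowski int sqrt_phase_power_tri assms)
        (auto simp: resolvent_nonneg phase_power_nonneg)
qed

text \<open>The sums over the past points factor into cosine and sine sums at \<open>p\<close> and
  at \<open>q\<close>. The inequality
  \<open>\<bar>u * v\<bar> \<le> (u\<^sup>2 + v\<^sup>2) / 2\<close> then separates the frequencies: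
  the past enters only through its spectrum, the future only through \<open>pair_cf\<close>.\<close>

lemma frozen_pair:
  assumes "finite I" "finite K"
  shows "ennreal \<bar>expectation (\<lambda>\<omega>. (\<Sum>i\<in>I. delta_deriv e (x i + (\<Sum>k\<in>K. l k * \<xi> k \<omega>))) *
      (\<Sum>i\<in>I. delta_deriv e (x i + (\<Sum>k\<in>K. m k * \<xi> k \<omega>))))\<bar>
    \<le> (\<integral>\<^sup>+p. \<integral>\<^sup>+q. ennreal ((1/2) * (occupation_spectrum I x p + occupation_spectrum I x q) *
        pair_cf K l m p q) \<partial>lborel \<partial>lborel)"
proof -
  let ?X = "\<lambda>i \<omega>. x i + (\<Sum>k\<in>K. l k * \<xi> k \<omega>)" and ?Y = "\<lambda>i \<omega>. x i + (\<Sum>k\<in>K. m k * \<xi> k \<omega>)"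
  let ?k = "\<lambda>i j z. freq_kernel e (fst z) * freq_kernel e (snd z) *
      ((cos (fst z * x i - snd z * x j) * pair_cf K l m (fst z) (- snd z) - cos (fst z * x i +
          snd z * x j) * pair_cf K l m (fst z) (snd z)) / 2)"
  have "expectation (\<lambda>\<omega>. (\<Sum>i\<in>I. delta_deriv e (?X i \<omega>)) * (\<Sum>i\<in>I. delta_deriv e (?Y i \<omega>))) =
    (\<Sum>i\<in>I. \<Sum>j\<in>I. expectation (\<lambda>\<omega>. delta_deriv e (?X i \<omega>) * delta_deriv e (?Y j \<omega>)))"
    unfolding sum_product by (simp add: integrable_delta_deriv_delta_deriv)
  also have "\<dots> = (\<integral>z. (\<Sum>i\<in>I. \<Sum>j\<in>I. ?k i j z) \<partial>plane)"
    unfolding expectation_delta_deriv_delta_deriv[OF assms(2)] using integrable_pair_cf_kernel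
    by simp
  finally have eq: "expectation (\<lambda>\<omega>. (\<Sum>i\<in>I. delta_deriv e (?X i \<omega>)) *
      (\<Sum>i\<in>I. delta_deriv e (?Y i \<omega>))) = (\<integral>z. (\<Sum>i\<in>I. \<Sum>j\<in>I. ?k i j z) \<partial>plane)" .
  define b where "b p q = (1/4) * (occupation_spectrum I x p + occupation_spectrum I x q) *
      pair_cf K l m p q" for p q
  have b0: "0 \<le> b p q" for p q using occupation_spectrum_nonneg pair_cf_bounds(1)[of K l m p q]
    by (simp add: b_def)
  have [measurable]: "(\<lambda>z. b (fst z) (snd z)) \<in> borel_measurable (borel \<Otimes>\<^sub>M borel)"
     "(\<lambda>z. b (fst z) (- snd z)) \<in> borel_measurable (borel \<Otimes>\<^sub>M borel)" unfolding b_def by measurable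
  have [measurable]: "b p \<in> borel_measurable borel" for p unfolding b_def pair_cf_def by measurable
  have bound: "\<bar>\<Sum>i\<in>I. \<Sum>j\<in>I. ?k i j (p, q)\<bar> \<le> b p (- q) + b p q" for p q
  proof -
    let ?C = "\<lambda>p. \<Sum>i\<in>I. cos (p * x i)" and ?D = "\<lambda>p. \<Sum>i\<in>I. sin (p * x i)"
    have s1: "(\<Sum>i\<in>I. \<Sum>j\<in>I. cos (p * x i - q * x j)) = ?C p * ?C q + ?D p * ?D q"
      by (simp add: cos_diff sum.distrib sum_product)
    have s2: "(\<Sum>i\<in>I. \<Sum>j\<in>I. cos (p * x i + q * x j)) = ?C p * ?C q - ?D p * ?D q"
      by (simp add: cos_add sum_subtractf sum_product)
    \<comment> \<open>The sign \<open>t\<close> is 1 for cosines of differences and -1 for cosines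
      of sums.\<close>
    have amgm: "\<bar>freq_kernel e p * freq_kernel e q * (?C p * ?C q + t * (?D p * ?D q))\<bar> \<le>
        (occupation_spectrum I x p + occupation_spectrum I x q) / 2" if "\<bar>t\<bar> = 1" for t
    proof -
      have h: "\<bar>u * v\<bar> \<le> (u\<^sup>2 + v\<^sup>2) / 2" for u v :: real
        using sum_squares_bound[of "\<bar>u\<bar>" "\<bar>v\<bar>"] by (simp add: abs_mult)
      have "\<bar>freq_kernel e p * freq_kernel e q * (?C p * ?C q + t * (?D p * ?D q))\<bar> =
        \<bar>(freq_kernel e p * ?C p) * (freq_kernel e q * ?C q) + t * ((freq_kernel e p * ?D p) *
            (freq_kernel e q * ?D q))\<bar>"
        by (simp add: algebra_simps)
      also have "\<dots> \<le> \<bar>(freq_kernel e p * ?C p) * (freq_kernel e q * ?C q)\<bar> + \<bar>(freq_kernel e p *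
          ?D p) * (freq_kernel e q * ?D q)\<bar>"
        using that by (intro order_trans[OF abs_triangle_ineq]) (simp add: abs_mult)
      also have "\<dots> \<le> ((freq_kernel e p * ?C p)\<^sup>2 + (freq_kernel e q * ?C q)\<^sup>2) / 2 +
          ((freq_kernel e p * ?D p)\<^sup>2 + (freq_kernel e q * ?D q)\<^sup>2) / 2"
        by (intro add_mono h)
      also have "\<dots> = (occupation_spectrum I x p + occupation_spectrum I x q) / 2"
        by (simp add: occupation_spectrum_def phase_power_def power_mult_distrib field_simps)
      finally show ?thesis .
    qed
    have "(\<Sum>i\<in>I. \<Sum>j\<in>I. ?k i j (p, q)) = freq_kernel e p * freq_kernel e q *
      (((\<Sum>i\<in>I. \<Sum>j\<in>I. cos (p * x i - q * x j)) * pair_cf K l m p (- q) -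
          (\<Sum>i\<in>I. \<Sum>j\<in>I. cos (p * x i + q * x j)) * pair_cf K l m p q) / 2)"
      by (simp add: sum_subtractf sum_distrib_left sum_distrib_right sum_divide_distrib
          diff_divide_distrib right_diff_distrib)
    also have "\<dots> = (freq_kernel e p * freq_kernel e q * (?C p * ?C q + 1 * (?D p * ?D q))) *
        (pair_cf K l m p (- q) / 2) -
       (freq_kernel e p * freq_kernel e q * (?C p * ?C q + (-1) * (?D p * ?D q))) *
           (pair_cf K l m p q / 2)"
      unfolding s1 s2 by (simp add: algebra_simps diff_divide_distrib)
    finally have ex: "(\<Sum>i\<in>I. \<Sum>j\<in>I. ?k i j (p, q)) = \<dots>" .
    have "\<bar>\<Sum>i\<in>I. \<Sum>j\<in>I. ?k i j (p, q)\<bar> \<le> \<bar>freq_kernel e p * freq_kernel e q * (?C p * ?C q + 1 *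
        (?D p * ?D q))\<bar> * (pair_cf K l m p (- q) / 2) +
       \<bar>freq_kernel e p * freq_kernel e q * (?C p * ?C q + (-1) * (?D p * ?D q))\<bar> *
           (pair_cf K l m p q / 2)"
      unfolding ex using pair_cf_bounds(1)[of K l m]
      by (intro order_trans[OF abs_triangle_ineq4]) (simp add: abs_mult abs_of_pos)
    also have "\<dots> \<le> (occupation_spectrum I x p + occupation_spectrum I x q) / 2 *
        (pair_cf K l m p (- q) / 2) + (occupation_spectrum I x p + occupation_spectrum I x q) / 2 *
        (pair_cf K l m p q / 2)"
      using pair_cf_bounds(1)[of K l m]
      by (intro add_mono mult_right_mono amgm) (auto simp: less_imp_le)
    also have "\<dots> = b p (- q) + b p q" by (simp add: b_def occupation_spectrum_minus)
    finally show ?thesis .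
  qed
  have "ennreal \<bar>\<integral>z. (\<Sum>i\<in>I. \<Sum>j\<in>I. ?k i j z) \<partial>plane\<bar> \<le>
      (\<integral>\<^sup>+z. ennreal (norm (\<Sum>i\<in>I. \<Sum>j\<in>I. ?k i j z)) \<partial>plane)"
    using integral_norm_bound_ennreal[of plane "\<lambda>z. \<Sum>i\<in>I. \<Sum>j\<in>I. ?k i j z"] integrable_pair_cf_kernel
    by simp
  also have "\<dots> \<le> (\<integral>\<^sup>+z. ennreal (b (fst z) (- snd z)) + ennreal (b (fst z) (snd z)) \<partial>plane)"
  proof (intro nn_integral_mono)
    fix z :: "real \<times> real"
    show "ennreal (norm (\<Sum>i\<in>I. \<Sum>j\<in>I. ?k i j z)) \<le> ennreal (b (fst z) (- snd z)) +
        ennreal (b (fst z) (snd z))"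
      using bound[of "fst z" "snd z"] b0
      by (subst ennreal_plus[symmetric]) (auto simp del: ennreal_plus intro!: ennreal_leI)
  qed
  also have "\<dots> = (\<integral>\<^sup>+p. \<integral>\<^sup>+q. ennreal (b p (- q)) \<partial>lborel \<partial>lborel) +
      (\<integral>\<^sup>+p. \<integral>\<^sup>+q. ennreal (b p q) \<partial>lborel \<partial>lborel)"
    using plane_nn_integral[of "\<lambda>p q. ennreal (b p (- q))"] plane_nn_integral[of
        "\<lambda>p q. ennreal (b p q)"]
    by (subst nn_integral_add) auto
  also have "(\<integral>\<^sup>+p. \<integral>\<^sup>+q. ennreal (b p (- q)) \<partial>lborel \<partial>lborel) =
      (\<integral>\<^sup>+p. \<integral>\<^sup>+q. ennreal (b p q) \<partial>lborel \<partial>lborel)"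
    using nn_integral_translate(4)[of "\<lambda>q. ennreal (b p q)" for p] by simp
  also have "(\<integral>\<^sup>+p. \<integral>\<^sup>+q. ennreal (b p q) \<partial>lborel \<partial>lborel) +
      (\<integral>\<^sup>+p. \<integral>\<^sup>+q. ennreal (b p q) \<partial>lborel \<partial>lborel) =
    (\<integral>\<^sup>+z. ennreal (b (fst z) (snd z)) + ennreal (b (fst z) (snd z)) \<partial>plane)"
    using plane_nn_integral[of "\<lambda>p q. ennreal (b p q)"] by (subst nn_integral_add) auto
  also have "\<dots> = (\<integral>\<^sup>+z. ennreal ((1/2) * (occupation_spectrum I x (fst z) + occupation_spectrum I x
      (snd z)) * pair_cf K l m (fst z) (snd z)) \<partial>plane)"
    using b0 by (intro nn_integral_cong) (simp add: b_def mult.commute flip: ennreal_plus)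
  also have "\<dots> = (\<integral>\<^sup>+p. \<integral>\<^sup>+q. ennreal ((1/2) * (occupation_spectrum I x p + occupation_spectrum I x
      q) * pair_cf K l m p q) \<partial>lborel \<partial>lborel)"
    by (rule plane_nn_integral[of "\<lambda>p q. ennreal ((1/2) * (occupation_spectrum I x p +
        occupation_spectrum I x q) * pair_cf K l m p q)"]) measurable
  finally show ?thesis unfolding eq .
qed

text \<open>Two ordered times after \<open>j\<close> are encoded by the gaps from \<open>j\<close>
  to the first and from the first to the second. This is an injection into a square, over which the
  exponential factorises.\<close>

lemma ordered_double_sum:
  assumes "j \<le> N"
  shows "(\<Sum>t\<in>Sigma {j<..N} (\<lambda>q. {j<..<q}). exp (- (real (snd t - j) / N * u + real (fst t - snd t) /
      N * v))) \<le>
    (\<Sum>k=1..N. exp (- (real k / N * u))) * (\<Sum>k=1..N. exp (- (real k / N * v)))"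
proof -
  define h where "h s = exp (- (real (fst s) / N * u)) * exp (- (real (snd s) / N * v))"
      for s :: "nat \<times> nat"
  have "(\<Sum>t\<in>Sigma {j<..N} (\<lambda>q. {j<..<q}). exp (- (real (snd t - j) / N * u + real (fst t - snd t) /
      N * v))) =
    (\<Sum>t\<in>Sigma {j<..N} (\<lambda>q. {j<..<q}). h ((\<lambda>t. (snd t - j, fst t - snd t)) t))"
    by (intro sum.cong) (auto simp: h_def simp flip: exp_add)
  also have "\<dots> \<le> (\<Sum>s\<in>{1..N} \<times> {1..N}. h s)"
    by (intro sum_inj_le) (auto simp: inj_on_def h_def)
  also have "\<dots> = (\<Sum>k=1..N. exp (- (real k / N * u))) * (\<Sum>k=1..N. exp (- (real k / N * v)))"
    by (simp add: h_def sum_product sum.cartesian_product case_prod_beta)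
  finally show ?thesis .
qed

text \<open>With the spectrum at \<open>p\<close>, the integral over \<open>q\<close> is a
  convolution and costs \<open>2 * 8\<close> by \<open>resolvent_conv\<close>; with the spectrum at
  \<open>q\<close>, integrating over \<open>p\<close> first costs 2. Either way one resolvent
  survives as the weight in \<open>occupation_energy\<close>, and
  \<open>18 = 16 + 2\<close>.\<close>

lemma occupation_spectrum_resolvent_resolvent_integral:
  "(\<integral>\<^sup>+p. \<integral>\<^sup>+q. ennreal (2 * (occupation_spectrum I x p + occupation_spectrum I x q) *
      resolvent a c (p + q) * resolvent a c q) \<partial>lborel \<partial>lborel) \<le> ennreal (18 * resolvent_mass a c *
      occupation_energy I x)"
proof -
  have L: "(\<integral>\<^sup>+p. ennreal (resolvent a c p * occupation_spectrum I x p) \<partial>lborel) =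
      ennreal (occupation_energy I x)"
    unfolding occupation_energy_def using resolvent_nonneg occupation_spectrum_nonneg
    by (intro nn_integral_eq_integral integrable_resolvent_occupation_spectrum) auto
  have exp_moment_const: "0 \<le> resolvent_mass a c" using c0 by (rule resolvent_mass_nonneg)
  have "(\<integral>\<^sup>+p. \<integral>\<^sup>+q. ennreal (2 * (occupation_spectrum I x p + occupation_spectrum I x q) *
      resolvent a c (p + q) * resolvent a c q) \<partial>lborel \<partial>lborel) =
    (\<integral>\<^sup>+p. \<integral>\<^sup>+q. ennreal (2 * occupation_spectrum I x p) * ennreal (resolvent a c (p + q) *
        resolvent a c q) + ennreal (2 * (resolvent a c q * occupation_spectrum I x q)) *
        ennreal (resolvent a c (p + q)) \<partial>lborel \<partial>lborel)"
    using occupation_spectrum_nonneg resolvent_nonneg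
    by (intro nn_integral_cong) (simp add: algebra_simps flip: ennreal_mult ennreal_plus)
  also have "\<dots> = (\<integral>\<^sup>+p. \<integral>\<^sup>+q. ennreal (2 * occupation_spectrum I x p) *
      ennreal (resolvent a c (p + q) * resolvent a c q) \<partial>lborel \<partial>lborel) +
     (\<integral>\<^sup>+p. \<integral>\<^sup>+q. ennreal (2 * (resolvent a c q * occupation_spectrum I x q)) *
         ennreal (resolvent a c (p + q)) \<partial>lborel \<partial>lborel)"
    by (simp add: nn_integral_add)
  finally have t0: "(\<integral>\<^sup>+p. \<integral>\<^sup>+q. ennreal (2 * (occupation_spectrum I x p + occupation_spectrum I x
      q) * resolvent a c (p + q) * resolvent a c q) \<partial>lborel \<partial>lborel) =
    (\<integral>\<^sup>+p. \<integral>\<^sup>+q. ennreal (2 * occupation_spectrum I x p) * ennreal (resolvent a c (p + q) *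
        resolvent a c q) \<partial>lborel \<partial>lborel) + (\<integral>\<^sup>+p. \<integral>\<^sup>+q. ennreal (2 * (resolvent a c q *
        occupation_spectrum I x q)) * ennreal (resolvent a c (p + q)) \<partial>lborel \<partial>lborel)" .
  have "(\<integral>\<^sup>+p. \<integral>\<^sup>+q. ennreal (2 * (resolvent a c q * occupation_spectrum I x q)) *
      ennreal (resolvent a c (p + q)) \<partial>lborel \<partial>lborel) =
     (\<integral>\<^sup>+q. \<integral>\<^sup>+p. ennreal (2 * (resolvent a c q * occupation_spectrum I x q)) *
         ennreal (resolvent a c (p + q)) \<partial>lborel \<partial>lborel)"
    by (rule lborel_pair.Fubini') simp
  also have "\<dots> = (\<integral>\<^sup>+q. ennreal (2 * resolvent_mass a c) * ennreal (resolvent a c q *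
      occupation_spectrum I x q) \<partial>lborel)"
  proof (intro nn_integral_cong)
    fix q
    have "(\<integral>\<^sup>+p. ennreal (2 * (resolvent a c q * occupation_spectrum I x q)) *
        ennreal (resolvent a c (p + q)) \<partial>lborel) =
      ennreal (2 * (resolvent a c q * occupation_spectrum I x q)) * ennreal (resolvent_mass a c)"
      using c0 a1 by (simp add: nn_integral_cmult nn_integral_translate(2)[of
          "\<lambda>u. ennreal (resolvent a c u)"] nn_integral_resolvent)
    then show "(\<integral>\<^sup>+p. ennreal (2 * (resolvent a c q * occupation_spectrum I x q)) *
        ennreal (resolvent a c (p + q)) \<partial>lborel) =
      ennreal (2 * resolvent_mass a c) * ennreal (resolvent a c q * occupation_spectrum I x q)"
      using exp_moment_const resolvent_nonneg occupation_spectrum_nonneg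
      by (simp add: mult_ac flip: ennreal_mult)
  qed
  also have "\<dots> = ennreal (2 * resolvent_mass a c * occupation_energy I x)"
    using exp_moment_const occupation_energy_nonneg
    by (simp add: nn_integral_cmult L flip: ennreal_mult)
  finally have t1: "(\<integral>\<^sup>+p. \<integral>\<^sup>+q. ennreal (2 * (resolvent a c q * occupation_spectrum I x q)) *
      ennreal (resolvent a c (p + q)) \<partial>lborel \<partial>lborel) = ennreal (2 * resolvent_mass a c *
      occupation_energy I x)" .
  have "(\<integral>\<^sup>+p. \<integral>\<^sup>+q. ennreal (2 * occupation_spectrum I x p) * ennreal (resolvent a c (p + q) *
      resolvent a c q) \<partial>lborel \<partial>lborel) =
    (\<integral>\<^sup>+p. ennreal (2 * occupation_spectrum I x p) * (\<integral>\<^sup>+q. ennreal (resolvent a c (p + q) *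
        resolvent a c q) \<partial>lborel) \<partial>lborel)"
    by (simp add: nn_integral_cmult)
  also have "\<dots> \<le> (\<integral>\<^sup>+p. ennreal (2 * occupation_spectrum I x p) * ennreal (8 * resolvent_mass a c *
      resolvent a c p) \<partial>lborel)"
  proof (intro nn_integral_mono mult_left_mono)
    fix p
    have "(\<integral>\<^sup>+q. ennreal (resolvent a c (p + q) * resolvent a c q) \<partial>lborel) =
        (\<integral>\<^sup>+q. ennreal (resolvent a c q * resolvent a c (p - q)) \<partial>lborel)"
      using nn_integral_translate(4)[of "\<lambda>q. ennreal (resolvent a c q * resolvent a c (p - q))"]
      by (simp add: mult.commute)
    also have "\<dots> \<le> ennreal (8 * resolvent_mass a c * resolvent a c p)"
      using c0 a1 a2 by (rule resolvent_conv)
    finally show "(\<integral>\<^sup>+q. ennreal (resolvent a c (p + q) * resolvent a c q) \<partial>lborel) \<le>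
        ennreal (8 * resolvent_mass a c * resolvent a c p)" .
  qed auto
  also have "\<dots> = (\<integral>\<^sup>+p. ennreal (16 * resolvent_mass a c) * ennreal (resolvent a c p *
      occupation_spectrum I x p) \<partial>lborel)"
    using occupation_spectrum_nonneg resolvent_nonneg exp_moment_const
    by (intro nn_integral_cong) (simp add: mult_ac flip: ennreal_mult)
  also have "\<dots> = ennreal (16 * resolvent_mass a c * occupation_energy I x)"
    using exp_moment_const occupation_energy_nonneg
    by (simp add: nn_integral_cmult L flip: ennreal_mult)
  finally have "(\<integral>\<^sup>+p. \<integral>\<^sup>+q. ennreal (2 * occupation_spectrum I x p) *
      ennreal (resolvent a c (p + q) * resolvent a c q) \<partial>lborel \<partial>lborel) \<le>
      ennreal (16 * resolvent_mass a c * occupation_energy I x)" .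
  then have "(\<integral>\<^sup>+p. \<integral>\<^sup>+q. ennreal (2 * (occupation_spectrum I x p + occupation_spectrum I x q) *
      resolvent a c (p + q) * resolvent a c q) \<partial>lborel \<partial>lborel) \<le>
     ennreal (16 * resolvent_mass a c * occupation_energy I x) + ennreal (2 * resolvent_mass a c *
         occupation_energy I x)"
    unfolding t0 t1 by (rule add_right_mono)
  also have "\<dots> = ennreal (18 * resolvent_mass a c * occupation_energy I x)"
    using exp_moment_const occupation_energy_nonneg[of I x] by (simp flip: ennreal_plus)
  finally show ?thesis .
qed

text \<open>Equal future times contribute a crude error of order \<open>1 / N\<close>. For two
  different future times both increments start at \<open>j\<close>, so their common part carries the
  frequency \<open>p + q\<close> and the excess carries \<open>q\<close>; averaging yields two
  resolvents. The 36 counts the constant 18 for both orders of the two times.\<close>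

lemma frozen_second_moment:
  assumes "finite I" "card I \<le> N" "j \<le> N"
  shows "expectation (\<lambda>\<omega>. ((\<Sum>r\<in>{j<..N}. \<Sum>i\<in>I. delta_deriv e (x i + step_sum \<omega> (j, r))) / real N ^
      2)\<^sup>2) \<le>
    (freq_kernel_norm e)\<^sup>2 / N + 36 * resolvent_mass a c * (occupation_energy I x / real N ^ 2)"
proof -
  let ?T = "Sigma {j<..N} (\<lambda>q. {j<..<q})"
  let ?K = "{j..<N}"
  define G where "G r \<omega> = (\<Sum>i\<in>I. delta_deriv e (x i + step_sum \<omega> (j, r)))" for r \<omega>
  have [measurable]: "G r \<in> borel_measurable M" for r unfolding G_def by measurable
  have Gb: "\<bar>G r \<omega>\<bar> \<le> N * freq_kernel_norm e" for r \<omega>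
  proof -
    have "\<bar>G r \<omega>\<bar> \<le> (\<Sum>i\<in>I. freq_kernel_norm e)" unfolding G_def
      by (intro order_trans[OF sum_abs] sum_mono delta_deriv_bound e0)
    also have "\<dots> \<le> N * freq_kernel_norm e" using assms freq_kernel_norm_nonneg[of e]
      by (auto intro!: mult_right_mono)
    finally show ?thesis .
  qed
  have Gi: "integrable M (\<lambda>\<omega>. G r \<omega> * G q \<omega>)" for r q
    using mult_mono[OF Gb Gb] freq_kernel_norm_nonneg[of e]
    by (intro integrable_const_bound[where B="(N * freq_kernel_norm e) * (N * freq_kernel_norm e)"])
        (auto simp: abs_mult)
  have Gi2: "integrable M (\<lambda>\<omega>. (G r \<omega>)\<^sup>2)" for r using Gi[of r r] by (simp add: power2_eq_square)
  have diag: "expectation (\<lambda>\<omega>. (G r \<omega>)\<^sup>2) \<le> (N * freq_kernel_norm e)\<^sup>2" for r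
  proof (intro integral_le_const Gi2 AE_I2)
    fix \<omega>
    show "(G r \<omega>)\<^sup>2 \<le> (N * freq_kernel_norm e)\<^sup>2" using power_mono[OF Gb[of r \<omega>], of 2] by simp
  qed
  have off: "(\<Sum>t\<in>?T. expectation (\<lambda>\<omega>. G (snd t) \<omega> * G (fst t) \<omega>)) / real N ^ 2 \<le>
      18 * resolvent_mass a c * occupation_energy I x"
  proof -
    define y where "y t p q = (1/2) * (occupation_spectrum I x p + occupation_spectrum I x q) *
        pair_cf ?K (interval_ind (j, snd t)) (interval_ind (j, fst t)) p q" for t p q
    have st: "step_sum \<omega> (j, r) = (\<Sum>k\<in>?K. interval_ind (j, r) k * \<xi> k \<omega>)" if "r \<le> N" for r \<omega>
      using that by (intro step_sum_interval_ind) auto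
    have "ennreal (1 / real N ^ 2 * (\<Sum>t\<in>?T. \<bar>expectation (\<lambda>\<omega>. G (snd t) \<omega> * G (fst t) \<omega>)\<bar>)) \<le>
      (\<integral>\<^sup>+p. \<integral>\<^sup>+q. ennreal (2 * (occupation_spectrum I x p + occupation_spectrum I x q) *
          resolvent a c (p + q) * resolvent a c q) \<partial>lborel \<partial>lborel)"
    proof (rule ennreal_sum_le_nn_integral2[where y = y])
      fix t assume t: "t \<in> ?T"
      show "0 \<le> y t p q" for p q using occupation_spectrum_nonneg pair_cf_bounds
        by (simp add: y_def less_imp_le)
      show "(\<lambda>z. y t (fst z) (snd z)) \<in> borel_measurable (borel \<Otimes>\<^sub>M borel)"
        unfolding y_def by measurable
      have r: "snd t \<le> N" "fst t \<le> N" using t by auto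
      show "ennreal \<bar>expectation (\<lambda>\<omega>. G (snd t) \<omega> * G (fst t) \<omega>)\<bar> \<le>
          (\<integral>\<^sup>+p. \<integral>\<^sup>+q. ennreal (y t p q) \<partial>lborel \<partial>lborel)"
        unfolding G_def y_def st[OF r(1)] st[OF r(2)] using assms by (intro frozen_pair) auto
    next
      fix p q
      have "(\<Sum>t\<in>?T. y t p q) = (1/2) * (occupation_spectrum I x p + occupation_spectrum I x q) *
        (\<Sum>t\<in>?T. exp (- (real (snd t - j) / N * levy_exponent a c (p + q) + real (fst t - snd t) / N
            * levy_exponent a c q)))"
        unfolding sum_distrib_left
      proof (intro sum.cong refl)
        fix t assume t: "t \<in> ?T"
        then have s: "{j..<snd t} - {j..<fst t} = {}" "{j..<snd t} \<inter> {j..<fst t} = {j..<snd t}"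
            "{j..<fst t} - {j..<snd t} = {snd t..<fst t}"
          "{j..<snd t} \<subseteq> {j..<N}" "{j..<fst t} \<subseteq> {j..<N}" by auto
        have "pair_cf ?K (interval_ind (j, snd t)) (interval_ind (j, fst t)) p q =
          exp (- (real (snd t - j) / N * levy_exponent a c (p + q) + real (fst t - snd t) / N *
              levy_exponent a c q))"
          by (subst pair_cf_interval_ind) (use s in simp_all)
        then show "y t p q = (1/2) * (occupation_spectrum I x p + occupation_spectrum I x q) *
            exp (- (real (snd t - j) / N * levy_exponent a c (p + q) + real (fst t - snd t) / N *
            levy_exponent a c q))"
          by (simp add: y_def)
      qed
      also have "\<dots> \<le> (1/2) * (occupation_spectrum I x p + occupation_spectrum I x q) *
        ((\<Sum>k=1..N. exp (- (real k / N * levy_exponent a c (p + q)))) *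
            (\<Sum>k=1..N. exp (- (real k / N * levy_exponent a c q))))"
        using occupation_spectrum_nonneg assms by (intro mult_left_mono ordered_double_sum) auto
      finally have "1 / real N ^ 2 * (\<Sum>t\<in>?T. y t p q) \<le>
          1 / real N ^ 2 * ((1/2) * (occupation_spectrum I x p + occupation_spectrum I x q) *
        ((\<Sum>k=1..N. exp (- (real k / N * levy_exponent a c (p + q)))) *
            (\<Sum>k=1..N. exp (- (real k / N * levy_exponent a c q)))))"
        by (intro mult_left_mono) auto
      also have "\<dots> = (1/2) * (occupation_spectrum I x p + occupation_spectrum I x q) *
        ((\<Sum>k=1..N. exp (- (real k / N * levy_exponent a c (p + q)))) / N *
            ((\<Sum>k=1..N. exp (- (real k / N * levy_exponent a c q))) / N))"
        by (simp add: power2_eq_square)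
      also have "\<dots> \<le> (1/2) * (occupation_spectrum I x p + occupation_spectrum I x q) *
          ((2 * resolvent a c (p + q)) * (2 * resolvent a c q))"
        using occupation_spectrum_nonneg c0 N0 resolvent_nonneg
        by (intro mult_left_mono mult_mono geometric_average_resolvent)
            (auto intro!: divide_nonneg_nonneg sum_nonneg)
      also have "\<dots> = 2 * (occupation_spectrum I x p + occupation_spectrum I x q) *
          resolvent a c (p + q) * resolvent a c q" by simp
      finally show "1 / real N ^ 2 * (\<Sum>t\<in>?T. y t p q) \<le>
          2 * (occupation_spectrum I x p + occupation_spectrum I x q) * resolvent a c (p + q) *
          resolvent a c q" .
    qed auto
    also have "\<dots> \<le> ennreal (18 * resolvent_mass a c * occupation_energy I x)"
      by (rule occupation_spectrum_resolvent_resolvent_integral)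
    finally have "1 / real N ^ 2 * (\<Sum>t\<in>?T. \<bar>expectation (\<lambda>\<omega>. G (snd t) \<omega> * G (fst t) \<omega>)\<bar>) \<le>
        18 * resolvent_mass a c * occupation_energy I x"
      using resolvent_mass_nonneg[OF c0, of a] occupation_energy_nonneg[of I x]
      by (subst (asm) ennreal_le_iff) auto
    moreover have "(\<Sum>t\<in>?T. expectation (\<lambda>\<omega>. G (snd t) \<omega> * G (fst t) \<omega>)) \<le>
        (\<Sum>t\<in>?T. \<bar>expectation (\<lambda>\<omega>. G (snd t) \<omega> * G (fst t) \<omega>)\<bar>)"
      by (intro sum_mono) auto
    then have "1 / real N ^ 2 * (\<Sum>t\<in>?T. expectation (\<lambda>\<omega>. G (snd t) \<omega> * G (fst t) \<omega>)) \<le>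
        1 / real N ^ 2 * (\<Sum>t\<in>?T. \<bar>expectation (\<lambda>\<omega>. G (snd t) \<omega> * G (fst t) \<omega>)\<bar>)"
      by (intro mult_left_mono) auto
    ultimately show ?thesis by simp
  qed
  have "expectation (\<lambda>\<omega>. ((\<Sum>r\<in>{j<..N}. G r \<omega>) / real N ^ 2)\<^sup>2) =
    expectation (\<lambda>\<omega>. (1 / real N ^ 4) * ((\<Sum>r\<in>{j<..N}. (G r \<omega>)\<^sup>2) + 2 * (\<Sum>t\<in>?T. G (snd t) \<omega> *
        G (fst t) \<omega>)))"
    unfolding power_divide square_sum_ordered by (simp flip: power_mult)
  also have "\<dots> = (1 / real N ^ 4) * ((\<Sum>r\<in>{j<..N}. expectation (\<lambda>\<omega>. (G r \<omega>)\<^sup>2)) + 2 *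
      (\<Sum>t\<in>?T. expectation (\<lambda>\<omega>. G (snd t) \<omega> * G (fst t) \<omega>)))"
    by (simp add: Gi Gi2)
  also have "\<dots> \<le> (1 / real N ^ 4) * (real N * (N * freq_kernel_norm e)\<^sup>2 + 2 *
      (real N ^ 2 * (18 * resolvent_mass a c * occupation_energy I x)))"
  proof (intro mult_left_mono add_mono)
    have "(\<Sum>r\<in>{j<..N}. expectation (\<lambda>\<omega>. (G r \<omega>)\<^sup>2)) \<le> (\<Sum>r\<in>{j<..N}. (N * freq_kernel_norm e)\<^sup>2)"
      by (intro sum_mono diag)
    also have "\<dots> \<le> real N * (N * freq_kernel_norm e)\<^sup>2" by (auto intro!: mult_right_mono)
    finally show "(\<Sum>r\<in>{j<..N}. expectation (\<lambda>\<omega>. (G r \<omega>)\<^sup>2)) \<le> real N * (N * freq_kernel_norm e)\<^sup>2" .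
    show "(\<Sum>t\<in>?T. expectation (\<lambda>\<omega>. G (snd t) \<omega> * G (fst t) \<omega>)) \<le>
        real N ^ 2 * (18 * resolvent_mass a c * occupation_energy I x)"
      using off N0 by (simp add: field_simps)
  qed auto
  also have "\<dots> = (freq_kernel_norm e)\<^sup>2 / N + 36 * resolvent_mass a c *
      (occupation_energy I x / real N ^ 2)"
    using N0 by (simp add: field_simps power_numeral_reduce)
  finally show ?thesis unfolding G_def .
qed

end

section \<open>Exponential tails for a random walk\<close>

text \<open>A discretisation term: it bounds the energy of a single point and the diagonal part of
  the expected energy, and is absorbed into \<open>variance_scale\<close> once \<open>N\<close> is
  large.\<close>

definition gauss_second_moment :: "real \<Rightarrow> real" where
  "gauss_second_moment e = (LBINT p. p\<^sup>2 * exp (- (e * p\<^sup>2 / 2)))"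

lemma gauss_second_moment_nonneg: "0 \<le> gauss_second_moment e"
  unfolding gauss_second_moment_def by (intro Bochner_Integration.integral_nonneg) auto

definition triangle :: "nat \<Rightarrow> (nat \<times> nat) set" where
  "triangle j = {(i, r). 0 < i \<and> i < r \<and> r \<le> j}"

lemma in_triangle [simp]: "(i, r) \<in> triangle j \<longleftrightarrow> 0 < i \<and> i < r \<and> r \<le> j"
  by (simp add: triangle_def)

lemma finite_triangle [simp]: "finite (triangle j)"
  by (rule finite_subset[of _ "{..j} \<times> {..j}"]) auto

section \<open>Filtration of the walk and conditioning on the past\<close>

context walk
begin

abbreviation "past_space j \<equiv> PiM {..<j} (\<lambda>_. borel :: real measure)"
abbreviation "future_space j \<equiv> PiM {j..<N} (\<lambda>_. borel :: real measure)"

text \<open>The restriction makes the history a point of the product space, so that independence of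
  past and future becomes a statement about product measures.\<close>

definition past :: "nat \<Rightarrow> 'a \<Rightarrow> nat \<Rightarrow> real" where
  "past j \<omega> = restrict (\<lambda>k. \<xi> k \<omega>) {..<j}"

definition future :: "nat \<Rightarrow> 'a \<Rightarrow> nat \<Rightarrow> real" where
  "future j \<omega> = restrict (\<lambda>k. \<xi> k \<omega>) {j..<N}"

definition past_algebra :: "nat \<Rightarrow> 'a measure" where
  "past_algebra j = vimage_algebra (space M) (past j) (past_space j)"

lemma past_measurable [measurable]: "past j \<in> measurable M (past_space j)"
  unfolding past_def[abs_def] by (intro measurable_restrict) auto

lemma future_measurable [measurable]: "future j \<in> measurable M (future_space j)"
  unfolding future_def[abs_def] by (intro measurable_restrict) auto

lemma space_past_algebra: "space (past_algebra j) = space M"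
  by (simp add: past_algebra_def)

lemma sets_past_algebra: "sets (past_algebra j) = {past j -` A \<inter> space M | A. A \<in>
    sets (past_space j)}"
  unfolding past_algebra_def using measurable_space[OF past_measurable]
  by (intro sets_vimage_algebra2) auto

lemma sets_past_algebra_subset: "sets (past_algebra j) \<subseteq> sets M"
  unfolding sets_past_algebra using measurable_sets[OF past_measurable] by auto

lemma xi_past_algebra: assumes "k < j" shows "\<xi> k \<in> borel_measurable (past_algebra j)"
proof -
  have "past j \<in> measurable (past_algebra j) (past_space j)"
    unfolding past_algebra_def using measurable_space[OF past_measurable]
    by (intro measurable_vimage_algebra1) auto
  then have "(\<lambda>\<omega>. past j \<omega> k) \<in> borel_measurable (past_algebra j)"
    by (rule measurable_compose[OF _ measurable_component_singleton]) (use assms in auto)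
  then show ?thesis using assms by (simp add: past_def)
qed

lemma sets_past_algebra_mono: assumes "i \<le> j" shows "sets (past_algebra i) \<subseteq> sets (past_algebra j)"
proof -
  have "past i \<in> measurable (past_algebra j) (past_space i)"
    unfolding past_def[abs_def] using assms by (intro measurable_restrict xi_past_algebra) auto
  then have "past i -` A \<inter> space M \<in> sets (past_algebra j)" if "A \<in> sets (past_space i)" for A
    using measurable_sets[OF _ that, of "past i" "past_algebra j"] by (simp add: space_past_algebra)
  then show ?thesis unfolding sets_past_algebra[of i] by auto
qed

lemma step_sum_past_algebra: assumes "snd t \<le> j" shows "(\<lambda>\<omega>. step_sum \<omega> t) \<in>
    borel_measurable (past_algebra j)"
  unfolding step_sum_def using assms by (intro borel_measurable_sum xi_past_algebra) auto

text \<open>Past and future are independent vectors, so their joint law is a product and the future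
  integrates out for each fixed history \<open>h\<close>. This replaces conditional expectations.
  The bound \<open>\<kappa>\<close> may depend on the history, which is essential for the cross
  term.\<close>

lemma freezing:
  assumes [measurable]: "(\<lambda>z. D (fst z) (snd z)) \<in>
      borel_measurable (past_space j \<Otimes>\<^sub>M future_space j)"
    and [measurable]: "\<kappa> \<in> borel_measurable (past_space j)"
    and le: "\<And>h. (\<integral>\<^sup>+\<omega>. D h (future j \<omega>) \<partial>M) \<le> \<kappa> h"
    and E: "E \<in> sets (past_algebra j)"
  shows "(\<integral>\<^sup>+\<omega>. D (past j \<omega>) (future j \<omega>) * indicator E \<omega> \<partial>M) \<le>
      (\<integral>\<^sup>+\<omega>. \<kappa> (past j \<omega>) * indicator E \<omega> \<partial>M)"
proof -
  obtain B where B [measurable]: "B \<in> sets (past_space j)" and EB: "E = past j -` B \<inter> space M"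
    using E unfolding sets_past_algebra by auto
  let ?P1 = "distr M (past_space j) (past j)" and ?P2 = "distr M (future_space j) (future j)"
  interpret P1: prob_space ?P1 by (rule prob_space_distr) measurable
  interpret P2: prob_space ?P2 by (rule prob_space_distr) measurable
  have iv: "indep_var (past_space j) (past j) (future_space j) (future j)"
    unfolding past_def[abs_def] future_def[abs_def] by (intro indep_var_restrict[OF indep]) auto
  then have eq: "?P1 \<Otimes>\<^sub>M ?P2 = distr M (past_space j \<Otimes>\<^sub>M future_space j) (\<lambda>\<omega>. (past j \<omega>,
      future j \<omega>))"
    by (simp add: indep_var_distribution_eq)
  have "(\<integral>\<^sup>+\<omega>. D (past j \<omega>) (future j \<omega>) * indicator E \<omega> \<partial>M) =
    (\<integral>\<^sup>+\<omega>. (\<lambda>z. D (fst z) (snd z) * indicator B (fst z)) (past j \<omega>, future j \<omega>) \<partial>M)"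
    by (intro nn_integral_cong) (auto simp: EB indicator_def)
  also have "\<dots> = (\<integral>\<^sup>+z. D (fst z) (snd z) * indicator B (fst z) \<partial>(?P1 \<Otimes>\<^sub>M ?P2))"
    unfolding eq by (rule nn_integral_distr[symmetric]) measurable
  also have "\<dots> = (\<integral>\<^sup>+h. \<integral>\<^sup>+f. D h f * indicator B h \<partial>?P2 \<partial>?P1)"
    using P2.nn_integral_fst[of "\<lambda>z. D (fst z) (snd z) * indicator B (fst z)" ?P1] by simp
  also have "\<dots> \<le> (\<integral>\<^sup>+h. \<kappa> h * indicator B h \<partial>?P1)"
  proof (rule nn_integral_mono)
    fix h assume "h \<in> space ?P1"
    then have [measurable]: "D h \<in> borel_measurable (future_space j)"
      using measurable_compose_Pair1[of h "past_space j" "\<lambda>z. D (fst z) (snd z)" "future_space j"]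
      by simp
    have "(\<integral>\<^sup>+f. D h f * indicator B h \<partial>?P2) = (\<integral>\<^sup>+f. D h f \<partial>?P2) * indicator B h"
      by (simp add: nn_integral_multc)
    also have "(\<integral>\<^sup>+f. D h f \<partial>?P2) = (\<integral>\<^sup>+\<omega>. D h (future j \<omega>) \<partial>M)"
      by (rule nn_integral_distr) measurable
    also have "\<dots> * indicator B h \<le> \<kappa> h * indicator B h" by (intro mult_right_mono le) auto
    finally show "(\<integral>\<^sup>+f. D h f * indicator B h \<partial>?P2) \<le> \<kappa> h * indicator B h" .
  qed
  also have "\<dots> = (\<integral>\<^sup>+\<omega>. \<kappa> (past j \<omega>) * indicator B (past j \<omega>) \<partial>M)"
    by (rule nn_integral_distr) measurable
  also have "\<dots> = (\<integral>\<^sup>+\<omega>. \<kappa> (past j \<omega>) * indicator E \<omega> \<partial>M)"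
    by (intro nn_integral_cong) (auto simp: EB indicator_def)
  finally show ?thesis .
qed

text \<open>The diagonal gives at most \<open>N\<close>. A pair of times at distance
  \<open>k\<close> gives \<open>exp (- (k / N * levy_exponent a c p))\<close>, and the average of
  these over \<open>k\<close> is at most twice the resolvent.\<close>

lemma expectation_phase_power:
  assumes "j \<le> N"
  shows "expectation (\<lambda>\<omega>. phase_power {j<..N} (\<lambda>r. p * step_sum \<omega> (j, r))) \<le>
      N + 4 * real N ^ 2 * resolvent a c p"
proof -
  let ?T = "Sigma {j<..N} (\<lambda>q. {j<..<q})"
  have ex: "phase_power {j<..N} (\<lambda>r. p * step_sum \<omega> (j, r)) =
    real (N - j) + 2 * (\<Sum>t\<in>?T. cos (0 + (\<Sum>k\<in>{snd t..<fst t}. p * \<xi> k \<omega>)))" for \<omega>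
  proof -
    let ?y = "\<lambda>r. p * step_sum \<omega> (j, r)"
    have "phase_power {j<..N} ?y = (\<Sum>r\<in>{j<..N}. (cos (?y r))\<^sup>2 + (sin (?y r))\<^sup>2) +
      2 * (\<Sum>t\<in>?T. cos (?y (snd t)) * cos (?y (fst t)) + sin (?y (snd t)) * sin (?y (fst t)))"
      unfolding phase_power_def square_sum_ordered
      by (simp only: sum.distrib) (simp add: algebra_simps)
    also have "(\<Sum>r\<in>{j<..N}. (cos (?y r))\<^sup>2 + (sin (?y r))\<^sup>2) = real (N - j)" by simp
    also have "(\<Sum>t\<in>?T. cos (?y (snd t)) * cos (?y (fst t)) + sin (?y (snd t)) * sin (?y (fst t))) =
      (\<Sum>t\<in>?T. cos (0 + (\<Sum>k\<in>{snd t..<fst t}. p * \<xi> k \<omega>)))"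
    proof (intro sum.cong refl)
      fix t assume t: "t \<in> ?T"
      have "{j..<fst t} = {j..<snd t} \<union> {snd t..<fst t}" using t by auto
      then have "step_sum \<omega> (j, fst t) = step_sum \<omega> (j, snd t) + (\<Sum>k\<in>{snd t..<fst t}. \<xi> k \<omega>)"
        unfolding step_sum_def fst_conv snd_conv by (simp only:) (intro sum.union_disjoint, auto)
      then have "(\<Sum>k\<in>{snd t..<fst t}. p * \<xi> k \<omega>) = ?y (fst t) - ?y (snd t)"
        by (simp add: sum_distrib_left right_diff_distrib distrib_left)
      then show "cos (?y (snd t)) * cos (?y (fst t)) + sin (?y (snd t)) * sin (?y (fst t)) =
        cos (0 + (\<Sum>k\<in>{snd t..<fst t}. p * \<xi> k \<omega>))"
        by (simp add: cos_diff mult.commute)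
    qed
    finally show ?thesis .
  qed
  have int: "integrable M (\<lambda>\<omega>. cos (0 + (\<Sum>k\<in>A. p * \<xi> k \<omega>)))" for A
    by (rule integrable_const_bound[where B=1]) auto
  have "expectation (\<lambda>\<omega>. phase_power {j<..N} (\<lambda>r. p * step_sum \<omega> (j, r))) =
    real (N - j) + 2 * (\<Sum>t\<in>?T. expectation (\<lambda>\<omega>. cos (0 + (\<Sum>k\<in>{snd t..<fst t}. p * \<xi> k \<omega>))))"
    unfolding ex using int by (simp add: prob_space)
  also have "\<dots> = real (N - j) + 2 *
      (\<Sum>t\<in>?T. exp (- (real (snd t - j) / N * 0 + real (fst t - snd t) / N * levy_exponent a c p)))"
    using expectation_cos[of _ 0 "\<lambda>_. p"] by simp
  also have "\<dots> \<le> N + 2 * ((\<Sum>k=1..N. exp (- (real k / N * 0))) *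
      (\<Sum>k=1..N. exp (- (real k / N * levy_exponent a c p))))"
    using assms by (intro add_mono mult_left_mono ordered_double_sum) auto
  also have "\<dots> = N + 2 * (real N ^ 2 * ((\<Sum>k=1..N. exp (- (real k / N * levy_exponent a c p))) / N))"
    using N0 by (simp add: power2_eq_square)
  also have "\<dots> \<le> N + 2 * (real N ^ 2 * (2 * resolvent a c p))"
    using c0 N0 by (intro add_left_mono mult_left_mono geometric_average_resolvent) auto
  finally show ?thesis by simp
qed

text \<open>One resolvent is the weight in the energy and a second one comes from averaging over the
  walk; together they form \<open>variance_scale\<close>.\<close>

lemma occupation_energy_expectation:
  assumes "j \<le> N"
  shows "(\<integral>\<^sup>+\<omega>. ennreal (occupation_energy {j<..N} (\<lambda>r. step_sum \<omega> (j, r)) / real N ^ 2) \<partial>M) \<le>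
      ennreal (gauss_second_moment e / N + 4 * variance_scale a c e)"
proof -
  interpret P: pair_sigma_finite M lborel ..
  let ?y = "\<lambda>p \<omega>. resolvent a c p * occupation_spectrum {j<..N} (\<lambda>r. step_sum \<omega> (j, r)) p / real N ^
      2"
  have y0: "0 \<le> ?y p \<omega>" for p \<omega> using resolvent_nonneg occupation_spectrum_nonneg by simp
  have [measurable]: "(\<lambda>z. ?y (snd z) (fst z)) \<in> borel_measurable (M \<Otimes>\<^sub>M lborel)"
    unfolding occupation_spectrum_def phase_power_def by measurable
  have "(\<integral>\<^sup>+\<omega>. ennreal (occupation_energy {j<..N} (\<lambda>r. step_sum \<omega> (j, r)) / real N ^ 2) \<partial>M) =
      (\<integral>\<^sup>+\<omega>. \<integral>\<^sup>+p. ennreal (?y p \<omega>) \<partial>lborel \<partial>M)"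
  proof (intro nn_integral_cong)
    fix \<omega>
    have "occupation_energy {j<..N} (\<lambda>r. step_sum \<omega> (j, r)) / real N ^ 2 = (LBINT p. ?y p \<omega>)"
      unfolding occupation_energy_def by simp
    then show "ennreal (occupation_energy {j<..N} (\<lambda>r. step_sum \<omega> (j, r)) / real N ^ 2) =
        (\<integral>\<^sup>+p. ennreal (?y p \<omega>) \<partial>lborel)"
      using y0 integrable_resolvent_occupation_spectrum by (subst nn_integral_eq_integral) auto
  qed
  also have "\<dots> = (\<integral>\<^sup>+p. \<integral>\<^sup>+\<omega>. ennreal (?y p \<omega>) \<partial>M \<partial>lborel)"
    by (rule P.Fubini'[symmetric]) (simp add: case_prod_beta)
  also have "\<dots> \<le> (\<integral>\<^sup>+p. ennreal (p\<^sup>2 * exp (- (e * p\<^sup>2 / 2)) / N + 4 *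
      (p\<^sup>2 * exp (- (e * p\<^sup>2 / 2)) * (resolvent a c p)\<^sup>2)) \<partial>lborel)"
  proof (intro nn_integral_mono)
    fix p
    have int: "integrable M (\<lambda>\<omega>. phase_power {j<..N} (\<lambda>r. p * step_sum \<omega> (j, r)))"
    proof (rule integrable_const_bound[where B="(real (card {j<..N}))\<^sup>2"])
      show "(\<lambda>\<omega>. phase_power {j<..N} (\<lambda>r. p * step_sum \<omega> (j, r))) \<in> borel_measurable M"
        unfolding phase_power_def by measurable
    qed (use phase_power_le phase_power_nonneg in \<open>auto intro!: AE_I2 simp: abs_of_nonneg simp del:
        card_greaterThanAtMost\<close>)
    have "(\<integral>\<^sup>+\<omega>. ennreal (?y p \<omega>) \<partial>M) = ennreal (expectation (\<lambda>\<omega>. ?y p \<omega>))"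
      using y0 int by (intro nn_integral_eq_integral) (auto simp: occupation_spectrum_def)
    also have "expectation (\<lambda>\<omega>. ?y p \<omega>) = (resolvent a c p * (freq_kernel e p)\<^sup>2 / real N ^ 2) *
        expectation (\<lambda>\<omega>. phase_power {j<..N} (\<lambda>r. p * step_sum \<omega> (j, r)))"
      unfolding occupation_spectrum_def
      by (subst integral_mult_right_zero[symmetric]) (simp add: mult_ac)
    also have "ennreal \<dots> \<le> ennreal (p\<^sup>2 * exp (- (e * p\<^sup>2 / 2)) / N + 4 *
        (p\<^sup>2 * exp (- (e * p\<^sup>2 / 2)) * (resolvent a c p)\<^sup>2))"
    proof (rule ennreal_leI)
      have "(resolvent a c p * (freq_kernel e p)\<^sup>2 / real N ^ 2) *
          expectation (\<lambda>\<omega>. phase_power {j<..N} (\<lambda>r. p * step_sum \<omega> (j, r))) \<le>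
        (resolvent a c p * (p\<^sup>2 * exp (- (e * p\<^sup>2 / 2))) / real N ^ 2) * (N + 4 * real N ^ 2 *
            resolvent a c p)"
        using resolvent_nonneg e0 phase_power_nonneg assms
        by (intro mult_mono divide_right_mono mult_left_mono freq_kernel_sq_le
            expectation_phase_power
            Bochner_Integration.integral_nonneg) (auto intro!: divide_nonneg_nonneg
                mult_nonneg_nonneg)
      also have "\<dots> = resolvent a c p * (p\<^sup>2 * exp (- (e * p\<^sup>2 / 2)) / N) + 4 *
          (p\<^sup>2 * exp (- (e * p\<^sup>2 / 2)) * (resolvent a c p)\<^sup>2)"
        using N0 by (simp add: field_simps power2_eq_square)
      also have "\<dots> \<le> 1 * (p\<^sup>2 * exp (- (e * p\<^sup>2 / 2)) / N) + 4 * (p\<^sup>2 * exp (- (e * p\<^sup>2 / 2)) *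
          (resolvent a c p)\<^sup>2)"
        using c0 by (intro add_right_mono mult_right_mono resolvent_le1) auto
      finally show "(resolvent a c p * (freq_kernel e p)\<^sup>2 / real N ^ 2) *
          expectation (\<lambda>\<omega>. phase_power {j<..N} (\<lambda>r. p * step_sum \<omega> (j, r))) \<le>
        p\<^sup>2 * exp (- (e * p\<^sup>2 / 2)) / N + 4 * (p\<^sup>2 * exp (- (e * p\<^sup>2 / 2)) * (resolvent a c p)\<^sup>2)"
            by simp
    qed
    finally show "(\<integral>\<^sup>+\<omega>. ennreal (?y p \<omega>) \<partial>M) \<le> ennreal (p\<^sup>2 * exp (- (e * p\<^sup>2 / 2)) / N + 4 *
        (p\<^sup>2 * exp (- (e * p\<^sup>2 / 2)) * (resolvent a c p)\<^sup>2))" .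
  qed
  also have "\<dots> = ennreal (LBINT p. p\<^sup>2 * exp (- (e * p\<^sup>2 / 2)) / N + 4 *
      (p\<^sup>2 * exp (- (e * p\<^sup>2 / 2)) * (resolvent a c p)\<^sup>2))"
    using integrable_gauss2 integrable_variance_scale[OF e0, of c a] c0
    by (intro nn_integral_eq_integral Bochner_Integration.integrable_add integrable_divide
        integrable_mult_right) auto
  also have "(LBINT p. p\<^sup>2 * exp (- (e * p\<^sup>2 / 2)) / N + 4 * (p\<^sup>2 * exp (- (e * p\<^sup>2 / 2)) *
      (resolvent a c p)\<^sup>2)) = gauss_second_moment e / N + 4 * variance_scale a c e"
    unfolding gauss_second_moment_def variance_scale_def
    using integrable_gauss2 integrable_variance_scale[OF e0, of c a] c0
    by (subst Bochner_Integration.integral_add) (auto intro!: integrable_divide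
        integrable_mult_right)
  finally show ?thesis .
qed

text \<open>A weighted \<open>L\<^sup>2\<close>-norm of the Fourier transform of the occupation measure of the walk on \<open>{i<..j}\<close>.\<close>
definition occupation_norm :: "nat \<Rightarrow> nat \<Rightarrow> 'a \<Rightarrow> real" where
  "occupation_norm i j \<omega> = sqrt (occupation_energy {i<..j} (\<lambda>r. step_sum \<omega> (0, r))) / N"

lemma step_sum_split: "i \<le> j \<Longrightarrow> j \<le> k \<Longrightarrow> step_sum \<omega> (i, k) = step_sum \<omega> (i, j) + step_sum \<omega> (j, k)"
  unfolding step_sum_def fst_conv snd_conv
  by (subst ivl_disj_un_two(3)[of i j k, symmetric]) (auto intro!: sum.union_disjoint)

lemma occupation_norm_sq: "(occupation_norm i j \<omega>)\<^sup>2 =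
    occupation_energy {i<..j} (\<lambda>r. step_sum \<omega> (0, r)) / real N ^ 2"
  by (simp add: occupation_norm_def power_divide occupation_energy_nonneg)

text \<open>By shift invariance the norm over later times is a function of the future steps alone,
  as \<open>freezing\<close> requires.\<close>

lemma occupation_norm_sq_future: "(occupation_norm j k \<omega>)\<^sup>2 =
    occupation_energy {j<..k} (\<lambda>r. step_sum \<omega> (j, r)) / real N ^ 2"
proof -
  have "occupation_energy {j<..k} (\<lambda>r. step_sum \<omega> (0, r)) =
      occupation_energy {j<..k} (\<lambda>r. step_sum \<omega> (0, j) + step_sum \<omega> (j, r))"
    by (intro occupation_energy_cong step_sum_split) auto
  then show ?thesis by (simp add: occupation_norm_sq occupation_energy_shift)
qed

text \<open>By reflection invariance the increments from past times up to \<open>j\<close>, which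
  are the offsets in the cross term, have the same energy as the positions themselves.\<close>

lemma occupation_norm_sq_past: "(occupation_norm 0 j \<omega>)\<^sup>2 =
    occupation_energy {0<..j} (\<lambda>i. step_sum \<omega> (i, j)) / real N ^ 2"
proof -
  have "occupation_energy {0<..j} (\<lambda>i. step_sum \<omega> (i, j)) =
      occupation_energy {0<..j} (\<lambda>i. step_sum \<omega> (0, j) - step_sum \<omega> (0, i))"
    by (intro occupation_energy_cong) (use step_sum_split[of 0 _ j \<omega>] in auto)
  then show ?thesis by (simp add: occupation_norm_sq occupation_energy_reflect)
qed

lemma occupation_energy_future_measurable:
  "(\<lambda>f. occupation_energy {j<..N} (\<lambda>r. \<Sum>k\<in>{j..<r}. f k)) \<in> borel_measurable (future_space j)"
  by (intro occupation_energy_measurable borel_measurable_sum measurable_component_singleton) auto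

lemma occupation_energy_past_measurable:
  "(\<lambda>h. occupation_energy {0<..j} (\<lambda>i. \<Sum>k\<in>{i..<j}. h k)) \<in> borel_measurable (past_space j)"
  by (intro occupation_energy_measurable borel_measurable_sum measurable_component_singleton) auto

lemma occupation_norm_past_algebra: "j \<le> N \<Longrightarrow> occupation_norm i j \<in>
    borel_measurable (past_algebra j)"
proof -
  have "(\<lambda>\<omega>. occupation_energy {i<..j} (\<lambda>r. step_sum \<omega> (0, r))) \<in> borel_measurable (past_algebra j)"
    by (intro occupation_energy_measurable step_sum_past_algebra) auto
  then show ?thesis unfolding occupation_norm_def[abs_def] by measurable
qed

lemma occupation_tail:
  assumes W: "gauss_second_moment e \<le> N * variance_scale a c e"
  shows "prob {\<omega>\<in>space M. \<exists>j. 0 \<le> j \<and> j \<le> N \<and> \<omega> \<in>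
      space M \<and> real l * (4 * sqrt (5 * variance_scale a c e) + sqrt (variance_scale a c e)) \<le>
      occupation_norm 0 j \<omega>} \<le> (1/2) ^ l"
proof -
  have V: "0 < variance_scale a c e" using e0 c0 by (intro variance_scale_pos) auto
  have WN: "gauss_second_moment e / N \<le> variance_scale a c e" using W N0 by (simp add: field_simps)
  have "prob {\<omega>\<in>space M. \<exists>j. 0 \<le> j \<and> j \<le> N \<and> \<omega> \<in>
      space M \<and> real l * (4 * sqrt (5 * variance_scale a c e) + sqrt (variance_scale a c e)) \<le>
      occupation_norm 0 j \<omega>} \<le> (1/2) ^ l * prob (space M)"
  proof (rule good_lambda[where F = past_algebra and m = N and G = "\<lambda>_. space M"])
    show "space (past_algebra j) = space M" for j by (rule space_past_algebra)
    show "sets (past_algebra j) \<subseteq> sets M" for j by (rule sets_past_algebra_subset)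
    show "i \<le> j \<Longrightarrow> sets (past_algebra i) \<subseteq> sets (past_algebra j)"
        for i j by (rule sets_past_algebra_mono)
    show "j \<le> N \<Longrightarrow> occupation_norm i j \<in> borel_measurable (past_algebra j)"
        for i j by (rule occupation_norm_past_algebra)
    show "0 \<le> occupation_norm i j w"
        for i j w by (simp add: occupation_norm_def occupation_energy_nonneg)
    show "occupation_norm i i w = 0"
        for i w by (simp add: occupation_norm_def occupation_energy_def occupation_spectrum_def
        phase_power_def)
    show "occupation_norm i k w \<le> occupation_norm i j w + occupation_norm j k w" if "i \<le> j" "j \<le> k"
        for i j k w
      unfolding occupation_norm_def add_divide_distrib[symmetric]
      using that occupation_energy_tri(1) by (intro divide_right_mono) auto
    show "occupation_norm i j w \<le> occupation_norm i k w + occupation_norm j k w" if "i \<le> j" "j \<le> k"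
        for i j k w
      unfolding occupation_norm_def add_divide_distrib[symmetric]
      using that occupation_energy_tri(2) by (intro divide_right_mono) auto
    show "occupation_norm j (Suc j) w \<le> sqrt (variance_scale a c e)" for j w
    proof (rule real_le_rsqrt)
      have "occupation_energy {j<..Suc j} (\<lambda>r. step_sum w (0, r)) \<le>
          (LBINT p. (real (card {j<..Suc j}))\<^sup>2 * (p\<^sup>2 * exp (- (e * p\<^sup>2 / 2))))"
        unfolding occupation_energy_def
        by (intro integral_mono integrable_resolvent_occupation_spectrum integrable_mult_right
            integrable_gauss2 resolvent_occupation_spectrum_le)
      also have "\<dots> = gauss_second_moment e" by (simp add: gauss_second_moment_def)
      finally have "(occupation_norm j (Suc j) w)\<^sup>2 \<le> gauss_second_moment e / real N ^ 2"
        unfolding occupation_norm_sq by (intro divide_right_mono) auto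
      also have "\<dots> \<le> gauss_second_moment e / N"
        using N0 gauss_second_moment_nonneg
        by (intro divide_left_mono) (auto simp: power2_eq_square)
      also note WN
      finally show "(occupation_norm j (Suc j) w)\<^sup>2 \<le> variance_scale a c e" .
    qed
    show "space M \<in> sets (past_algebra j)" for j by (metis space_past_algebra sets.top)
    show "0 < sqrt (5 * variance_scale a c e)" "0 \<le> sqrt (variance_scale a c e)" using V by auto
    fix j E assume j: "j \<le> N" and E: "E \<in> sets (past_algebra j)"
    let ?D = "\<lambda>h f :: nat \<Rightarrow> real. ennreal (occupation_energy {j<..N} (\<lambda>r. \<Sum>k\<in>{j..<r}. f k) / real N
        ^ 2)"
    have fe: "occupation_energy {j<..N} (\<lambda>r. \<Sum>k\<in>{j..<r}. future j \<omega> k) =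
        occupation_energy {j<..N} (\<lambda>r. step_sum \<omega> (j, r))" for \<omega>
      by (intro occupation_energy_cong) (auto simp: future_def step_sum_def intro!: sum.cong)
    have "(\<integral>\<^sup>+\<omega>. ennreal ((occupation_norm j N \<omega>)\<^sup>2) * indicator E \<omega> \<partial>M) =
        (\<integral>\<^sup>+\<omega>. ?D (past j \<omega>) (future j \<omega>) * indicator E \<omega> \<partial>M)"
      unfolding occupation_norm_sq_future fe ..
    also have "\<dots> \<le> (\<integral>\<^sup>+\<omega>. (\<lambda>_. ennreal ((sqrt (5 * variance_scale a c e))\<^sup>2)) (past j \<omega>) *
        indicator E \<omega> \<partial>M)"
    proof (rule freezing[OF _ _ _ E])
      show "(\<lambda>z. ?D (fst z) (snd z)) \<in> borel_measurable (past_space j \<Otimes>\<^sub>M future_space j)"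
      proof -
        have [measurable]: "(\<lambda>z. occupation_energy {j<..N} (\<lambda>r. \<Sum>k\<in>{j..<r}. snd z k)) \<in>
            borel_measurable (past_space j \<Otimes>\<^sub>M future_space j)"
          by (rule measurable_compose[OF measurable_snd occupation_energy_future_measurable])
        show ?thesis by measurable
      qed
      fix h
      have "(\<integral>\<^sup>+\<omega>. ?D h (future j \<omega>) \<partial>M) \<le> ennreal (gauss_second_moment e / N + 4 *
          variance_scale a c e)"
        unfolding fe by (rule occupation_energy_expectation[OF j])
      also have "\<dots> \<le> ennreal ((sqrt (5 * variance_scale a c e))\<^sup>2)"
        using WN V by (intro ennreal_leI) simp
      finally show "(\<integral>\<^sup>+\<omega>. ?D h (future j \<omega>) \<partial>M) \<le> ennreal ((sqrt (5 * variance_scale a c e))\<^sup>2)" .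
    qed simp
    also have "\<dots> = ennreal ((sqrt (5 * variance_scale a c e))\<^sup>2) * emeasure M E"
      using E sets_past_algebra_subset by (intro nn_integral_cmult_indicator) auto
    finally show "(\<integral>\<^sup>+\<omega>. ennreal ((occupation_norm j N \<omega>)\<^sup>2) * indicator E \<omega> \<partial>M) \<le>
        ennreal ((sqrt (5 * variance_scale a c e))\<^sup>2) * emeasure M E" .
  next
    show "space M \<in> sets (past_algebra 0)" by (metis space_past_algebra sets.top)
  qed auto
  then show ?thesis by (simp add: prob_space)
qed

section \<open>Tail of the discretised local time\<close>

definition walk_silt :: "nat \<Rightarrow> 'a \<Rightarrow> real" where
  "walk_silt j \<omega> = (\<Sum>t\<in>triangle j. delta_deriv e (step_sum \<omega> t)) / real N ^ 2"

lemma walk_silt_past_algebra: "walk_silt j \<in> borel_measurable (past_algebra j)"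
  unfolding walk_silt_def[abs_def]
  by (intro borel_measurable_divide borel_measurable_sum measurable_compose[OF step_sum_past_algebra
      delta_deriv_meas]) (auto simp: triangle_def)

lemma walk_silt_measurable [measurable]: "walk_silt j \<in> borel_measurable M"
  unfolding walk_silt_def[abs_def] by measurable

text \<open>A pair that is new after \<open>j\<close> either straddles \<open>j\<close> or lies
  beyond it. An increment that straddles \<open>j\<close> splits there into a part known from the
  past and a part belonging to the future.\<close>

lemma walk_silt_increment:
  assumes "j \<le> N"
  shows "walk_silt N \<omega> - walk_silt j \<omega> = (\<Sum>r\<in>{j<..N}. \<Sum>i\<in>{0<..j}. delta_deriv e (step_sum \<omega> (i, j) +
      step_sum \<omega> (j, r))) / real N ^ 2
    + (\<Sum>t\<in>pairs j. delta_deriv e (step_sum \<omega> t)) / real N ^ 2"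
proof -
  let ?t = triangle
  let ?f = "\<lambda>t. delta_deriv e (step_sum \<omega> t)"
  have U: "?t N = (?t j \<union> {0<..j} \<times> {j<..N}) \<union> pairs j"
  proof (rule set_eqI)
    fix t :: "nat \<times> nat"
    show "t \<in> ?t N \<longleftrightarrow> t \<in> (?t j \<union> {0<..j} \<times> {j<..N}) \<union> pairs j"
      using assms by (cases t) (simp add: pairs_def, linarith)
  qed
  have "sum ?f (?t N) = sum ?f (?t j \<union> {0<..j} \<times> {j<..N}) + sum ?f (pairs j)"
    unfolding U
  proof (intro sum.union_disjoint finite_UnI finite_triangle finite_pairs)
    show "finite ({0<..j} \<times> {j<..N})" by simp
    show "(?t j \<union> {0<..j} \<times> {j<..N}) \<inter> pairs j = {}" by (rule equals0I) (auto simp: pairs_def)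
  qed
  also have "sum ?f (?t j \<union> {0<..j} \<times> {j<..N}) = sum ?f (?t j) + sum ?f ({0<..j} \<times> {j<..N})"
  proof (intro sum.union_disjoint finite_triangle)
    show "finite ({0<..j} \<times> {j<..N})" by simp
    show "?t j \<inter> {0<..j} \<times> {j<..N} = {}" by (rule equals0I) auto
  qed
  also have "sum ?f ({0<..j} \<times> {j<..N}) = (\<Sum>i\<in>{0<..j}. \<Sum>r\<in>{j<..N}. ?f (i, r))"
    by (rule sum.cartesian_product')
  also have "\<dots> = (\<Sum>r\<in>{j<..N}. \<Sum>i\<in>{0<..j}. ?f (i, r))" by (rule sum.swap)
  also have "\<dots> = (\<Sum>r\<in>{j<..N}. \<Sum>i\<in>{0<..j}. delta_deriv e (step_sum \<omega> (i, j) + step_sum \<omega> (j, r)))"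
    by (intro sum.cong refl arg_cong[where f = "delta_deriv e"] step_sum_split) auto
  finally show ?thesis by (simp add: walk_silt_def add_divide_distrib)
qed

text \<open>In \<open>walk_tail\<close> the conditional second moment is at most
  \<open>l\<^sup>2 * V\<close> times \<open>7264 * K + 10\<close>, with \<open>K\<close> the
  resolvent mass and \<open>V\<close> the variance scale. Here \<open>7264 = 72 * 100 + 64\<close>,
  where 100 is the square of the 10 in the bound on the occupation norm, and
  \<open>10 = 2 * (1 + 4)\<close> collects the discretisation errors. The outer \<open>4\<close> and
  \<open>1\<close> come from the unit \<open>4 * k + h\<close>.\<close>

definition walk_tail_const :: real where
  "walk_tail_const = 4 * sqrt (7264 * resolvent_mass a c + 10) + 1"

text \<open>The second use of \<open>good_lambda\<close>, restricted to histories whose occupation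
  norm is at most \<open>10 * l * sqrt V\<close>. The band width is then proportional to
  \<open>l\<close>, and \<open>l\<close> bands reach the threshold
  \<open>l\<^sup>2 * sqrt V\<close>. Each of the two exceptional events has probability at most
  \<open>(1/2) ^ l\<close>.\<close>

lemma walk_tail:
  assumes W: "gauss_second_moment e \<le> N * variance_scale a c e" and Fb: "(freq_kernel_norm e)\<^sup>2 \<le>
      N * variance_scale a c e" and l: "1 \<le> l"
  shows "prob {\<omega>\<in>space M. walk_tail_const * (real l)\<^sup>2 * sqrt (variance_scale a c e) \<le>
      \<bar>walk_silt N \<omega>\<bar>} \<le> 2 * (1/2) ^ l"
proof -
  let ?V = "variance_scale a c e" and ?K = "resolvent_mass a c"
  have V: "0 < ?V" using e0 c0 by (intro variance_scale_pos) auto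
  have K: "0 \<le> ?K" using c0 by (rule resolvent_mass_nonneg)
  have FN: "(freq_kernel_norm e)\<^sup>2 / N \<le> ?V" using Fb N0 by (simp add: field_simps)
  \<comment> \<open>The 10 dominates \<open>4 * sqrt 5 + 1\<close>, the unit of
    \<open>occupation_tail\<close>, because \<open>sqrt 5 \<le> 9 / 4\<close>.\<close>
  define k' where "k' = 10 * real l * sqrt ?V"
  define k where "k = real l * sqrt ((7264 * ?K + 10) * ?V)"
  have k0: "0 < k" using V K l by (auto simp: k_def intro!: mult_pos_pos add_nonneg_pos)
  have k'0: "0 \<le> k'" using V by (simp add: k'_def)
  \<comment> \<open>The minimum stops the constraint at time \<open>N\<close>:
    \<open>good_lambda\<close> asks for sets at all indices, while the norm is shown to be adapted
    only up to \<open>N\<close>.\<close>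
  define G where "G j = {\<omega>\<in>space M. \<forall>i\<in>{..min j N}. occupation_norm 0 i \<omega> \<le> k'}" for j
  have GF: "G j \<in> sets (past_algebra j)" for j
  proof -
    have "{\<omega>\<in>space (past_algebra j). \<forall>i\<in>{..min j N}. occupation_norm 0 i \<omega> \<le> k'} \<in>
        sets (past_algebra j)"
    proof (intro sets.sets_Collect_finite_All)
      fix i assume "i \<in> {..min j N}"
      then have i: "i \<le> j" "i \<le> N" by auto
      have "occupation_norm 0 i \<in> borel_measurable (past_algebra i)"
        using i by (intro occupation_norm_past_algebra)
      then have "{\<omega>\<in>space (past_algebra i). occupation_norm 0 i \<omega> \<le> k'} \<in> sets (past_algebra i)"
        by (intro borel_measurable_le) auto
      then show "{\<omega>\<in>space (past_algebra j). occupation_norm 0 i \<omega> \<le> k'} \<in> sets (past_algebra j)"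
        using sets_past_algebra_mono[OF i(1)] by (auto simp: space_past_algebra)
    qed auto
    then show ?thesis by (simp add: G_def space_past_algebra)
  qed
  have Gm: "G j \<in> sets M" for j using GF sets_past_algebra_subset by blast
  let ?B1 = "{\<omega>\<in>space M. \<exists>j. 0 \<le> j \<and> j \<le> N \<and> \<omega> \<in> G j \<and> real l * (4 * k + sqrt ?V) \<le>
      \<bar>walk_silt j \<omega> - walk_silt 0 \<omega>\<bar>}"
  let ?B2 = "{\<omega>\<in>space M. \<exists>j. 0 \<le> j \<and> j \<le> N \<and> \<omega> \<in> space M \<and> real l * (4 * sqrt (5 * ?V) + sqrt ?V) \<le>
      occupation_norm 0 j \<omega>}"
  have B1: "prob ?B1 \<le> (1/2) ^ l * prob (space M)"
  proof (rule good_lambda[where F = past_algebra and m = N and G = G and d =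
      "\<lambda>i j \<omega>. \<bar>walk_silt j \<omega> - walk_silt i \<omega>\<bar>"])
    show "space (past_algebra j) = space M" for j by (rule space_past_algebra)
    show "sets (past_algebra j) \<subseteq> sets M" for j by (rule sets_past_algebra_subset)
    show "i \<le> j \<Longrightarrow> sets (past_algebra i) \<subseteq> sets (past_algebra j)"
        for i j by (rule sets_past_algebra_mono)
    show "(\<lambda>\<omega>. \<bar>walk_silt j \<omega> - walk_silt i \<omega>\<bar>) \<in> borel_measurable (past_algebra j)" if "i \<le> j"
        for i j
    proof -
      have "walk_silt i \<in> borel_measurable (past_algebra j)"
        using walk_silt_past_algebra[of i] sets_past_algebra_mono[OF that]
        by (intro measurable_from_subalg[of "past_algebra j"
            "past_algebra i"]) (auto simp: subalgebra_def space_past_algebra)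
      then show ?thesis using walk_silt_past_algebra[of j] by measurable
    qed
    show "\<bar>walk_silt (Suc j) w - walk_silt j w\<bar> \<le> sqrt ?V" if "j < N" for j w
    proof (rule real_le_rsqrt)
      let ?t = triangle
      let ?f = "\<lambda>t. delta_deriv e (step_sum w t)"
      have "?t (Suc j) = ?t j \<union> {0<..j} \<times> {Suc j}"
      proof (rule set_eqI)
        fix t :: "nat \<times> nat"
        show "t \<in> ?t (Suc j) \<longleftrightarrow> t \<in> ?t j \<union> {0<..j} \<times> {Suc j}" by (cases t) (simp, linarith)
      qed
      then have "sum ?f (?t (Suc j)) = sum ?f (?t j) + sum ?f ({0<..j} \<times> {Suc j})"
      proof (simp only:, intro sum.union_disjoint finite_triangle)
        show "finite ({0<..j} \<times> {Suc j})" by simp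
        show "?t j \<inter> {0<..j} \<times> {Suc j} = {}" by (rule equals0I) (clarsimp)
      qed
      then have "walk_silt (Suc j) w - walk_silt j w = sum ?f ({0<..j} \<times> {Suc j}) / real N ^ 2"
        by (simp add: walk_silt_def add_divide_distrib)
      moreover have "\<bar>sum ?f ({0<..j} \<times> {Suc j})\<bar> \<le> (\<Sum>t\<in>{0<..j} \<times> {Suc j}. freq_kernel_norm e)"
        by (intro order_trans[OF sum_abs] sum_mono delta_deriv_bound e0)
      moreover have "(\<Sum>t\<in>{0<..j} \<times> {Suc j}. freq_kernel_norm e) \<le> N * freq_kernel_norm e"
        using that freq_kernel_norm_nonneg[of e]
        by (auto simp: card_cartesian_product intro!: mult_right_mono)
      ultimately have "\<bar>walk_silt (Suc j) w - walk_silt j w\<bar> \<le>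
          (N * freq_kernel_norm e) / real N ^ 2"
        by (auto simp: abs_divide intro!: divide_right_mono)
      also have "\<dots> = freq_kernel_norm e / N" using N0 by (simp add: power2_eq_square)
      finally have "\<bar>walk_silt (Suc j) w - walk_silt j w\<bar>\<^sup>2 \<le> (freq_kernel_norm e / N)\<^sup>2"
        by (intro power_mono) auto
      also have "\<dots> = (freq_kernel_norm e)\<^sup>2 / N / N" by (simp add: power_divide power2_eq_square)
      also have "\<dots> \<le> (freq_kernel_norm e)\<^sup>2 / N / 1" using N0 by (intro divide_left_mono) auto
      also have "\<dots> \<le> ?V" using FN by simp
      finally show "\<bar>walk_silt (Suc j) w - walk_silt j w\<bar>\<^sup>2 \<le> ?V" .
    qed
    show "G j \<in> sets (past_algebra j)" for j by (rule GF)
    show "G j \<subseteq> G i" if "i \<le> j" for i j using that unfolding G_def by auto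
    show "0 < k" by (rule k0)
    show "0 \<le> sqrt ?V" using V by simp
    fix j E assume j: "j \<le> N" and E: "E \<in> sets (past_algebra j)" and EG: "E \<subseteq> G j"
    \<comment> \<open>Pairs straddling \<open>j\<close> and pairs after \<open>j\<close>, written as
      functions of a history \<open>h\<close> and a future \<open>f\<close> so that
      \<open>freezing\<close> applies.\<close>
    define cross where "cross h f = (\<Sum>r\<in>{j<..N}. \<Sum>i\<in>{0<..j}. delta_deriv e ((\<Sum>k\<in>{i..<j}. h k) +
        (\<Sum>k\<in>{j..<r}. f k))) / real N ^ 2" for h f :: "nat \<Rightarrow> real"
    define tail where "tail f = (\<Sum>t\<in>pairs j. delta_deriv e (\<Sum>k\<in>{fst t..<snd t}. f k)) / real N ^ 2"
        for f :: "nat \<Rightarrow> real"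
    define L where "L h = occupation_energy {0<..j} (\<lambda>i. \<Sum>k\<in>{i..<j}. h k) / real N ^ 2"
        for h :: "nat \<Rightarrow> real"
    let ?D = "\<lambda>h f. ennreal ((cross h f + tail f)\<^sup>2)"
    let ?\<kappa> = "\<lambda>h. ennreal (10 * ?V + 72 * ?K * L h + 64 * ?V * ?K)"
    have L0: "0 \<le> L h" for h by (simp add: L_def occupation_energy_nonneg)
    have cf: "cross h (future j \<omega>) = (\<Sum>r\<in>{j<..N}. \<Sum>i\<in>{0<..j}. delta_deriv e ((\<Sum>k\<in>{i..<j}. h k) +
        step_sum \<omega> (j, r))) / real N ^ 2" for h \<omega>
    proof -
      have "(\<Sum>k\<in>{j..<r}. future j \<omega> k) = step_sum \<omega> (j, r)" if "r \<in> {j<..N}" for r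
        using that by (auto simp: future_def step_sum_def intro!: sum.cong)
      then show ?thesis unfolding cross_def by simp
    qed
    have ch: "(\<Sum>k\<in>{i..<j}. past j \<omega> k) = step_sum \<omega> (i, j)" for i \<omega>
      by (auto simp: past_def step_sum_def intro!: sum.cong)
    have tf: "tail (future j \<omega>) = (\<Sum>t\<in>pairs j. delta_deriv e (step_sum \<omega> t)) / real N ^ 2" for \<omega>
    proof -
      have "(\<Sum>k\<in>{fst t..<snd t}. future j \<omega> k) = step_sum \<omega> t" if "t \<in> pairs j" for t
        using that by (auto simp: future_def step_sum_def pairs_def intro!: sum.cong)
      then show ?thesis unfolding tail_def by simp
    qed
    have "(\<integral>\<^sup>+\<omega>. ennreal (\<bar>walk_silt N \<omega> - walk_silt j \<omega>\<bar>\<^sup>2) * indicator E \<omega> \<partial>M) =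
        (\<integral>\<^sup>+\<omega>. ?D (past j \<omega>) (future j \<omega>) * indicator E \<omega> \<partial>M)"
      unfolding cf ch tf power2_abs walk_silt_increment[OF j] ..
    also have "\<dots> \<le> (\<integral>\<^sup>+\<omega>. ?\<kappa> (past j \<omega>) * indicator E \<omega> \<partial>M)"
    proof (rule freezing[OF _ _ _ E])
      show "(\<lambda>z. ?D (fst z) (snd z)) \<in> borel_measurable (past_space j \<Otimes>\<^sub>M future_space j)"
      proof -
        have [measurable]: "(\<lambda>z. fst z k) \<in> borel_measurable (past_space j \<Otimes>\<^sub>M future_space j)"
            if "k < j" for k
          using that by (intro measurable_compose[OF measurable_fst] measurable_component_singleton)
              auto
        have [measurable]: "(\<lambda>z. snd z k) \<in> borel_measurable (past_space j \<Otimes>\<^sub>M future_space j)"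
            if "j \<le> k" "k < N" for k
          using that by (intro measurable_compose[OF measurable_snd] measurable_component_singleton)
              auto
        have "(\<lambda>z. cross (fst z) (snd z)) \<in> borel_measurable (past_space j \<Otimes>\<^sub>M future_space j)"
          unfolding cross_def
          by (intro borel_measurable_divide borel_measurable_sum measurable_compose[OF _
              delta_deriv_meas] borel_measurable_add) auto
        moreover have "(\<lambda>z. tail (snd z)) \<in> borel_measurable (past_space j \<Otimes>\<^sub>M future_space j)"
          unfolding tail_def
          by (intro borel_measurable_divide borel_measurable_sum measurable_compose[OF _
              delta_deriv_meas]) (auto simp: pairs_def)
        ultimately show ?thesis by measurable
      qed
      show "?\<kappa> \<in> borel_measurable (past_space j)"
        unfolding L_def using occupation_energy_past_measurable[of j] by measurable
      fix h
      have cm: "(\<lambda>\<omega>. cross h (future j \<omega>)) \<in> borel_measurable M" unfolding cf by measurable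
      have tm: "(\<lambda>\<omega>. tail (future j \<omega>)) \<in> borel_measurable M" unfolding tf by measurable
      have ci: "integrable M (\<lambda>\<omega>. (cross h (future j \<omega>))\<^sup>2)"
      proof (rule integrable_const_bound)
        show "AE \<omega> in M. norm ((cross h (future j \<omega>))\<^sup>2) \<le>
            ((\<Sum>r\<in>{j<..N}. \<Sum>i\<in>{0<..j}. freq_kernel_norm e) / real N ^ 2)\<^sup>2"
          unfolding cf real_norm_def power_abs abs_divide
          by (intro AE_I2 power_mono frac_le order_trans[OF sum_abs] sum_mono delta_deriv_bound e0)
             (use N0 freq_kernel_norm_nonneg[of e] in \<open>auto intro!: sum_nonneg\<close>)
      qed (use cm in measurable)
      have ti: "integrable M (\<lambda>\<omega>. (tail (future j \<omega>))\<^sup>2)"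
      proof (rule integrable_const_bound)
        show "AE \<omega> in M. norm ((tail (future j \<omega>))\<^sup>2) \<le>
            ((\<Sum>t\<in>pairs j. freq_kernel_norm e) / real N ^ 2)\<^sup>2"
          unfolding tf real_norm_def power_abs abs_divide
          by (intro AE_I2 power_mono frac_le order_trans[OF sum_abs] sum_mono delta_deriv_bound e0)
             (use N0 freq_kernel_norm_nonneg[of e] in \<open>auto intro!: sum_nonneg\<close>)
      qed (use tm in measurable)
      have "(\<integral>\<^sup>+\<omega>. ?D h (future j \<omega>) \<partial>M) \<le>
          (\<integral>\<^sup>+\<omega>. ennreal (2 * (cross h (future j \<omega>))\<^sup>2 + 2 * (tail (future j \<omega>))\<^sup>2) \<partial>M)"
      proof (intro nn_integral_mono ennreal_leI)
        fix \<omega>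
        show "(cross h (future j \<omega>) + tail (future j \<omega>))\<^sup>2 \<le> 2 * (cross h (future j \<omega>))\<^sup>2 + 2 *
            (tail (future j \<omega>))\<^sup>2"
          using sum_squares_bound[of "cross h (future j \<omega>)" "tail (future j \<omega>)"]
          by (simp add: power2_sum)
      qed
      also have "\<dots> = ennreal (expectation (\<lambda>\<omega>. 2 * (cross h (future j \<omega>))\<^sup>2 + 2 *
          (tail (future j \<omega>))\<^sup>2))"
        using ci ti by (intro nn_integral_eq_integral) auto
      also have "\<dots> \<le> ?\<kappa> h"
      proof (rule ennreal_leI)
        have "expectation (\<lambda>\<omega>. 2 * (cross h (future j \<omega>))\<^sup>2 + 2 * (tail (future j \<omega>))\<^sup>2) =
          2 * expectation (\<lambda>\<omega>. (cross h (future j \<omega>))\<^sup>2) + 2 *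
              expectation (\<lambda>\<omega>. (tail (future j \<omega>))\<^sup>2)"
          using ci ti by simp
        also have "\<dots> \<le> 2 * ((freq_kernel_norm e)\<^sup>2 / N + 36 * ?K * L h) + 2 *
            (4 * (freq_kernel_norm e)\<^sup>2 / N + 32 * ?V * ?K)"
          unfolding cf tf L_def using j
          by (intro add_mono mult_left_mono pairs_second_moment frozen_second_moment) auto
        also have "\<dots> = 10 * ((freq_kernel_norm e)\<^sup>2 / N) + 72 * ?K * L h + 64 * ?V * ?K" by simp
        also have "\<dots> \<le> 10 * ?V + 72 * ?K * L h + 64 * ?V * ?K" using FN by simp
        finally show "expectation (\<lambda>\<omega>. 2 * (cross h (future j \<omega>))\<^sup>2 + 2 * (tail (future j \<omega>))\<^sup>2) \<le>
            10 * ?V + 72 * ?K * L h + 64 * ?V * ?K" .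
      qed
      finally show "(\<integral>\<^sup>+\<omega>. ?D h (future j \<omega>) \<partial>M) \<le> ?\<kappa> h" .
    qed
    also have "\<dots> \<le> (\<integral>\<^sup>+\<omega>. ennreal (k\<^sup>2) * indicator E \<omega> \<partial>M)"
    proof (intro nn_integral_mono)
      fix \<omega>
      show "?\<kappa> (past j \<omega>) * indicator E \<omega> \<le> ennreal (k\<^sup>2) * indicator E \<omega>"
      proof (cases "\<omega> \<in> E")
        case True
        then have "occupation_norm 0 j \<omega> \<le> k'" using EG j unfolding G_def by auto
        moreover have "0 \<le> occupation_norm 0 j \<omega>"
          by (simp add: occupation_norm_def occupation_energy_nonneg)
        ultimately have "(occupation_norm 0 j \<omega>)\<^sup>2 \<le> k'\<^sup>2" by (intro power_mono)
        then have Lk: "L (past j \<omega>) \<le> 100 * ((real l)\<^sup>2 * ?V)"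
          using V unfolding occupation_norm_sq_past L_def ch k'_def
          by (simp add: power_mult_distrib)
        have l2: "1 \<le> (real l)\<^sup>2" using l by simp
        have "10 * ?V + 72 * ?K * L (past j \<omega>) + 64 * ?V * ?K \<le>
          10 * ((real l)\<^sup>2 * ?V) + 72 * ?K * (100 * ((real l)\<^sup>2 * ?V)) + 64 * ((real l)\<^sup>2 * ?V) *
              ?K"
          using V K Lk mult_right_mono[OF l2, of ?V]
          by (intro add_mono mult_left_mono mult_right_mono) auto
        also have "\<dots> = k\<^sup>2" using V K unfolding k_def
          by (simp add: power_mult_distrib algebra_simps)
        finally show ?thesis by (auto intro!: mult_right_mono ennreal_leI)
      qed simp
    qed
    also have "\<dots> = ennreal (k\<^sup>2) * emeasure M E"
      using E sets_past_algebra_subset by (intro nn_integral_cmult_indicator) auto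
    finally show "(\<integral>\<^sup>+\<omega>. ennreal (\<bar>walk_silt N \<omega> - walk_silt j \<omega>\<bar>\<^sup>2) * indicator E \<omega> \<partial>M) \<le>
        ennreal (k\<^sup>2) * emeasure M E" .
  next
    show "space M \<in> sets (past_algebra 0)" by (metis space_past_algebra sets.top)
  qed auto
  have B2: "prob ?B2 \<le> (1/2) ^ l" by (rule occupation_tail[OF W])
  have ddM [measurable]: "occupation_norm 0 j \<in> borel_measurable M" if "j \<le> N" for j
    using occupation_norm_past_algebra[OF that] sets_past_algebra_subset
    by (intro measurable_from_subalg[of M "past_algebra j"]) (auto simp: subalgebra_def
        space_past_algebra)
  have B1m: "?B1 \<in> sets M"
  proof -
    have "?B1 = (\<Union>j\<in>{..N}. G j \<inter> {\<omega>\<in>space M. real l * (4 * k + sqrt ?V) \<le>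
        \<bar>walk_silt j \<omega> - walk_silt 0 \<omega>\<bar>})" by auto
    also have "\<dots> \<in> sets M" by (intro sets.finite_UN sets.Int Gm) auto
    finally show ?thesis .
  qed
  have B2m: "?B2 \<in> sets M"
  proof -
    have "?B2 = (\<Union>j\<in>{..N}. {\<omega>\<in>space M. real l * (4 * sqrt (5 * ?V) + sqrt ?V) \<le>
        occupation_norm 0 j \<omega>})" by auto
    also have "\<dots> \<in> sets M"
      by (intro sets.finite_UN borel_measurable_le ddM) auto
    finally show ?thesis .
  qed
  have "{\<omega>\<in>space M. walk_tail_const * (real l)\<^sup>2 * sqrt ?V \<le> \<bar>walk_silt N \<omega>\<bar>} \<subseteq> ?B1 \<union> ?B2"
  proof
    fix \<omega> assume w: "\<omega> \<in> {\<omega>\<in>space M. walk_tail_const * (real l)\<^sup>2 * sqrt ?V \<le> \<bar>walk_silt N \<omega>\<bar>}"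
    show "\<omega> \<in> ?B1 \<union> ?B2"
    proof (cases "\<omega> \<in> G N")
      case True
      have "triangle 0 = {}" by auto
      then have A0: "walk_silt 0 \<omega> = 0" by (simp add: walk_silt_def)
      have "real l * (4 * k + sqrt ?V) = 4 * sqrt (7264 * ?K + 10) * (real l)\<^sup>2 * sqrt ?V + real l *
          sqrt ?V"
        unfolding k_def real_sqrt_mult[of "7264 * ?K + 10"]
        by (simp add: power2_eq_square algebra_simps)
      also have "\<dots> \<le> 4 * sqrt (7264 * ?K + 10) * (real l)\<^sup>2 * sqrt ?V + (real l)\<^sup>2 * sqrt ?V"
        using V l by (intro add_left_mono mult_right_mono) (auto simp: power2_eq_square)
      also have "\<dots> = walk_tail_const * (real l)\<^sup>2 * sqrt ?V"
        by (simp add: walk_tail_const_def algebra_simps)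
      also have "\<dots> \<le> \<bar>walk_silt N \<omega> - walk_silt 0 \<omega>\<bar>" using w A0 by simp
      finally show ?thesis using True w by auto
    next
      case False
      then obtain i where i: "i \<le> N" "k' < occupation_norm 0 i \<omega>"
        using w unfolding G_def by (auto simp: not_le)
      have "sqrt 5 \<le> 9 / 4" by (rule real_le_lsqrt) (auto simp: power2_eq_square)
      then have "4 * sqrt (5 * ?V) + sqrt ?V \<le> 10 * sqrt ?V"
        using V mult_right_mono[of "sqrt 5" "9/4" "sqrt ?V"] by (simp add: real_sqrt_mult)
      then have "real l * (4 * sqrt (5 * ?V) + sqrt ?V) \<le> real l * (10 * sqrt ?V)"
        by (intro mult_left_mono) auto
      also have "\<dots> = k'" by (simp add: k'_def)
      finally have "real l * (4 * sqrt (5 * ?V) + sqrt ?V) \<le> occupation_norm 0 i \<omega>" using i by simp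
      then show ?thesis using w i by auto
    qed
  qed
  then have "prob {\<omega>\<in>space M. walk_tail_const * (real l)\<^sup>2 * sqrt ?V \<le> \<bar>walk_silt N \<omega>\<bar>} \<le>
      prob (?B1 \<union> ?B2)"
    using B1m B2m by (intro finite_measure_mono sets.Un)
  also have "\<dots> \<le> prob ?B1 + prob ?B2" by (rule measure_Un_le[OF B1m B2m])
  also have "\<dots> \<le> (1/2) ^ l + (1/2) ^ l" using B1 B2 by (simp add: prob_space)
  finally show ?thesis by simp
qed

end

section \<open>Riemann sums of the regularised local time\<close>

text \<open>Rounding up places the grid point to the right of \<open>t\<close>, the side on which
  paths are continuous.\<close>

definition grid :: "nat \<Rightarrow> real \<Rightarrow> nat" where
  "grid N t = nat \<lceil>t * N\<rceil>"

lemma grid_measurable [measurable]: "(\<lambda>t. h (grid N t) :: real) \<in> borel_measurable borel"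
proof -
  have "(\<lambda>t. \<lceil>t * real N\<rceil>) \<in> measurable borel (count_space UNIV)" by measurable
  then have "(\<lambda>t. (\<lambda>k. h (nat k)) \<lceil>t * real N\<rceil>) \<in> borel_measurable borel"
    by (rule measurable_compose) simp
  then show ?thesis by (simp add: grid_def)
qed

lemma grid_bounds:
  assumes "0 \<le> t" "0 < N" shows "t \<le> real (grid N t) / N" "real (grid N t) / N \<le> t + 1 / N"
proof -
  have c: "0 \<le> \<lceil>t * real N\<rceil>" using assms by (simp add: order_less_le_trans[of "-1" 0])
  have "t * N \<le> real (grid N t)" "real (grid N t) \<le> t * N + 1"
    using c ceiling_correct[of "t * real N"] by (auto simp: grid_def)
  then show "t \<le> real (grid N t) / N" "real (grid N t) / N \<le> t + 1 / N"
    using assms by (auto simp: field_simps)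
qed

lemma integral_grid:
  fixes h :: "nat \<Rightarrow> real"
  assumes N: "0 < N"
  shows "(LBINT t:{0..1}. h (grid N t)) = (\<Sum>k=1..N. h k) / N"
proof -
  \<comment> \<open>The index is constant on cells that are open on the left. Index 0 occurs only at
    the point 0 and drops out of the integral.\<close>
  have "indicator {0..1} t * h (grid N t) = h 0 * indicator {0} t + (\<Sum>k=1..N. h k *
      indicator {(real k - 1) / N<..real k / N} t)" for t :: real
  proof -
    have iff: "t \<in> {(real k - 1) / N<..real k / N} \<longleftrightarrow> grid N t = k \<and> 0 < t" if k: "1 \<le> k" for k
    proof -
      have "t \<in> {(real k - 1) / N<..real k / N} \<longleftrightarrow> real k - 1 < t * N \<and> t * N \<le> real k"
        using N by (auto simp: field_simps)
      also have "\<dots> \<longleftrightarrow> \<lceil>t * N\<rceil> = int k" by (auto simp: ceiling_eq_iff)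
      also have "\<dots> \<longleftrightarrow> grid N t = k \<and> 0 < t"
      proof
        assume c: "\<lceil>t * N\<rceil> = int k"
        then have "real k - 1 < t * N" by (simp add: ceiling_eq_iff)
        then have "0 < t * N" using k by simp
        then have "0 < t" using N by (simp add: zero_less_mult_iff)
        then show "grid N t = k \<and> 0 < t" using c by (simp add: grid_def)
      next
        assume "grid N t = k \<and> 0 < t"
        then show "\<lceil>t * N\<rceil> = int k" using k unfolding grid_def by auto
      qed
      finally show ?thesis .
    qed
    have s: "(\<Sum>k=1..N. h k * indicator {(real k - 1) / N<..real k / N} t) = (\<Sum>k=1..N.
        if k = grid N t then (if 0 < t then h (grid N t) else 0) else 0)"
      by (intro sum.cong refl) (use iff in \<open>auto simp: indicator_def\<close>)
    consider "t < 0" | "t = 0" | "0 < t" "t \<le> 1" | "1 < t" by linarith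
    then show ?thesis
    proof cases
      case 1 then show ?thesis unfolding s by auto
    next
      case 2 then show ?thesis unfolding s by (auto simp: grid_def)
    next
      case 3
      have "t * N \<le> real N" using 3 by (simp add: mult_left_le_one_le)
      then have "\<lceil>t * N\<rceil> \<le> int N" by (simp add: ceiling_le_iff)
      then have "grid N t \<le> N" by (simp only: grid_def nat_le_iff)
      moreover have "0 < t * N" using 3 N by simp
      then have "1 \<le> grid N t" unfolding grid_def using less_ceiling_iff[of 0 "t * real N"]
        by linarith
      ultimately show ?thesis using 3 unfolding s by (simp add: sum.delta)
    next
      case 4
      have "real N < t * N" using 4 N by simp
      also have "t * N \<le> real (grid N t)"
        using grid_bounds(1)[of t N] 4 N by (simp add: field_simps)
      finally show ?thesis using 4 unfolding s by (auto simp: sum.delta)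
    qed
  qed
  then have "(LBINT t:{0..1}. h (grid N t)) =
      (LBINT t. h 0 * indicator {0} t + (\<Sum>k=1..N. h k * indicator {(real k - 1) / N<..real k / N}
      t))"
    unfolding set_lebesgue_integral_def by simp
  also have "\<dots> = (\<Sum>k=1..N. h k * (1 / N))"
  proof -
    have i: "integrable lborel (\<lambda>t. h k * indicator {(real k - 1) / N<..real k / N} t)" for k
    proof -
      have "(real k - 1) / N \<le> real k / N" by (intro divide_right_mono) auto
      then show ?thesis by (intro integrable_mult_right integrable_real_indicator)
          (auto simp: emeasure_lborel_Ioc)
    qed
    have i0: "integrable lborel (\<lambda>t. h 0 * indicator {0::real} t)"
      by (intro integrable_mult_right integrable_real_indicator) auto
    have m: "measure lborel {(real k - 1) / N<..real k / N} = 1 / N" for k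
    proof -
      have "(real k - 1) / N \<le> real k / N" by (intro divide_right_mono) auto
      then show ?thesis by (simp add: measure_def emeasure_lborel_Ioc diff_divide_distrib)
    qed
    have e: "(LBINT t. h k * indicator S t) = h k * measure lborel S" if "S \<in> sets borel"
        for k and S :: "real set"
      using that by (simp only: integral_mult_right_zero) simp
    have "(LBINT t. h 0 * indicator {0} t + (\<Sum>k=1..N. h k * indicator {(real k - 1) / N<..real k /
        N} t)) =
      (LBINT t. h 0 * indicator {0::real} t) + (LBINT t. (\<Sum>k=1..N. h k * indicator {(real k -
          1) / N<..real k / N} t))"
      by (intro Bochner_Integration.integral_add i0 Bochner_Integration.integrable_sum i)
    also have "(LBINT t. (\<Sum>k=1..N. h k * indicator {(real k - 1) / N<..real k / N} t)) =
      (\<Sum>k=1..N. LBINT t. h k * indicator {(real k - 1) / N<..real k / N} t)"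
      by (intro Bochner_Integration.integral_sum i)
    also have "\<dots> = (\<Sum>k=1..N. h k * (1 / N))"
      by (intro sum.cong refl) (subst e, simp, simp only: m)
    also have "(LBINT t. h 0 * indicator {0::real} t) = 0" by (subst e) auto
    finally show ?thesis by simp
  qed
  also have "\<dots> = (\<Sum>k=1..N. h k) / N" by (simp add: sum_divide_distrib)
  finally show ?thesis .
qed

text \<open>The exceptional point \<open>z\<close> serves the diagonal \<open>s = t\<close>, where
  the indicator of \<open>grid N s < grid N t\<close> stays 0 although that of
  \<open>s \<le> t\<close> is 1.\<close>

lemma set_integral_dominated:
  fixes f :: "nat \<Rightarrow> real \<Rightarrow> real"
  assumes fm: "\<And>n. (\<lambda>t. indicator {0..1} t * f n t) \<in> borel_measurable borel"
    and gm: "(\<lambda>t. indicator {0..1} t * g t) \<in> borel_measurable borel"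
    and lim: "\<And>t. t \<in> {0..1} \<Longrightarrow> t \<noteq> z \<Longrightarrow> (\<lambda>n. f n t) \<longlonglongrightarrow> g t"
    and b: "\<And>n t. t \<in> {0..1} \<Longrightarrow> \<bar>f n t\<bar> \<le> B"
  shows "(\<lambda>n. LBINT t:{0..1}. f n t) \<longlonglongrightarrow> (LBINT t:{0..1}. g t)"
  unfolding set_lebesgue_integral_def real_scaleR_def
proof (rule integral_dominated_convergence[where w = "\<lambda>t. B * indicator {0..1} t"])
  show "integrable lborel (\<lambda>t. B * indicator {0..1::real} t)"
    by (intro integrable_mult_right integrable_indicator_Icc)
  show "AE t in lborel. (\<lambda>n. indicator {0..1} t * f n t) \<longlonglongrightarrow> indicator {0..1} t * g t"
    using AE_lborel_singleton[of z] by (rule AE_mp) (auto intro!: AE_I2 lim simp: indicator_def)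
  show "AE t in lborel. norm (indicator {0..1} t * f n t) \<le> B * indicator {0..1} t" for n
    using b by (auto simp: indicator_def intro!: AE_I2)
qed (use fm gm in auto)

definition silt :: "real \<Rightarrow> (real \<Rightarrow> real) \<Rightarrow> real" where
  "silt e x = (LBINT t:{0..1}. LBINT s:{0..t}. delta_deriv e (x t - x s))"

section \<open>Riemann sums along right-continuous paths\<close>

context
  fixes x :: "real \<Rightarrow> real" and e :: real
  assumes x: "\<And>t. 0 \<le> t \<Longrightarrow> continuous (at_right t) x" and e: "0 < e"
begin

lemma grid_limit:
  assumes "0 \<le> t" shows "(\<lambda>N. x (real (grid (Suc N) t) / real (Suc N))) \<longlonglongrightarrow> x t"
proof (rule LIMSEQ_I)
  fix r :: real assume "0 < r"
  have "(x \<longlongrightarrow> x t) (at_right t)" using x[OF assms] by (simp add: continuous_within)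
  then have "eventually (\<lambda>y. dist (x y) (x t) < r) (at_right t)" using \<open>0 < r\<close> by (rule tendstoD)
  then obtain b where b: "b > t" "\<And>y. t < y \<Longrightarrow> y < b \<Longrightarrow> dist (x y) (x t) < r"
    unfolding eventually_at_right_field by blast
  have "(\<lambda>N. t + 1 / real (Suc N)) \<longlonglongrightarrow> t + 0"
    by (intro tendsto_add tendsto_const LIMSEQ_Suc[OF lim_1_over_n])
  then have "eventually (\<lambda>N. t + 1 / real (Suc N) < b) sequentially"
    using b(1) by (intro order_tendstoD(2)) auto
  then obtain N0 where N0: "\<And>N. N \<ge> N0 \<Longrightarrow> t + 1 / real (Suc N) < b"
    unfolding eventually_sequentially by blast
  have "norm (x (real (grid (Suc N) t) / real (Suc N)) - x t) < r" if "N \<ge> N0" for N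
    using grid_bounds[OF assms, of "Suc N"] N0[OF that] b(2)[of
        "real (grid (Suc N) t) / real (Suc N)"] \<open>0 < r\<close>
    by (cases "real (grid (Suc N) t) / real (Suc N) = t") (auto simp: dist_norm)
  then show "\<exists>N0. \<forall>N\<ge>N0. norm (x (real (grid (Suc N) t) / real (Suc N)) - x t) < r" by blast
qed

text \<open>A right-continuous path is the pointwise limit of its step functions along the
  grids.\<close>

lemma path_measurable: "(\<lambda>t. indicator {0..1} t * x t) \<in> borel_measurable borel"
proof (rule borel_measurable_LIMSEQ_real)
  show "(\<lambda>N. indicator {0..1} t * x (real (grid (Suc N) t) / real (Suc N))) \<longlonglongrightarrow> indicator {0..1} t *
      x t" for t
    using grid_limit[of t] by (cases "t \<in> {0..1}") (auto intro!: tendsto_mult)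
  show "(\<lambda>t. indicator {0..1} t * x (real (grid (Suc N) t) / real (Suc N))) \<in>
      borel_measurable borel" for N
    using grid_measurable[of "\<lambda>k. x (real k / real (Suc N))" "Suc N"] by measurable
qed

definition inner_sum :: "nat \<Rightarrow> nat \<Rightarrow> real" where
  "inner_sum N r = (\<Sum>i=1..N. of_bool (i < r) * delta_deriv e (x (real r / N) - x (real i / N))) / N"

lemma inner_limit:
  assumes t: "t \<in> {0..1}"
  shows "(\<lambda>N. inner_sum (Suc N) (grid (Suc N) t)) \<longlonglongrightarrow> (LBINT s:{0..t}. delta_deriv e (x t - x s))"
proof -
  let ?u = "\<lambda>N s. real (grid (Suc N) s) / real (Suc N)"
  let ?f = "\<lambda>N s. of_bool (grid (Suc N) s < grid (Suc N) t) * delta_deriv e (x (?u N t) -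
      x (?u N s))"
  have [measurable]: "delta_deriv e \<in> borel_measurable borel"
    using e by (rule delta_deriv_measurable)
  have "(\<lambda>N. LBINT s:{0..1}. ?f N s) \<longlonglongrightarrow> (LBINT s:{0..1}. of_bool (s \<le> t) * delta_deriv e (x t -
      x s))"
  proof (rule set_integral_dominated[where z = t and B = "freq_kernel_norm e"])
    show "(\<lambda>s. indicator {0..1} s * ?f n s) \<in> borel_measurable borel" for n
      using grid_measurable[of "\<lambda>k. of_bool (k < grid (Suc n) t) * delta_deriv e (x (?u n t) -
          x (real k / real (Suc n)))" "Suc n"]
      by (intro borel_measurable_times) auto
    have "(\<lambda>s. indicator {0..1} s * (of_bool (s \<le> t) * delta_deriv e (x t - x s))) =
      (\<lambda>s. indicator {0..1} s * (of_bool (s \<le> t) * delta_deriv e (x t - indicator {0..1} s * x s)))"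
      by (auto simp: indicator_def)
    also have "\<dots> \<in> borel_measurable borel" using path_measurable by measurable
    finally show "(\<lambda>s. indicator {0..1} s * (of_bool (s \<le> t) * delta_deriv e (x t - x s))) \<in>
        borel_measurable borel" .
    show "\<bar>?f n s\<bar> \<le> freq_kernel_norm e" for n s
      using delta_deriv_bound[OF e] freq_kernel_norm_nonneg[of e] by (auto simp: abs_mult)
    fix s assume s: "s \<in> {0..1}" "s \<noteq> t"
    have tl: "(\<lambda>N. delta_deriv e (x (?u N t) - x (?u N s))) \<longlonglongrightarrow> delta_deriv e (x t - x s)"
      using delta_deriv_continuous[OF e] grid_limit[of t] grid_limit[of s] s t
      by (intro continuous_on_tendsto_compose[of UNIV "delta_deriv e"] tendsto_diff) auto
    \<comment> \<open>Off the diagonal the grid eventually reproduces the order of the two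
      times.\<close>
    moreover have "eventually (\<lambda>N. of_bool (grid (Suc N) s < grid (Suc N) t) =
        (of_bool (s \<le> t) :: real)) sequentially"
    proof (cases "s < t")
      case True
      have "(\<lambda>N. s + 1 / real (Suc N)) \<longlonglongrightarrow> s + 0"
        by (intro tendsto_add tendsto_const LIMSEQ_Suc[OF lim_1_over_n])
      then have "eventually (\<lambda>N. s + 1 / real (Suc N) < t) sequentially"
        using True by (intro order_tendstoD(2)) auto
      then show ?thesis
      proof eventually_elim
        case (elim N)
        have "real (grid (Suc N) s) / real (Suc N) < real (grid (Suc N) t) / real (Suc N)"
          using grid_bounds(2)[of s "Suc N"] grid_bounds(1)[of t "Suc N"] s t elim by auto
        then have "grid (Suc N) s < grid (Suc N) t" by (simp add: divide_less_cancel)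
        then show ?case using True by simp
      qed
    next
      case False
      then have "t < s" using s by simp
      have "grid (Suc N) t \<le> grid (Suc N) s" for N
        unfolding grid_def using \<open>t < s\<close> by (intro nat_mono ceiling_mono mult_right_mono) auto
      then show ?thesis using \<open>t < s\<close> by (auto simp: not_less)
    qed
    then have "(\<lambda>N. of_bool (grid (Suc N) s < grid (Suc N) t) :: real) \<longlonglongrightarrow> of_bool (s \<le> t)"
      by (rule tendsto_eventually)
    ultimately show "(\<lambda>N. ?f N s) \<longlonglongrightarrow> of_bool (s \<le> t) * delta_deriv e (x t - x s)"
      by (intro tendsto_mult)
  qed
  moreover have "(LBINT s:{0..1}. ?f N s) = inner_sum (Suc N) (grid (Suc N) t)" for N
    unfolding inner_sum_def
    using integral_grid[of "Suc N" "\<lambda>k. of_bool (k < grid (Suc N) t) * delta_deriv e (x (?u N t) -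
        x (real k / real (Suc N)))"]
    by simp
  moreover have "(LBINT s:{0..1}. of_bool (s \<le> t) * delta_deriv e (x t - x s)) =
      (LBINT s:{0..t}. delta_deriv e (x t - x s))"
    unfolding set_lebesgue_integral_def using t
    by (intro Bochner_Integration.integral_cong) (auto simp: indicator_def)
  ultimately show ?thesis by simp
qed

lemma inner_sum_bound: assumes "0 < N" shows "\<bar>inner_sum N r\<bar> \<le> freq_kernel_norm e"
proof -
  have "\<bar>\<Sum>i=1..N. of_bool (i < r) * delta_deriv e (x (real r / N) - x (real i / N))\<bar> \<le>
      (\<Sum>i=1..N. freq_kernel_norm e)"
    using delta_deriv_bound[OF e] freq_kernel_norm_nonneg[of e]
    by (intro order_trans[OF sum_abs] sum_mono) (auto simp: abs_mult)
  then show ?thesis using assms by (simp add: inner_sum_def abs_divide pos_divide_le_eq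
      mult.commute)
qed

lemma riemann_limit:
  "(\<lambda>N. (\<Sum>t\<in>triangle (Suc N). delta_deriv e (x (real (snd t) / Suc N) - x (real (fst t) / Suc N))) /
      real (Suc N) ^ 2) \<longlonglongrightarrow> silt e x"
proof -
  have inner_m: "(\<lambda>t. indicator {0..1} t * inner_sum (Suc n) (grid (Suc n) t)) \<in>
      borel_measurable borel" for n
    using grid_measurable[of "inner_sum (Suc n)" "Suc n"] by (intro borel_measurable_times) auto
  have "(\<lambda>N. LBINT t:{0..1}. inner_sum (Suc N) (grid (Suc N) t)) \<longlonglongrightarrow> (LBINT t:{0..1}. LBINT s:{0..t}.
      delta_deriv e (x t - x s))"
  \<comment> \<open>The exceptional point is put outside the interval, since convergence holds
    everywhere in it.\<close>
  proof (rule set_integral_dominated[where z = 2 and B = "freq_kernel_norm e"])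
    show "(\<lambda>t. indicator {0..1} t * inner_sum (Suc n) (grid (Suc n) t)) \<in> borel_measurable borel"
        for n
      by (rule inner_m)
    show "(\<lambda>t. indicator {0..1} t * (LBINT s:{0..t}. delta_deriv e (x t - x s))) \<in>
        borel_measurable borel"
    proof (rule borel_measurable_LIMSEQ_real[OF _ inner_m])
      show "(\<lambda>N. indicator {0..1} t * inner_sum (Suc N) (grid (Suc N) t)) \<longlonglongrightarrow> indicator {0..1} t *
          (LBINT s:{0..t}. delta_deriv e (x t - x s))" for t
        using inner_limit[of t] by (cases "t \<in> {0..1}") (auto intro!: tendsto_mult)
    qed
  qed (use inner_limit inner_sum_bound in auto)
  moreover have "(LBINT t:{0..1}. inner_sum (Suc N) (grid (Suc N) t)) =
    (\<Sum>t\<in>triangle (Suc N). delta_deriv e (x (real (snd t) / Suc N) - x (real (fst t) / Suc N))) /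
        real (Suc N) ^ 2" for N
  proof -
    let ?n = "Suc N"
    let ?f = "\<lambda>r i. delta_deriv e (x (real r / ?n) - x (real i / ?n))"
    have tri: "triangle ?n = (\<lambda>(r, i). (i, r)) ` {t \<in> {1..?n} \<times> {1..?n}. snd t < fst t}"
    proof (rule set_eqI)
      fix t :: "nat \<times> nat"
      show "t \<in> triangle ?n \<longleftrightarrow> t \<in> (\<lambda>(r, i). (i, r)) ` {t \<in> {1..?n} \<times> {1..?n}. snd t < fst t}"
        by (cases t) (auto simp: image_iff)
    qed
    have "(\<Sum>t\<in>triangle ?n. ?f (snd t) (fst t)) =
        (\<Sum>t\<in>{t \<in> {1..?n} \<times> {1..?n}. snd t < fst t}. ?f (fst t) (snd t))"
      unfolding tri by (subst sum.reindex) (auto simp: inj_on_def case_prod_beta)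
    also have "\<dots> = (\<Sum>t\<in>{1..?n} \<times> {1..?n}. of_bool (snd t < fst t) * ?f (fst t) (snd t))"
    proof -
      have "(\<Sum>t\<in>{t \<in> {1..?n} \<times> {1..?n}. snd t < fst t}. ?f (fst t) (snd t)) =
        (\<Sum>t\<in>{1..?n} \<times> {1..?n}. if snd t < fst t then ?f (fst t) (snd t) else 0)"
        by (rule sum.inter_filter) simp
      also have "\<dots> = (\<Sum>t\<in>{1..?n} \<times> {1..?n}. of_bool (snd t < fst t) * ?f (fst t) (snd t))"
        by (rule sum.cong) auto
      finally show ?thesis .
    qed
    also have "\<dots> = (\<Sum>r=1..?n. \<Sum>i=1..?n. of_bool (i < r) * ?f r i)"
      by (subst sum.cartesian_product') simp
    finally have eq: "(\<Sum>t\<in>triangle ?n. ?f (snd t) (fst t)) = (\<Sum>r=1..?n. \<Sum>i=1..?n. of_bool (i < r) *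
        ?f r i)" .
    have "(LBINT t:{0..1}. inner_sum ?n (grid ?n t)) = (\<Sum>r=1..?n. inner_sum ?n r) / ?n"
      by (rule integral_grid) simp
    then show ?thesis unfolding inner_sum_def eq
      by (simp add: power2_eq_square flip: sum_divide_distrib)
  qed
  ultimately show ?thesis unfolding silt_def by simp
qed

end

text \<open>The kernel is odd, so only the sine part of the exponential survives.\<close>

lemma fourier_kernel:
  assumes "0 < e"
  shows "(LINT p|lborel. complex_of_real p * iexp (p * y) * complex_of_real (exp (- e * p\<^sup>2 / 2))) =
      \<i> * complex_of_real (delta_deriv e y)"
proof -
  have i1: "integrable lborel (\<lambda>p. complex_of_real (freq_kernel e p * cos (p * y)))"
    and i2: "integrable lborel (\<lambda>p. \<i> * complex_of_real (freq_kernel e p * sin (p * y)))"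
    by (intro integrable_of_real integrable_mult_right integrable_freq_kernel_times assms; simp)+
  have odd: "(LBINT p. freq_kernel e p * cos (p * y)) = 0"
  proof -
    have "(LBINT p. freq_kernel e p * cos (p * y)) = (LBINT p. freq_kernel e (- p) * cos (- p * y))"
      using lborel_integral_real_affine[of "-1" "\<lambda>p. freq_kernel e p * cos (p * y)" 0] by simp
    then show ?thesis by simp
  qed
  have "(LINT p|lborel. complex_of_real p * iexp (p * y) * complex_of_real (exp (- e * p\<^sup>2 / 2))) =
    (LINT p|lborel. complex_of_real (freq_kernel e p * cos (p * y)) + \<i> *
        complex_of_real (freq_kernel e p * sin (p * y)))"
    by (intro Bochner_Integration.integral_cong refl)
       (simp add: freq_kernel_def exp_eq_polar cis_conv_exp[symmetric] complex_eq_iff)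
  also have "\<dots> = complex_of_real (LBINT p. freq_kernel e p * cos (p * y)) + \<i> *
      complex_of_real (LBINT p. freq_kernel e p * sin (p * y))"
    unfolding Bochner_Integration.integral_add[OF i1 i2] integral_mult_right_zero
        integral_complex_of_real ..
  finally show ?thesis unfolding odd by (simp add: delta_deriv_def)
qed

text \<open>The imaginary unit in front and the one from \<open>fourier_kernel\<close> multiply to
  -1, so the regularisation is real.\<close>

lemma dsilt_approx_silt:
  assumes "0 < e"
  shows "dsilt_approx X e \<omega> = complex_of_real (- silt e (\<lambda>t. X t \<omega>) / (2 * pi))"
proof -
  have c: "(LINT s:A|lborel. \<i> * complex_of_real (g s)) =
      \<i> * complex_of_real (LINT s:A|lborel. g s)" for A and g :: "real \<Rightarrow> real"
  proof -
    have "(LINT s:A|lborel. \<i> * complex_of_real (g s)) =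
        (LINT s|lborel. \<i> * complex_of_real (indicator A s * g s))"
      unfolding set_lebesgue_integral_def
      by (intro Bochner_Integration.integral_cong) (auto simp: scaleR_conv_of_real)
    also have "\<dots> = \<i> * complex_of_real (LINT s|lborel. indicator A s * g s)"
      by (simp only: integral_mult_right_zero integral_complex_of_real)
    finally show ?thesis by (simp add: set_lebesgue_integral_def)
  qed
  show ?thesis
    unfolding dsilt_approx_def fourier_kernel[OF assms] c silt_def
    by (simp add: complex_eq_iff Re_divide Im_divide power2_eq_square)
qed

section \<open>Uniform tails for the regularised local time\<close>

text \<open>Sums over the layers \<open>l < sqrt Y \<le> l + 1\<close>. The rate 1/4 makes the
  series geometric with ratio \<open>exp (1/4) / 2 < 1\<close>.\<close>

lemma (in prob_space) exp_moment_of_tail: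
  assumes [measurable]: "Y \<in> borel_measurable M" and Y0: "\<And>\<omega>. 0 \<le> Y \<omega>"
    and tail: "\<And>l. 1 \<le> l \<Longrightarrow> prob {\<omega>\<in>space M. (real l)\<^sup>2 < Y \<omega>} \<le> 2 * (1/2) ^ l"
  shows "(\<integral>\<^sup>+\<omega>. ennreal (exp (sqrt (Y \<omega>) / 4)) \<partial>M) \<le>
      ennreal (exp 1 + (\<Sum>l. exp ((real l + 1) / 4) * (2 * (1/2) ^ l)))"
    and "summable (\<lambda>l. exp ((real l + 1) / 4) * (2 * (1/2) ^ l))"
proof -
  let ?t = "\<lambda>l::nat. exp ((real l + 1) / 4) * (2 * (1/2) ^ l)"
  have t_eq: "?t l = (2 * exp (1/4)) * (exp (1/4) / 2) ^ l" for l
  proof -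
    have "exp ((real l + 1) / 4) = exp (1/4) * exp (1/4) ^ l"
      by (simp add: add_divide_distrib exp_add flip: exp_of_nat_mult)
    then show ?thesis by (simp add: power_divide)
  qed
  have "exp (1/4) < exp (1/2 :: real)" by simp
  also have "\<dots> \<le> 2" by (rule exp_half_le2)
  finally have r: "exp (1/4 :: real) / 2 < 1" by simp
  show sm: "summable ?t" unfolding t_eq using r by (intro summable_mult summable_geometric) auto
  have "(\<integral>\<^sup>+\<omega>. ennreal (exp (sqrt (Y \<omega>) / 4)) \<partial>M) \<le>
    (\<integral>\<^sup>+\<omega>. ennreal (exp 1) + (\<Sum>l. ennreal (exp ((real l + 1) / 4)) * indicator {\<omega>\<in>space M. 1 \<le>
        l \<and> (real l)\<^sup>2 < Y \<omega>} \<omega>) \<partial>M)"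
  proof (rule nn_integral_mono)
    fix \<omega> assume w: "\<omega> \<in> space M"
    let ?g = "\<lambda>l. ennreal (exp ((real l + 1) / 4)) * indicator {\<omega>\<in>space M. 1 \<le>
        l \<and> (real l)\<^sup>2 < Y \<omega>} \<omega>"
    show "ennreal (exp (sqrt (Y \<omega>) / 4)) \<le> ennreal (exp 1) + (\<Sum>l. ?g l)"
    proof (cases "sqrt (Y \<omega>) \<le> 1")
      case True
      then have "sqrt (Y \<omega>) / 4 \<le> 1" by linarith
      then have "ennreal (exp (sqrt (Y \<omega>) / 4)) \<le> ennreal (exp 1)"
        by (intro ennreal_leI) (simp only: exp_le_cancel_iff)
      then show ?thesis by (simp add: add_increasing2)
    next
      case False
      \<comment> \<open>Ceiling minus one keeps \<open>l\<close> strictly below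
        \<open>sqrt Y\<close>, in accordance with the strict event in \<open>tail\<close>.\<close>
      define l where "l = nat (\<lceil>sqrt (Y \<omega>)\<rceil> - 1)"
      have c: "2 \<le> \<lceil>sqrt (Y \<omega>)\<rceil>" using False by linarith
      then have l: "1 \<le> l" "real l < sqrt (Y \<omega>)" "sqrt (Y \<omega>) \<le> real l + 1"
        unfolding l_def by linarith+
      have "(real l)\<^sup>2 < (sqrt (Y \<omega>))\<^sup>2" using l by (intro power_strict_mono) auto
      then have "(real l)\<^sup>2 < Y \<omega>" using Y0 by simp
      then have g: "ennreal (exp ((real l + 1) / 4)) = ?g l" using l w by simp
      have "ennreal (exp (sqrt (Y \<omega>) / 4)) \<le> ennreal (exp ((real l + 1) / 4))"
        using l by (intro ennreal_leI) simp
      also note g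
      also have "?g l \<le> (\<Sum>l. ?g l)"
      proof -
        have "sum g {l} \<le> suminf g" for g :: "nat \<Rightarrow> ennreal" by (intro sum_le_suminf) auto
        from this[of ?g] show ?thesis
          by (simp only: sum.insert finite.emptyI empty_iff not_False_eq_True sum.empty add_0_right)
      qed
      finally show ?thesis by (intro add_increasing) auto
    qed
  qed
  also have "\<dots> = ennreal (exp 1) + (\<Sum>l. \<integral>\<^sup>+\<omega>. ennreal (exp ((real l + 1) / 4)) *
      indicator {\<omega>\<in>space M. 1 \<le> l \<and> (real l)\<^sup>2 < Y \<omega>} \<omega> \<partial>M)"
    by (subst nn_integral_add) (auto simp: nn_integral_suminf emeasure_space_1)
  also have "\<dots> \<le> ennreal (exp 1) + (\<Sum>l. ennreal (?t l))"
  proof (intro add_left_mono suminf_le)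
    fix l
    have "(\<integral>\<^sup>+\<omega>. ennreal (exp ((real l + 1) / 4)) * indicator {\<omega>\<in>space M. 1 \<le>
        l \<and> (real l)\<^sup>2 < Y \<omega>} \<omega> \<partial>M) =
      ennreal (exp ((real l + 1) / 4)) * emeasure M {\<omega>\<in>space M. 1 \<le> l \<and> (real l)\<^sup>2 < Y \<omega>}"
      by (intro nn_integral_cmult_indicator) measurable
    also have "\<dots> \<le> ennreal (exp ((real l + 1) / 4)) * ennreal (2 * (1/2) ^ l)"
      unfolding emeasure_eq_measure using tail[of l]
      by (intro mult_left_mono ennreal_leI) (cases "1 \<le> l"; simp)+
    also have "\<dots> = ennreal (?t l)" by (simp add: ennreal_mult)
    finally show "(\<integral>\<^sup>+\<omega>. ennreal (exp ((real l + 1) / 4)) * indicator {\<omega>\<in>space M. 1 \<le>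
        l \<and> (real l)\<^sup>2 < Y \<omega>} \<omega> \<partial>M) \<le> ennreal (?t l)" .
  qed auto
  also have "(\<Sum>l. ennreal (?t l)) = ennreal (\<Sum>l. ?t l)"
    by (intro suminf_ennreal2 sm) auto
  also have "ennreal (exp 1) + ennreal (\<Sum>l. ?t l) = ennreal (exp 1 + (\<Sum>l. ?t l))"
    using sm by (intro ennreal_plus[symmetric]) (auto intro!: suminf_nonneg)
  finally show "(\<integral>\<^sup>+\<omega>. ennreal (exp (sqrt (Y \<omega>) / 4)) \<partial>M) \<le> ennreal (exp 1 + (\<Sum>l. ?t l))" .
qed

section \<open>Transfer of the tails from the walk to the stable process\<close>

locale stable_process =
  fixes M :: "'a measure" and X :: "real \<Rightarrow> 'a \<Rightarrow> real" and a s :: real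
  assumes sp: "sym_stable_process M a s X" and a1: "1 < a"
begin

sublocale prob_space M
  using sp by (simp add: sym_stable_process_def)

abbreviation "c \<equiv> s powr a"

lemma a2: "a \<le> 2" and c0: "0 < c" and X_measurable [measurable]: "X t \<in> borel_measurable M"
  using sp by (auto simp: sym_stable_process_def)

lemma X_right_continuous: "\<omega> \<in> space M \<Longrightarrow> 0 \<le> t \<Longrightarrow> continuous (at_right t) (\<lambda>t. X t \<omega>)"
  using sp by (simp add: sym_stable_process_def)

definition inc :: "nat \<Rightarrow> nat \<Rightarrow> 'a \<Rightarrow> real" where
  "inc N k \<omega> = X (real (Suc k) / N) \<omega> - X (real k / N) \<omega>"

lemma walk_inc:
  assumes "0 < N" "0 < e" shows "walk M (inc N) N a c e"
proof (intro walk.intro walk_axioms.intro)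
  show "prob_space M" by (rule prob_space_axioms)
  show "indep_vars (\<lambda>_. borel) (inc N) UNIV"
  proof -
    have "\<forall>tt :: nat \<Rightarrow> real. 0 \<le> tt 0 \<longrightarrow> mono tt \<longrightarrow>
        indep_vars (\<lambda>_. borel) (\<lambda>i \<omega>. X (tt (Suc i)) \<omega> - X (tt i) \<omega>) UNIV"
      using sp by (simp add: sym_stable_process_def)
    from this[rule_format, of "\<lambda>k. real k / N"] show ?thesis
      unfolding inc_def[abs_def] by (simp add: mono_def divide_right_mono)
  qed
  fix k u
  have "(CLINT \<omega>|M. iexp (u * (X (real (Suc k) / N) \<omega> - X (real k / N) \<omega>))) =
     complex_of_real (exp (- (real (Suc k) / N - real k / N) * s powr a * \<bar>u\<bar> powr a))"
  proof -
    have "\<forall>r t u. 0 \<le> r \<longrightarrow> r \<le> t \<longrightarrow> (CLINT \<omega>|M. iexp (u * (X t \<omega> - X r \<omega>))) =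
        complex_of_real (exp (- (t - r) * s powr a * \<bar>u\<bar> powr a))"
      using sp unfolding sym_stable_process_def by (elim conjE)
    from this[rule_format, of "real k / N" "real (Suc k) / N" u] show ?thesis
      by (simp add: divide_right_mono)
  qed
  also have "- (real (Suc k) / N - real k / N) * s powr a * \<bar>u\<bar> powr a =
      - (levy_exponent a c u / N)"
    by (simp add: levy_exponent_def diff_divide_distrib[symmetric])
  finally show "(CLINT \<omega>|M. iexp (u * inc N k \<omega>)) =
      complex_of_real (exp (- (levy_exponent a c u / N)))"
    by (simp add: inc_def)
qed (use assms a1 a2 c0 in auto)

definition grid_silt :: "real \<Rightarrow> nat \<Rightarrow> 'a \<Rightarrow> real" where
  "grid_silt e N \<omega> = (\<Sum>t\<in>triangle N. delta_deriv e (X (real (snd t) / N) \<omega> - X (real (fst t) / N)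
      \<omega>)) / real N ^ 2"

lemma step_sum_inc:
  assumes "0 < N" "0 < (e::real)" "t \<in> triangle N"
  shows "walk.step_sum (inc N) \<omega> t = X (real (snd t) / N) \<omega> - X (real (fst t) / N) \<omega>"
proof -
  interpret W: walk M "inc N" N a c e by (intro walk_inc assms)
  have "fst t \<le> snd t" using assms(3) by (cases t) auto
  then show ?thesis
    unfolding W.step_sum_def inc_def by (rule sum_Suc_diff'[of _ _ "\<lambda>k. X (real k / N) \<omega>"])
qed

lemma walk_silt_grid_silt:
  assumes "0 < N" "0 < e" shows "walk.walk_silt (inc N) N e N \<omega> = grid_silt e N \<omega>"
proof -
  interpret W: walk M "inc N" N a c e by (intro walk_inc assms)
  show ?thesis unfolding W.walk_silt_def grid_silt_def using step_sum_inc[OF assms] by simp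
qed

abbreviation "path_silt e \<omega> \<equiv> silt e (\<lambda>t. X t \<omega>)"

lemma grid_silt_limit: "0 < e \<Longrightarrow> \<omega> \<in> space M \<Longrightarrow> (\<lambda>n. grid_silt e (Suc n) \<omega>) \<longlonglongrightarrow> path_silt e \<omega>"
  unfolding grid_silt_def by (intro riemann_limit X_right_continuous)

lemma grid_silt_measurable [measurable]: assumes "0 < e" shows "grid_silt e N \<in> borel_measurable M"
proof -
  have [measurable]: "delta_deriv e \<in> borel_measurable borel"
    using assms by (rule delta_deriv_measurable)
  show ?thesis unfolding grid_silt_def[abs_def] by measurable
qed

lemma path_silt_measurable: "0 < e \<Longrightarrow> path_silt e \<in> borel_measurable M"
  by (rule borel_measurable_LIMSEQ_real[OF grid_silt_limit]) auto

lemma grid_silt_bound: assumes "0 < e" "0 < N" shows "\<bar>grid_silt e N \<omega>\<bar> \<le> freq_kernel_norm e"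
proof -
  have "triangle N \<subseteq> {1..N} \<times> {1..N}" by auto
  then have "card (triangle N) \<le> card ({1..N} \<times> {1..N})" by (intro card_mono) auto
  then have c: "real (card (triangle N)) \<le> real N ^ 2"
    by (simp add: card_cartesian_product power2_eq_square flip: of_nat_mult)
  have "\<bar>\<Sum>t\<in>triangle N. delta_deriv e (X (real (snd t) / N) \<omega> - X (real (fst t) / N) \<omega>)\<bar> \<le>
      (\<Sum>t\<in>triangle N. freq_kernel_norm e)"
    by (intro order_trans[OF sum_abs] sum_mono delta_deriv_bound assms)
  also have "\<dots> \<le> real N ^ 2 * freq_kernel_norm e"
    using c freq_kernel_norm_nonneg[of e] by (simp add: mult_right_mono)
  finally show ?thesis using assms by (simp add: grid_silt_def abs_divide pos_divide_le_eq
      mult.commute)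
qed

text \<open>The value of \<open>walk_tail_const\<close>. It involves neither \<open>N\<close> nor
  \<open>e\<close>, which is the uniformity needed in both limits.\<close>

definition tail_const :: real where
  "tail_const = 4 * sqrt (7264 * resolvent_mass a c + 10) + 1"

lemma tail_const_pos: "0 < tail_const"
  using resolvent_mass_nonneg[OF c0, of a] unfolding tail_const_def by (intro add_nonneg_pos) auto

lemma variance_scale_pos': "0 < e \<Longrightarrow> 0 < variance_scale a c e"
  using c0 by (intro variance_scale_pos) auto

text \<open>Fatou's lemma along the grids: a strict inequality for the limit forces the weak one for
  all large \<open>N\<close>. For fixed \<open>e\<close> the discretisation terms are below
  \<open>N * variance_scale\<close> eventually, and the bound for the walk no longer depends on
  \<open>N\<close>.\<close>

lemma silt_tail:
  assumes e: "0 < e" and l: "1 \<le> l"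
  shows "prob {\<omega>\<in>space M. tail_const * (real l)\<^sup>2 * sqrt (variance_scale a c e) < \<bar>path_silt e \<omega>\<bar>} \<le>
      2 * (1/2) ^ l"
proof -
  let ?T = "tail_const * (real l)\<^sup>2 * sqrt (variance_scale a c e)"
  have [measurable]: "path_silt e \<in> borel_measurable M" "grid_silt e n \<in> borel_measurable M" for n
    using e by (auto intro: path_silt_measurable)
  define A where "A n = {\<omega>\<in>space M. ?T \<le> \<bar>grid_silt e (Suc n) \<omega>\<bar>}" for n
  have [measurable]: "A n \<in> sets M" for n unfolding A_def by measurable
  have "emeasure M {\<omega>\<in>space M. ?T < \<bar>path_silt e \<omega>\<bar>} =
      (\<integral>\<^sup>+\<omega>. indicator {\<omega>\<in>space M. ?T < \<bar>path_silt e \<omega>\<bar>} \<omega> \<partial>M)"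
    by (rule nn_integral_indicator[symmetric]) measurable
  also have "\<dots> \<le> (\<integral>\<^sup>+\<omega>. liminf (\<lambda>n. indicator (A n) \<omega>) \<partial>M)"
  proof (rule nn_integral_mono)
    fix \<omega> assume w: "\<omega> \<in> space M"
    show "indicator {\<omega>\<in>space M. ?T < \<bar>path_silt e \<omega>\<bar>} \<omega> \<le> liminf (\<lambda>n. indicator (A n) \<omega> :: ennreal)"
    proof (cases "?T < \<bar>path_silt e \<omega>\<bar>")
      case True
      have "(\<lambda>n. \<bar>grid_silt e (Suc n) \<omega>\<bar>) \<longlonglongrightarrow> \<bar>path_silt e \<omega>\<bar>"
        by (intro tendsto_rabs grid_silt_limit e w)
      then have "eventually (\<lambda>n. ?T < \<bar>grid_silt e (Suc n) \<omega>\<bar>) sequentially"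
        using True by (rule order_tendstoD(1))
      then have "eventually (\<lambda>n. 1 \<le> (indicator (A n) \<omega> :: ennreal)) sequentially"
        by eventually_elim (use w in \<open>auto simp: A_def\<close>)
      then have "1 \<le> liminf (\<lambda>n. indicator (A n) \<omega> :: ennreal)" by (rule Liminf_bounded)
      then show ?thesis using True w by simp
    qed simp
  qed
  also have "\<dots> \<le> liminf (\<lambda>n. \<integral>\<^sup>+\<omega>. indicator (A n) \<omega> \<partial>M)"
    by (rule nn_integral_liminf) measurable
  also have "\<dots> \<le> liminf (\<lambda>n::nat. ennreal (2 * (1/2) ^ l))"
  proof (rule Liminf_mono)
    have "eventually (\<lambda>n. max (gauss_second_moment e) ((freq_kernel_norm e)\<^sup>2) / variance_scale a c
        e < real (Suc n)) sequentially"
      using filterlim_compose[OF filterlim_real_sequentially filterlim_Suc]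
      by (simp add: filterlim_at_top_dense)
    then show "eventually (\<lambda>n. (\<integral>\<^sup>+\<omega>. indicator (A n) \<omega> \<partial>M) \<le> ennreal (2 * (1/2) ^ l)) sequentially"
    proof eventually_elim
      case (elim n)
      interpret W: walk M "inc (Suc n)" "Suc n" a c e by (intro walk_inc e) simp
      have "max (gauss_second_moment e) ((freq_kernel_norm e)\<^sup>2) \<le>
          real (Suc n) * variance_scale a c e"
        using elim variance_scale_pos'[OF e] by (simp add: pos_divide_less_eq)
      then have "prob {\<omega>\<in>space M. W.walk_tail_const * (real l)\<^sup>2 * sqrt (variance_scale a c e) \<le>
          \<bar>W.walk_silt (Suc n) \<omega>\<bar>} \<le> 2 * (1/2) ^ l"
        by (intro W.walk_tail l) auto
      then have "prob (A n) \<le> 2 * (1/2) ^ l"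
        unfolding A_def W.walk_tail_const_def tail_const_def walk_silt_grid_silt[OF zero_less_Suc e]
            .
      then show ?case by (simp add: emeasure_eq_measure ennreal_leI)
    qed
  qed
  also have "\<dots> = ennreal (2 * (1/2) ^ l)" by (simp add: Liminf_const)
  finally show ?thesis by (simp add: emeasure_eq_measure)
qed

definition exp_moment_const :: real where
  "exp_moment_const = exp 1 + (\<Sum>l. exp ((real l + 1) / 4) * (2 * (1/2) ^ l))"

lemma silt_exp_moment:
  assumes e: "0 < e"
  shows "(\<integral>\<^sup>+\<omega>. ennreal (exp (sqrt (\<bar>path_silt e \<omega>\<bar> / (tail_const * sqrt (variance_scale a c e))) /
      4)) \<partial>M) \<le> ennreal exp_moment_const"
  unfolding exp_moment_const_def
proof (rule exp_moment_of_tail(1))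
  let ?b = "tail_const * sqrt (variance_scale a c e)"
  have b: "0 < ?b" using tail_const_pos variance_scale_pos'[OF e] by simp
  show "(\<lambda>\<omega>. \<bar>path_silt e \<omega>\<bar> / ?b) \<in> borel_measurable M"
    using path_silt_measurable[OF e] by measurable
  show "0 \<le> \<bar>path_silt e \<omega>\<bar> / ?b" for \<omega> using b by simp
  fix l :: nat assume l: "1 \<le> l"
  have "(real l)\<^sup>2 < \<bar>path_silt e \<omega>\<bar> / ?b \<longleftrightarrow> tail_const * (real l)\<^sup>2 * sqrt (variance_scale a c e) <
      \<bar>path_silt e \<omega>\<bar>" for \<omega>
    using b by (simp add: pos_less_divide_eq mult_ac)
  then show "prob {\<omega>\<in>space M. (real l)\<^sup>2 < \<bar>path_silt e \<omega>\<bar> / ?b} \<le> 2 * (1/2) ^ l"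
    using silt_tail[OF e l] by simp
qed

lemma cmod_dsilt_approx: "0 < e \<Longrightarrow> cmod (dsilt_approx X e \<omega>) = \<bar>path_silt e \<omega>\<bar> / (2 * pi)"
  by (simp only: dsilt_approx_silt norm_of_real) simp

lemma dsilt_approx_measurable: 
  assumes "0 < e" shows "dsilt_approx X e \<in> borel_measurable M"
  unfolding dsilt_approx_silt[OF assms, abs_def] using path_silt_measurable[OF assms] by measurable

text \<open>At high frequency the integrand is at most a multiple of
  \<open>\<bar>p\<bar> powr (2 - 2 * a)\<close>, whose exponent is below -1 exactly when
  \<open>3/2 < a\<close>.\<close>

lemma variance_scale_bounded:
  assumes "3/2 < a"
  obtains B where "0 < B" "\<And>e. 0 < e \<Longrightarrow> variance_scale a c e \<le> B"
proof
  let ?g = "\<lambda>p::real. indicator {-1..1} p + (1 / c\<^sup>2) * (indicator {p. 1 \<le>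
      \<bar>p\<bar>} p * \<bar>p\<bar> powr (2 - 2 * a))"
  have int: "integrable lborel ?g"
    using assms by (intro Bochner_Integration.integrable_add integrable_indicator_Icc
        integrable_mult_right integrable_abs_powr_tail) auto
  have le: "p\<^sup>2 * exp (- (e * p\<^sup>2 / 2)) * (resolvent a c p)\<^sup>2 \<le> ?g p" if "0 < e" for e p :: real
  proof -
    have "p\<^sup>2 * exp (- (e * p\<^sup>2 / 2)) * (resolvent a c p)\<^sup>2 \<le> p\<^sup>2 * 1 * (resolvent a c p)\<^sup>2"
      using that by (intro mult_right_mono mult_left_mono) auto
    also have "\<dots> \<le> ?g p"
    proof (cases "\<bar>p\<bar> \<le> 1")
      case True
      have "p\<^sup>2 * 1 * (resolvent a c p)\<^sup>2 \<le> 1 * 1 * 1"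
        using True resolvent_le1[of c a p] resolvent_pos[of c a p] c0
        by (intro mult_mono) (auto simp: abs_square_le_1 power_le_one)
      also have "1 * 1 * 1 \<le> ?g p" using True by (auto simp: indicator_def abs_le_iff)
      finally show ?thesis .
    next
      case False
      have "resolvent a c p \<le> \<bar>p\<bar> powr (- a) / c" using False c0 by (intro resolvent_le_powr) auto
      then have "(resolvent a c p)\<^sup>2 \<le> (\<bar>p\<bar> powr (- a) / c)\<^sup>2"
        using resolvent_pos[of c a p] c0 by (intro power_mono) auto
      then have "p\<^sup>2 * 1 * (resolvent a c p)\<^sup>2 \<le> p\<^sup>2 * 1 * (\<bar>p\<bar> powr (- a) / c)\<^sup>2"
        by (intro mult_left_mono) auto
      also have "\<dots> = (1 / c\<^sup>2) * \<bar>p\<bar> powr (2 - 2 * a)"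
      proof -
        have "p\<^sup>2 * \<bar>p\<bar> powr (- (2 * a)) = \<bar>p\<bar> powr (2 - 2 * a)"
          using False by (simp add: powr_diff powr_minus divide_inverse)
        moreover have "(\<bar>p\<bar> powr (- a))\<^sup>2 = \<bar>p\<bar> powr (- (2 * a))"
          by (simp add: power2_eq_square flip: powr_add)
        ultimately show ?thesis by (simp add: power_divide)
      qed
      finally show ?thesis using False by (auto simp: indicator_def)
    qed
    finally show ?thesis .
  qed
  show "0 < integral\<^sup>L lborel ?g + 1"
    by (intro add_nonneg_pos Bochner_Integration.integral_nonneg) auto
  show "variance_scale a c e \<le> integral\<^sup>L lborel ?g + 1" if "0 < e" for e
  proof -
    have "variance_scale a c e \<le> integral\<^sup>L lborel ?g"
      unfolding variance_scale_def using that c0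
      by (intro integral_mono integrable_variance_scale int le) auto
    then show ?thesis by simp
  qed
qed

text \<open>Convergence in probability carries the uniform tail over to the limit, and a tail in
  \<open>sqrt\<close> covers every power \<open>g \<le> 1/2\<close>.\<close>

lemma bounded_variance_exp_integrable:
  assumes B: "0 < B" "\<And>e. 0 < e \<Longrightarrow> variance_scale a c e \<le> B"
    and dsilt: "is_dsilt M X \<theta>" and g: "0 \<le> g" "g \<le> 1/2"
  shows "\<exists>C>0. integrable M (\<lambda>\<omega>. exp (C * cmod (\<theta> \<omega>) powr g))"
proof -
  have [measurable]: "\<theta> \<in> borel_measurable M" using dsilt by (simp add: is_dsilt_def)
  define T where "T = tail_const * sqrt B / (2 * pi)"
  have T: "0 < T" using tail_const_pos B by (simp add: T_def)
  \<comment> \<open>The 2 leaves room for the approximation: if the limit exceeds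
    \<open>2 * T * l\<^sup>2\<close>, then the approximation exceeds \<open>T * l\<^sup>2\<close> or
    differs from the limit by more than \<open>T / 2\<close>.\<close>
  let ?Y = "\<lambda>\<omega>. cmod (\<theta> \<omega>) / (2 * T)"
  have tail: "prob {\<omega>\<in>space M. (real l)\<^sup>2 < ?Y \<omega>} \<le> 2 * (1/2) ^ l" if l: "1 \<le> l" for l
  proof -
    have lim: "((\<lambda>e. prob {\<omega>\<in>space M. T / 2 < cmod (dsilt_approx X e \<omega> - \<theta> \<omega>)} + 2 * (1/2) ^ l) \<longlongrightarrow> 0
        + 2 * (1/2) ^ l) (at_right 0)"
    proof (intro tendsto_add tendsto_const)
      have "\<forall>\<delta>>0. ((\<lambda>e. prob {\<omega>\<in>space M. \<delta> < cmod (dsilt_approx X e \<omega> - \<theta> \<omega>)}) \<longlongrightarrow> 0) (at_right 0)"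
        using dsilt unfolding is_dsilt_def by (rule conjunct2)
      then show "((\<lambda>e. prob {\<omega>\<in>space M. T / 2 < cmod (dsilt_approx X e \<omega> - \<theta> \<omega>)}) \<longlongrightarrow> 0) (at_right 0)"
        using T half_gt_zero by blast
    qed
    have "eventually (\<lambda>e. prob {\<omega>\<in>space M. (real l)\<^sup>2 < ?Y \<omega>} \<le>
      prob {\<omega>\<in>space M. T / 2 < cmod (dsilt_approx X e \<omega> - \<theta> \<omega>)} + 2 * (1/2) ^ l) (at_right 0)"
      using eventually_at_right_less
    proof eventually_elim
      case (elim e)
      have [measurable]: "path_silt e \<in> borel_measurable M" "dsilt_approx X e \<in> borel_measurable M"
        using elim by (auto intro: path_silt_measurable dsilt_approx_measurable)
      let ?A = "{\<omega>\<in>space M. T / 2 < cmod (dsilt_approx X e \<omega> - \<theta> \<omega>)}"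
      let ?B = "{\<omega>\<in>space M. tail_const * (real l)\<^sup>2 * sqrt (variance_scale a c e) < \<bar>path_silt e
          \<omega>\<bar>}"
      have "{\<omega>\<in>space M. (real l)\<^sup>2 < ?Y \<omega>} \<subseteq> ?A \<union> ?B"
      proof (rule subsetI, rule ccontr)
        fix \<omega> assume w: "\<omega> \<in> {\<omega>\<in>space M. (real l)\<^sup>2 < ?Y \<omega>}" "\<omega> \<notin> ?A \<union> ?B"
        have "\<bar>path_silt e \<omega>\<bar> \<le> tail_const * (real l)\<^sup>2 * sqrt (variance_scale a c e)"
          using w by auto
        also have "\<dots> \<le> tail_const * (real l)\<^sup>2 * sqrt B"
          using B(2)[OF elim] tail_const_pos by (intro mult_left_mono) auto
        finally have "cmod (dsilt_approx X e \<omega>) \<le> (real l)\<^sup>2 * T"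
          unfolding cmod_dsilt_approx[OF elim] T_def by (simp add: divide_right_mono mult_ac)
        moreover have "cmod (dsilt_approx X e \<omega> - \<theta> \<omega>) \<le> T / 2" using w by auto
        moreover have "cmod (\<theta> \<omega>) \<le> cmod (dsilt_approx X e \<omega>) + cmod (dsilt_approx X e \<omega> - \<theta> \<omega>)"
          by (metis norm_triangle_sub norm_minus_commute)
        moreover have "(real l)\<^sup>2 * (2 * T) < cmod (\<theta> \<omega>)"
          using w T by (simp add: pos_less_divide_eq)
        moreover have "1 * T \<le> (real l)\<^sup>2 * T" using l T by (intro mult_right_mono) auto
        ultimately show False using T by linarith
      qed
      then have "prob {\<omega>\<in>space M. (real l)\<^sup>2 < ?Y \<omega>} \<le> prob (?A \<union> ?B)"
        by (intro finite_measure_mono) auto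
      also have "\<dots> \<le> prob ?A + prob ?B" by (intro measure_Un_le) auto
      also have "\<dots> \<le> prob ?A + 2 * (1/2) ^ l" using silt_tail[OF elim l] by simp
      finally show ?case .
    qed
    from tendsto_lowerbound[OF lim this] show ?thesis by simp
  qed
  have fin: "(\<integral>\<^sup>+\<omega>. ennreal (exp (sqrt (?Y \<omega>) / 4)) \<partial>M) < \<infinity>"
    using exp_moment_of_tail(1)[of ?Y] tail T by (auto intro: le_less_trans)
  \<comment> \<open>Makes \<open>C * sqrt y\<close> equal to
    \<open>sqrt (y / (2 * T)) / 4\<close>.\<close>
  define C where "C = 1 / (4 * sqrt (2 * T))"
  have C: "0 < C" using T by (simp add: C_def)
  \<comment> \<open>The factor \<open>exp C\<close> pays for the 1 in
    \<open>y powr g \<le> 1 + sqrt y\<close>.\<close>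
  have int: "integrable M (\<lambda>\<omega>. exp C * exp (sqrt (?Y \<omega>) / 4))"
    using fin by (intro integrable_mult_right integrableI_bounded) auto
  have "integrable M (\<lambda>\<omega>. exp (C * cmod (\<theta> \<omega>) powr g))"
  proof (rule Bochner_Integration.integrable_bound[OF int])
    show "AE \<omega> in M. norm (exp (C * cmod (\<theta> \<omega>) powr g)) \<le> norm (exp C * exp (sqrt (?Y \<omega>) / 4))"
    proof (rule AE_I2)
      fix \<omega>
      define y where "y = cmod (\<theta> \<omega>)"
      have y: "0 \<le> y" by (simp add: y_def)
      have "y powr g \<le> 1 + sqrt y"
      proof (cases "y \<le> 1")
        case True
        then have "y powr g \<le> 1" using y g by (cases "y = 0") (auto intro!: powr_le1)
        then show ?thesis using y by (simp add: add_increasing2)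
      next
        case False
        then have "y powr g \<le> y powr (1/2)" using g by (intro powr_mono) auto
        also have "\<dots> = sqrt y" using y by (simp add: powr_half_sqrt)
        finally show ?thesis by simp
      qed
      then have "C * y powr g \<le> C * (1 + sqrt y)" using C by (intro mult_left_mono) auto
      also have "\<dots> = C + sqrt (y / (2 * T)) / 4"
        by (simp add: C_def distrib_left real_sqrt_divide)
      finally show "norm (exp (C * cmod (\<theta> \<omega>) powr g)) \<le> norm (exp C * exp (sqrt (?Y \<omega>) / 4))"
        by (simp add: y_def flip: exp_add)
    qed
  qed measurable
  then show ?thesis using C by blast
qed

end

section \<open>Blow-up of the variance for small index\<close>

text \<open>A converse of \<open>geometric_average\<close> that uses only the first eighth of the
  grid, which leaves space for the other lengths in a configuration. Up to index
  \<open>y = n / (1 + b)\<close> the exponent is at most 1/8 and a term at least 7/8; rounding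
  \<open>y\<close> down costs at most a factor 2. The outcome \<open>7 / (128 * (1 + b))\<close> is
  larger than claimed.\<close>

lemma geometric_average_lower:
  fixes b :: real
  assumes b: "0 \<le> b" and n: "8 * (1 + b) \<le> real (8 * n)"
  shows "1 / (20 * (1 + b)) \<le> (\<Sum>k=1..n. exp (- (real k / real (8 * n) * b))) / real (8 * n)"
proof -
  define y where "y = real n / (1 + b)"
  define m where "m = nat \<lfloor>y\<rfloor>"
  have n0: "0 < real n" using b n by simp
  have y1: "1 \<le> y" using b n by (simp add: y_def)
  have "real m = of_int \<lfloor>y\<rfloor>" using y1 by (simp add: m_def)
  moreover have "(1::real) \<le> of_int \<lfloor>y\<rfloor>" using y1 by (simp add: le_floor_iff)
  ultimately have m1: "real m \<le> y" "y / 2 \<le> real m" using floor_correct[of y] by linarith+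
  have "y \<le> real n / 1" unfolding y_def using b by (intro divide_left_mono) auto
  then have mn: "m \<le> n" using m1(1) by linarith
  have "real m * (7/8) = (\<Sum>k=1..m. 7/8)" by simp
  also have "\<dots> \<le> (\<Sum>k=1..m. exp (- (real k / real (8 * n) * b)))"
  proof (rule sum_mono)
    fix k assume "k \<in> {1..m}"
    then have "real k \<le> y" using m1(1) by (simp add: order_trans)
    then have "real k * b \<le> y * b" using b by (intro mult_right_mono) auto
    also have "y * b \<le> real n" using b n0 by (simp add: y_def divide_le_eq)
    finally have "real k / real (8 * n) * b \<le> 1/8" using n0 by (simp add: field_simps)
    moreover have "1 + - (real k / real (8 * n) * b) \<le> exp (- (real k / real (8 * n) * b))"
      by (rule exp_ge_add_one_self)
    ultimately show "7/8 \<le> exp (- (real k / real (8 * n) * b))" by linarith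
  qed
  also have "\<dots> \<le> (\<Sum>k=1..n. exp (- (real k / real (8 * n) * b)))"
    using mn by (intro sum_mono2) auto
  finally have "y / 2 * (7/8) \<le> (\<Sum>k=1..n. exp (- (real k / real (8 * n) * b)))" using m1 by linarith
  then have "y / 2 * (7/8) / real (8 * n) \<le> (\<Sum>k=1..n. exp (- (real k / real (8 * n) * b))) / real
      (8 * n)"
    by (intro divide_right_mono) auto
  moreover have "1 / (20 * (1 + b)) \<le> y / 2 * (7/8) / real (8 * n)"
    using b n0 by (simp add: y_def divide_simps)
  ultimately show ?thesis by simp
qed

section \<open>Lower bound for the second moment\<close>

context stable_process
begin

definition truncated_variance :: "real \<Rightarrow> real" where
  "truncated_variance L = (LBINT p. indicator {2..L} p * (p\<^sup>2 * (resolvent a c p)\<^sup>2))"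

text \<open>A lower bound of \<open>exp (- (B * c)) - exp (- (3 * B * c))\<close> for
  \<open>B\<close> between 1/4 and 1/2.\<close>

definition gap_const :: real where
  "gap_const = exp (- (c / 2)) * (1 - exp (- (c / 2)))"

lemma gap_const: "0 < gap_const" "gap_const \<le> 1"
  using c0 unfolding gap_const_def by (auto intro!: mult_le_one)

text \<open>A strip of unit width along the diagonal. Here \<open>p - q\<close> is bounded while
  \<open>p + q\<close> is large, so the two exponentials in \<open>kernel_cov\<close> do not
  cancel.\<close>

definition region :: "real \<Rightarrow> real \<times> real \<Rightarrow> real" where
  "region L z = indicator {2..L} (fst z) * indicator {fst z..fst z + 1} (snd z) * (fst z)\<^sup>2"

lemma region_measurable [measurable]: "region L \<in> borel_measurable (borel \<Otimes>\<^sub>M borel)"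
proof -
  define S where "S = {z :: real \<times> real. 2 \<le> fst z \<and> fst z \<le> L \<and> fst z \<le> snd z \<and> snd z \<le> fst z + 1}"
  have [measurable]: "S \<in> sets (borel \<Otimes>\<^sub>M borel)"
    unfolding borel_prod S_def
    by (intro borel_closed closed_Collect_conj closed_Collect_le continuous_intros)
  have "region L = (\<lambda>z. indicator S z * (fst z)\<^sup>2)"
    unfolding region_def S_def fun_eq_iff by (auto simp: indicator_def)
  moreover have "(\<lambda>z. indicator S z * (fst z)\<^sup>2 :: real) \<in> borel_measurable (borel \<Otimes>\<^sub>M borel)"
    by (intro borel_measurable_times borel_measurable_indicator borel_measurable_power
        measurable_fst) measurable
  ultimately show ?thesis by (simp only:)
qed

lemma region_nonneg: "0 \<le> region L z"
  by (simp add: region_def)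

text \<open>On the strip \<open>e * p\<^sup>2 \<le> 1\<close> and
  \<open>e * q\<^sup>2 \<le> 4\<close>, so the damping costs at most
  \<open>exp (- (1/2 + 2))\<close>. This is the reason for the coupling
  \<open>e = 1 / L\<^sup>2\<close>.\<close>

lemma region_le_freq_kernel:
  assumes L: "2 \<le> L" and e: "e = 1 / L\<^sup>2" and z: "region L z \<noteq> 0"
  shows "region L z * exp (- (5/2)) \<le> freq_kernel e (fst z) * freq_kernel e (snd z)"
proof -
  obtain p q where pq: "z = (p, q)" by (cases z)
  have r: "2 \<le> p" "p \<le> L" "p \<le> q" "q \<le> p + 1"
    using z unfolding region_def pq by (auto simp: indicator_def split: if_splits)
  have "p\<^sup>2 \<le> L\<^sup>2" using r by (intro power_mono) auto
  then have ep: "e * p\<^sup>2 \<le> 1" using L unfolding e by simp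
  have "q\<^sup>2 \<le> (2 * L)\<^sup>2" using r L by (intro power_mono) auto
  then have eq: "e * q\<^sup>2 \<le> 4" using L unfolding e by (simp add: power_mult_distrib divide_le_eq)
  have "p\<^sup>2 * exp (- (5/2)) \<le> (p * q) * exp (- (e * p\<^sup>2 / 2) + - (e * q\<^sup>2 / 2))"
    using r ep eq by (intro mult_mono) (auto simp: power2_eq_square)
  also have "\<dots> = freq_kernel e p * freq_kernel e q" unfolding exp_add freq_kernel_def by simp
  finally show ?thesis using r by (simp add: region_def pq)
qed

lemma integrable_region:
  assumes L: "2 \<le> L" and [measurable]: "g \<in> borel_measurable (borel \<Otimes>\<^sub>M borel)"
    and g: "\<And>z. \<bar>g z\<bar> \<le> 1"
  shows "integrable plane (\<lambda>z. region L z * g z)"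
proof -
  define e where "e = 1 / L\<^sup>2"
  have "0 < e" using L by (simp add: e_def)
  from integrable_mult_right[OF integrable_freq_kernel_freq_kernel[OF this], of "exp (5/2)"]
  show ?thesis
  proof (rule Bochner_Integration.integrable_bound)
    show "AE z in plane. norm (region L z * g z) \<le>
        norm (exp (5/2) * (freq_kernel e (fst z) * freq_kernel e (snd z)))"
    proof (rule AE_I2)
      fix z
      show "norm (region L z * g z) \<le>
          norm (exp (5/2) * (freq_kernel e (fst z) * freq_kernel e (snd z)))"
      proof (cases "region L z = 0")
        case False
        have "norm (region L z * g z) \<le> region L z * 1"
          using region_nonneg[of L z] g[of z] by (simp add: abs_mult mult_left_le)
        also have "\<dots> = exp (5/2) * (region L z * exp (- (5/2)))"
          by (simp add: exp_minus)
        also have "\<dots> \<le> exp (5/2) * (freq_kernel e (fst z) * freq_kernel e (snd z))"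
          by (intro mult_left_mono region_le_freq_kernel L e_def False) auto
        finally show ?thesis by simp
      qed simp
    qed
  qed simp
qed

text \<open>Discards the nonnegative integrand off the strip. On it the exponent is at most
  \<open>c\<close> at \<open>p - q\<close> and at least \<open>3 * c\<close> at
  \<open>p + q\<close>, and \<open>B\<close> away from 0 and bounded keeps the difference of
  exponentials above \<open>gap_const\<close>.\<close>

lemma kernel_cov_lower:
  assumes L: "2 \<le> L" and e: "e = 1 / L\<^sup>2" and B: "1/4 \<le> B" "B \<le> 1/2" and AC: "0 \<le> A" "0 \<le> C"
  shows "(\<integral>z. region L z * exp (- (A * levy_exponent a c (fst z) + C *
      levy_exponent a c (snd z))) \<partial>plane) * (exp (- (5/2)) * gap_const / 2) \<le>
      kernel_cov a c e A B C"
proof -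
  have e0: "0 < e" using L e by simp
  let ?E = "\<lambda>z. exp (- (A * levy_exponent a c (fst z) + C * levy_exponent a c (snd z)))"
  have E1: "\<bar>?E z\<bar> \<le> 1" for z
  proof -
    have "0 \<le> A * levy_exponent a c (fst z) + C * levy_exponent a c (snd z)"
      using AC levy_exponent_nonneg[of c a] c0 by (intro add_nonneg_nonneg mult_nonneg_nonneg) auto
    then show ?thesis by (simp only: abs_exp_cancel exp_le_one_iff neg_le_0_iff_le)
  qed
  have int: "integrable plane (\<lambda>z. region L z * ?E z)" by (intro integrable_region L E1) measurable
  have "(\<integral>z. region L z * ?E z * (exp (- (5/2)) * gap_const) \<partial>plane) \<le>
      (\<integral>z. freq_kernel e (fst z) * freq_kernel e (snd z) *
     (?E z * (exp (- (B * levy_exponent a c (fst z - snd z))) -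
         exp (- (B * levy_exponent a c (fst z + snd z))))) \<partial>plane)"
  proof (intro integral_mono integrable_mult_left int kernel_cov_integrable)
    fix z :: "real \<times> real"
    obtain p q where pq: "z = (p, q)" by (cases z)
    show "region L z * ?E z * (exp (- (5/2)) * gap_const) \<le> freq_kernel e (fst z) *
        freq_kernel e (snd z) *
     (?E z * (exp (- (B * levy_exponent a c (fst z - snd z))) -
         exp (- (B * levy_exponent a c (fst z + snd z)))))"
    proof (cases "region L z = 0")
      case True
      then show ?thesis using kernel_cov_integrand_nonneg[of c a B e "fst z" "snd z" A C] c0 a1 B
        by simp
    next
      case False
      then have r: "2 \<le> p" "p \<le> L" "p \<le> q" "q \<le> p + 1"
        unfolding region_def pq by (auto simp: indicator_def split: if_splits)
      have l1: "levy_exponent a c (p - q) \<le> c"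
        using levy_exponent_mono[of c a "p - q" 1] r c0 a1 by (simp add: levy_exponent_def)
      \<comment> \<open>The strip has \<open>4 \<le> p + q\<close>, so comparing with the value at 3
        suffices.\<close>
      have "(3::real) powr 1 \<le> 3 powr a" using a1 by (intro powr_mono) auto
      then have "3 * c \<le> levy_exponent a c 3" using c0 by (simp add: levy_exponent_def mult.commute)
      also have "\<dots> \<le> levy_exponent a c (p + q)" using r c0 a1 by (intro levy_exponent_mono) auto
      finally have l2: "3 * c \<le> levy_exponent a c (p + q)" .
      have "B * levy_exponent a c (p - q) \<le> B * c" using l1 B by (intro mult_left_mono) auto
      then have x1: "exp (- (B * c)) \<le> exp (- (B * levy_exponent a c (p - q)))" by simp
      have "B * (3 * c) \<le> B * levy_exponent a c (p + q)" using l2 B by (intro mult_left_mono) auto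
      then have x2: "exp (- (B * levy_exponent a c (p + q))) \<le> exp (- (B * (3 * c)))" by simp
      have "gap_const \<le> exp (- (B * c)) * (1 - exp (- (2 * B * c)))"
        unfolding gap_const_def
      proof (intro mult_mono)
        have "B * c \<le> 1/2 * c" using B c0 by (intro mult_right_mono) auto
        then show "exp (- (c / 2)) \<le> exp (- (B * c))" by simp
        have "1/4 * c \<le> B * c" using B c0 by (intro mult_right_mono) auto
        then show "1 - exp (- (c / 2)) \<le> 1 - exp (- (2 * B * c))" by simp
      qed (use c0 in auto)
      also have "\<dots> = exp (- (B * c)) - exp (- (B * (3 * c)))"
        by (simp add: right_diff_distrib flip: exp_add)
      also have "\<dots> \<le> exp (- (B * levy_exponent a c (p - q))) -
          exp (- (B * levy_exponent a c (p + q)))" using x1 x2 by linarith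
      finally have "gap_const \<le> exp (- (B * levy_exponent a c (p - q))) -
          exp (- (B * levy_exponent a c (p + q)))" .
      then have Q: "?E z * gap_const \<le> ?E z * (exp (- (B * levy_exponent a c (p - q))) -
          exp (- (B * levy_exponent a c (p + q))))"
        by (intro mult_left_mono) auto
      have P: "region L z * exp (- (5/2)) \<le> freq_kernel e p * freq_kernel e q"
        using region_le_freq_kernel[OF L e False] by (simp add: pq)
      have "0 \<le> region L z * exp (- (5/2))" using region_nonneg[of L z] by simp
      then have P0: "0 \<le> freq_kernel e p * freq_kernel e q" using P by linarith
      have Q0: "0 \<le> ?E z * gap_const" using gap_const by simp
      have "(region L z * exp (- (5/2))) * (?E z * gap_const) \<le>
          (freq_kernel e p * freq_kernel e q) * (?E z * (exp (- (B * levy_exponent a c (p - q))) -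
          exp (- (B * levy_exponent a c (p + q)))))"
        by (rule mult_mono[OF P Q P0 Q0])
      then show ?thesis by (simp add: pq mult_ac)
    qed
  qed (use e0 c0 B AC in auto)
  then show ?thesis unfolding kernel_cov_def by simp
qed

lemma region_integral:
  assumes "2 \<le> L"
  shows "(\<integral>z. region L z * (resolvent a c (fst z))\<^sup>2 \<partial>plane) = truncated_variance L"
proof -
  have b: "\<bar>(resolvent a c p)\<^sup>2\<bar> \<le> 1" for p
    using resolvent_pos[of c a p] resolvent_le1[of c a p] c0 by (simp add: power_le_one)
  have "(\<integral>z. region L z * (resolvent a c (fst z))\<^sup>2 \<partial>plane) = (LBINT p. LBINT q. region L (p, q) *
      (resolvent a c p)\<^sup>2)"
    by (subst plane_integral[OF integrable_region[OF assms]]) (use b in auto)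
  also have "\<dots> = (LBINT p. indicator {2..L} p * (p\<^sup>2 * (resolvent a c p)\<^sup>2))"
  proof (intro Bochner_Integration.integral_cong refl)
    fix p :: real
    have "(LBINT q. region L (p, q) * (resolvent a c p)\<^sup>2) =
        (LBINT q. (indicator {2..L} p * (p\<^sup>2 * (resolvent a c p)\<^sup>2)) * indicator {p..p + 1} q)"
      by (intro Bochner_Integration.integral_cong) (auto simp: region_def)
    then show "(LBINT q. region L (p, q) * (resolvent a c p)\<^sup>2) =
        indicator {2..L} p * (p\<^sup>2 * (resolvent a c p)\<^sup>2)"
      by simp
  qed
  finally show ?thesis by (simp add: truncated_variance_def)
qed

text \<open>Only interleaved pairs with overlap between \<open>2 * n\<close> and
  \<open>4 * n\<close> are kept, so that the overlap is a fixed fraction of the \<open>8 * n\<close>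
  steps. Start, gap, overlap and gap fit because \<open>2 * n + n + 4 * n + n = 8 * n\<close>. The
  averages over the gaps give resolvents at \<open>p\<close> and \<open>q\<close>, which are
  comparable since \<open>q \<le> 2 * p\<close>; the size of \<open>n\<close> makes
  \<open>geometric_average_lower\<close> valid up to frequency \<open>2 * L\<close>.\<close>

lemma second_moment_lower:
  assumes L: "2 \<le> L" and e: "e = 1 / L\<^sup>2" and n: "1 + levy_exponent a c (2 * L) \<le> real n"
  shows "exp (- (5/2)) * gap_const / 51200 * truncated_variance L \<le>
      expectation (\<lambda>\<omega>. (grid_silt e (8 * n) \<omega>)\<^sup>2)"
proof -
  let ?N = "8 * n"
  have e0: "0 < e" using L e by simp
  have n0: "0 < n" using n levy_exponent_nonneg[of c a "2 * L"] c0 by (cases n) auto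
  then have N0: "0 < ?N" by simp
  interpret W: walk M "inc ?N" ?N a c e by (intro walk_inc e0 N0)
  define h where "h t = expectation (\<lambda>\<omega>. delta_deriv e (W.step_sum \<omega> (fst t)) *
      delta_deriv e (W.step_sum \<omega> (snd t)))" for t
  have tri: "W.pairs 0 = triangle ?N" by (auto simp: W.pairs_def)
  have "expectation (\<lambda>\<omega>. (grid_silt e ?N \<omega>)\<^sup>2) =
      expectation (\<lambda>\<omega>. ((\<Sum>t\<in>W.pairs 0. delta_deriv e (W.step_sum \<omega> t)) / real ?N ^ 2)\<^sup>2)"
    unfolding grid_silt_def tri using step_sum_inc[OF N0 e0] by simp
  also have "\<dots> = 1 / real ?N ^ 4 * (\<Sum>t\<in>W.pairs 0 \<times> W.pairs 0. h t)"
    unfolding W.second_moment_expand h_def ..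
  finally have eq: "expectation (\<lambda>\<omega>. (grid_silt e ?N \<omega>)\<^sup>2) =
      1 / real ?N ^ 4 * (\<Sum>t\<in>W.pairs 0 \<times> W.pairs 0. h t)" .
  define S where "S = {1..2*n} \<times> {2*n..4*n} \<times> {1..n} \<times> {1..n}"
  define \<phi> :: "nat \<times> nat \<times> nat \<times> nat \<Rightarrow> (nat \<times> nat) \<times> (nat \<times> nat)" where
    "\<phi> = (\<lambda>(s, B, A, C). ((s, s + A + B), (s + A, s + A + B + C)))"
  define Gz where "Gz A C = (\<integral>z. region L z * exp (- (real A / ?N * levy_exponent a c (fst z) +
      real C / ?N * levy_exponent a c (snd z))) \<partial>plane)" for A C :: nat
  let ?k = "exp (- (5/2)) * gap_const / 2"
  have E1: "\<bar>exp (- (A * levy_exponent a c (fst z) + C * levy_exponent a c (snd z)))\<bar> \<le> 1"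
      if "0 \<le> A" "0 \<le> C" for z and A C :: real
  proof -
    have "0 \<le> A * levy_exponent a c (fst z) + C * levy_exponent a c (snd z)"
      using that levy_exponent_nonneg[of c a] c0
      by (intro add_nonneg_nonneg mult_nonneg_nonneg) auto
    then show ?thesis by (simp only: abs_exp_cancel exp_le_one_iff neg_le_0_iff_le)
  qed
  have Gint: "integrable plane (\<lambda>z. region L z * exp (- (real A / ?N * levy_exponent a c (fst z) +
      real C / ?N * levy_exponent a c (snd z))))" for A C
    by (intro integrable_region L E1) auto
  have G0: "0 \<le> Gz A C" for A C unfolding Gz_def
    by (intro Bochner_Integration.integral_nonneg mult_nonneg_nonneg region_nonneg) auto
  have "(\<Sum>(s,B,A,C)\<in>S. ?k * Gz A C) \<le> (\<Sum>t\<in>S. h (\<phi> t))"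
  proof (rule sum_mono)
    fix t assume t': "t \<in> S"
    obtain s B A C where t: "t = (s, B, A, C)" by (metis prod.exhaust)
    have r: "1 \<le> s" "2 * n \<le> B" "B \<le> 4 * n" "1 \<le> A" "1 \<le> C" using t' unfolding S_def t by auto
    have sets: "{s..<s + A + B} - {s + A..<s + A + B + C} = {s..<s + A}"
      "{s..<s + A + B} \<inter> {s + A..<s + A + B + C} = {s + A..<s + A + B}"
      "{s + A..<s + A + B + C} - {s..<s + A + B} = {s + A + B..<s + A + B + C}" by auto
    have "h (\<phi> t) = kernel_cov a c e (real A / ?N) (real B / ?N) (real C / ?N)"
      unfolding h_def W.expectation_delta_deriv_kernel_cov unfolding \<phi>_def t by (simp add: sets)
    moreover have "Gz A C * ?k \<le> kernel_cov a c e (real A / ?N) (real B / ?N) (real C / ?N)"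
      unfolding Gz_def using r n0 by (intro kernel_cov_lower L e) (auto simp: field_simps)
    ultimately show "(case t of (s,B,A,C) \<Rightarrow> ?k * Gz A C) \<le> h (\<phi> t)" by (simp add: t mult.commute)
  qed
  also have "\<dots> \<le> (\<Sum>t\<in>W.pairs 0 \<times> W.pairs 0. h t)"
  proof (rule sum_inj_le)
    show "inj_on \<phi> S" by (auto simp: inj_on_def \<phi>_def)
    show "\<phi> ` S \<subseteq> W.pairs 0 \<times> W.pairs 0" unfolding S_def \<phi>_def W.pairs_def by auto
    show "0 \<le> h t" for t unfolding h_def by (rule W.expectation_delta_deriv_delta_deriv_nonneg)
  qed simp
  finally have low: "(\<Sum>(s,B,A,C)\<in>S. ?k * Gz A C) \<le> (\<Sum>t\<in>W.pairs 0 \<times> W.pairs 0. h t)" .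
  have "(\<Sum>(s,B,A,C)\<in>S. ?k * Gz A C) = real (2 * n) * (real (2 * n + 1) * (\<Sum>A=1..n. \<Sum>C=1..n. ?k *
      Gz A C))"
    unfolding S_def by (simp add: sum.cartesian_product' n0)
  also have "\<dots> \<ge> real (2 * n) * (real (2 * n) * (\<Sum>A=1..n. \<Sum>C=1..n. ?k * Gz A C))"
    using G0 gap_const by (intro mult_left_mono mult_right_mono sum_nonneg) auto
  finally have low2: "real (2 * n) * (real (2 * n) * (\<Sum>A=1..n. \<Sum>C=1..n. ?k * Gz A C)) \<le>
      (\<Sum>t\<in>W.pairs 0 \<times> W.pairs 0. h t)"
    using low by linarith
  \<comment> \<open>\<open>1600 = 20 * 20 * 4\<close>, from two uses of
    \<open>geometric_average_lower\<close> and one of \<open>resolvent_half\<close>.\<close>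
  have "real ?N ^ 2 / 1600 * truncated_variance L = (\<integral>z. region L z * (resolvent a c (fst z))\<^sup>2 *
      (real ?N ^ 2 / 1600) \<partial>plane)"
    unfolding region_integral[OF L, symmetric] by simp
  also have "\<dots> \<le> (\<integral>z. (\<Sum>A=1..n. \<Sum>C=1..n. region L z *
      exp (- (real A / ?N * levy_exponent a c (fst z) + real C / ?N *
      levy_exponent a c (snd z)))) \<partial>plane)"
  proof (rule integral_mono)
    have "\<bar>(resolvent a c (fst z))\<^sup>2\<bar> \<le> 1" for z :: "real \<times> real"
      using resolvent_pos[of c a "fst z"] resolvent_le1[of c a "fst z"] c0
      by (simp add: power_le_one)
    then show "integrable plane (\<lambda>z. region L z * (resolvent a c (fst z))\<^sup>2 * (real ?N ^ 2 / 1600))"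
      by (intro integrable_mult_left integrable_region L) auto
    show "integrable plane (\<lambda>z. \<Sum>A=1..n. \<Sum>C=1..n. region L z *
        exp (- (real A / ?N * levy_exponent a c (fst z) + real C / ?N *
        levy_exponent a c (snd z))))"
      by (intro Bochner_Integration.integrable_sum Gint)
    fix z :: "real \<times> real"
    obtain p q where pq: "z = (p, q)" by (cases z)
    show "region L z * (resolvent a c (fst z))\<^sup>2 * (real ?N ^ 2 / 1600) \<le>
        (\<Sum>A=1..n. \<Sum>C=1..n. region L z * exp (- (real A / ?N * levy_exponent a c (fst z) +
        real C / ?N * levy_exponent a c (snd z))))"
    proof (cases "region L z = 0")
      case False
      then have r: "2 \<le> p" "p \<le> L" "p \<le> q" "q \<le> p + 1"
        unfolding region_def pq by (auto simp: indicator_def split: if_splits)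
      have lp: "levy_exponent a c p \<le> levy_exponent a c (2 * L)" "levy_exponent a c q \<le>
          levy_exponent a c (2 * L)"
        using r c0 a1 by (intro levy_exponent_mono; simp)+
      have g: "resolvent a c x / 20 \<le> (\<Sum>k=1..n. exp (- (real k / ?N * levy_exponent a c x))) / ?N"
          if "levy_exponent a c x \<le> levy_exponent a c (2 * L)" for x
      proof -
        have "resolvent a c x / 20 = 1 / (20 * (1 + levy_exponent a c x))"
          by (simp add: resolvent_levy_exponent mult.commute)
        moreover have "1 / (20 * (1 + levy_exponent a c x)) \<le>
            (\<Sum>k=1..n. exp (- (real k / ?N * levy_exponent a c x))) / ?N"
          using that n levy_exponent_nonneg[of c a x] c0 by (intro geometric_average_lower) auto
        ultimately show ?thesis by (simp only:)
      qed
      have "resolvent a c p \<le> 4 * resolvent a c (2 * p)"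
        using resolvent_half[of c a "2 * p"] c0 a1 a2 by simp
      also have "\<dots> \<le> 4 * resolvent a c q"
        using r c0 a1 by (intro mult_left_mono resolvent_antimono) auto
      finally have rq: "resolvent a c p / 4 \<le> resolvent a c q" by simp
      have rp: "0 < resolvent a c p" using c0 by (intro resolvent_pos) auto
      have "(resolvent a c p)\<^sup>2 / 1600 = (resolvent a c p / 20) * (resolvent a c p / 4 / 20)"
        by (simp add: power2_eq_square)
      also have "\<dots> \<le> ((\<Sum>k=1..n. exp (- (real k / ?N * levy_exponent a c p))) / ?N) *
          ((\<Sum>k=1..n. exp (- (real k / ?N * levy_exponent a c q))) / ?N)"
      proof (intro mult_mono g lp)
        have "resolvent a c p / 4 / 20 \<le> resolvent a c q / 20" using rq by simp
        then show "resolvent a c p / 4 / 20 \<le> (\<Sum>k=1..n. exp (- (real k / ?N * levy_exponent a c q)))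
            / ?N"
          using g[OF lp(2)] by linarith
      qed (use rp in \<open>auto intro!: divide_nonneg_nonneg sum_nonneg\<close>)
      finally have "(resolvent a c p)\<^sup>2 / 1600 * real ?N ^ 2 \<le>
          ((\<Sum>k=1..n. exp (- (real k / ?N * levy_exponent a c p))) / ?N) *
          ((\<Sum>k=1..n. exp (- (real k / ?N * levy_exponent a c q))) / ?N) * real ?N ^ 2"
        by (intro mult_right_mono) auto
      also have "\<dots> = (\<Sum>k=1..n. exp (- (real k / ?N * levy_exponent a c p))) *
          (\<Sum>k=1..n. exp (- (real k / ?N * levy_exponent a c q)))"
        using n0 by (simp add: power2_eq_square)
      also have "\<dots> = (\<Sum>A=1..n. \<Sum>C=1..n. exp (- (real A / ?N * levy_exponent a c p + real C / ?N *
          levy_exponent a c q)))"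
        unfolding sum_product minus_add_distrib exp_add ..
      finally have "region L z * ((resolvent a c p)\<^sup>2 / 1600 * real ?N ^ 2) \<le>
          region L z * (\<Sum>A=1..n. \<Sum>C=1..n. exp (- (real A / ?N * levy_exponent a c p + real C / ?N *
          levy_exponent a c q)))"
        by (intro mult_left_mono region_nonneg)
      then show ?thesis unfolding sum_distrib_left pq by (simp add: mult_ac)
    qed simp
  qed
  also have "\<dots> = (\<Sum>A=1..n. \<Sum>C=1..n. Gz A C)"
    unfolding Gz_def using Gint by (simp only: Bochner_Integration.integral_sum
        Bochner_Integration.integrable_sum)
  finally have low3: "real ?N ^ 2 / 1600 * truncated_variance L \<le> (\<Sum>A=1..n. \<Sum>C=1..n. Gz A C)" .
  have "real (2 * n) * (real (2 * n) * (?k * (real ?N ^ 2 / 1600 * truncated_variance L))) \<le>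
      real (2 * n) * (real (2 * n) * (?k * (\<Sum>A=1..n. \<Sum>C=1..n. Gz A C)))"
    using low3 gap_const by (intro mult_left_mono) auto
  also have "\<dots> = real (2 * n) * (real (2 * n) * (\<Sum>A=1..n. \<Sum>C=1..n. ?k * Gz A C))"
    by (simp only: sum_distrib_left)
  also note low2
  finally have "1 / real ?N ^ 4 * (real (2 * n) * (real (2 * n) *
      (?k * (real ?N ^ 2 / 1600 * truncated_variance L)))) \<le> expectation (\<lambda>\<omega>. (grid_silt e ?N \<omega>)\<^sup>2)"
    unfolding eq by (intro mult_left_mono) auto
  \<comment> \<open>The powers of \<open>n\<close> reduce to 1/16, and
    \<open>16 * 1600 * 2 = 51200\<close>.\<close>
  also have "1 / real ?N ^ 4 * (real (2 * n) * (real (2 * n) *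
      (?k * (real ?N ^ 2 / 1600 * truncated_variance L)))) = exp (- (5/2)) * gap_const / 51200 *
      truncated_variance L"
    using n0 by (simp add: field_simps power_numeral_reduce)
  finally show ?thesis .
qed

text \<open>For fixed \<open>e\<close> the grid sums are bounded by
  \<open>freq_kernel_norm e\<close>, so second moments converge; the subsequence of grid sizes
  divisible by 8 suffices.\<close>

lemma silt_second_moment_lower:
  assumes L: "2 \<le> L" and e: "e = 1 / L\<^sup>2"
  shows "exp (- (5/2)) * gap_const / 51200 * truncated_variance L \<le>
      expectation (\<lambda>\<omega>. (path_silt e \<omega>)\<^sup>2)"
proof -
  have e0: "0 < e" using L e by simp
  have [measurable]: "path_silt e \<in> borel_measurable M" "grid_silt e n \<in> borel_measurable M" for n
    using e0 by (auto intro: path_silt_measurable)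
  have sub: "(\<lambda>n. grid_silt e (8 * Suc n) \<omega>) \<longlonglongrightarrow> path_silt e \<omega>" if "\<omega> \<in> space M" for \<omega>
  proof -
    have "strict_mono (\<lambda>n::nat. 8 * n + 7)" by (simp add: strict_mono_def)
    from LIMSEQ_subseq_LIMSEQ[OF grid_silt_limit[OF e0 that] this] show ?thesis by (simp add: o_def)
  qed
  have "(\<lambda>n. expectation (\<lambda>\<omega>. (grid_silt e (8 * Suc n) \<omega>)\<^sup>2)) \<longlonglongrightarrow> expectation (\<lambda>\<omega>. (path_silt e \<omega>)\<^sup>2)"
  proof (rule integral_dominated_convergence[where w = "\<lambda>_. (freq_kernel_norm e)\<^sup>2"])
    show "AE \<omega> in M. (\<lambda>n. (grid_silt e (8 * Suc n) \<omega>)\<^sup>2) \<longlonglongrightarrow> (path_silt e \<omega>)\<^sup>2"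
      by (intro AE_I2 tendsto_power sub)
    show "AE \<omega> in M. norm ((grid_silt e (8 * Suc n) \<omega>)\<^sup>2) \<le> (freq_kernel_norm e)\<^sup>2" for n
      using grid_silt_bound[OF e0, of "8 * Suc n"] power_mono[of "\<bar>grid_silt e (8 * Suc n) _\<bar>"
          "freq_kernel_norm e" 2] by (intro AE_I2) simp
  qed auto
  moreover obtain n0 where n0: "1 + levy_exponent a c (2 * L) \<le> real n0"
    using real_arch_simple by blast
  have "\<forall>n\<ge>n0. exp (- (5/2)) * gap_const / 51200 * truncated_variance L \<le>
      expectation (\<lambda>\<omega>. (grid_silt e (8 * Suc n) \<omega>)\<^sup>2)"
  proof (intro allI impI second_moment_lower L e)
    fix n assume "n0 \<le> n"
    then have "real n0 \<le> real (Suc n)" by simp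
    then show "1 + levy_exponent a c (2 * L) \<le> real (Suc n)" using n0 by linarith
  qed
  ultimately show ?thesis by (intro LIMSEQ_le_const) auto
qed

section \<open>Comparison of the truncated with the Gaussian variance, and its divergence\<close>

lemma truncated_variance_integrable: "integrable lborel (\<lambda>p. indicator {2..L} p *
    (p\<^sup>2 * (resolvent a c p)\<^sup>2))"
proof (rule Bochner_Integration.integrable_bound)
  show "integrable lborel (\<lambda>p. L\<^sup>2 * indicator {2..L} p)"
    by (intro integrable_mult_right integrable_indicator_Icc)
  show "AE p in lborel. norm (indicator {2..L} p * (p\<^sup>2 * (resolvent a c p)\<^sup>2)) \<le>
      norm (L\<^sup>2 * indicator {2..L} p)"
  proof (rule AE_I2)
    fix p :: real
    have "p\<^sup>2 * (resolvent a c p)\<^sup>2 \<le> L\<^sup>2 * 1" if "p \<in> {2..L}"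
      using that resolvent_pos[of c a p] resolvent_le1[of c a p] c0
      by (intro mult_mono power_mono) (auto simp: power_le_one)
    then show "norm (indicator {2..L} p * (p\<^sup>2 * (resolvent a c p)\<^sup>2)) \<le>
        norm (L\<^sup>2 * indicator {2..L} p)"
      by (auto simp: indicator_def)
  qed
qed measurable

lemma resolvent_lower: assumes "1 \<le> p" shows "p powr (- a) / (1 + c) \<le> resolvent a c p"
proof -
  have "1 \<le> p powr a" using assms a1 by (intro ge_one_powr_ge_zero) auto
  then have "1 + c * p powr a \<le> (1 + c) * p powr a" using c0 by (simp add: algebra_simps)
  then have "1 / ((1 + c) * p powr a) \<le> 1 / (1 + c * p powr a)"
    using c0 by (intro divide_left_mono mult_pos_pos add_pos_nonneg) auto
  then show ?thesis using assms by (simp add: resolvent_def powr_minus field_simps)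
qed

text \<open>The block from \<open>L / 2\<close> to \<open>L\<close> already has this size; it serves
  to absorb the frequencies beyond the cut-off.\<close>

lemma truncated_variance_lower_scale:
  assumes L: "4 \<le> L"
  shows "L powr (3 - 2 * a) / (8 * (1 + c)\<^sup>2) \<le> truncated_variance L"
proof -
  have "(LBINT p. (L\<^sup>2 / 4 * (resolvent a c L)\<^sup>2) * indicator {L/2..L} p) \<le> truncated_variance L"
    unfolding truncated_variance_def
  proof (intro integral_mono truncated_variance_integrable integrable_mult_right
      integrable_indicator_Icc)
    fix p :: real
    have "L\<^sup>2 / 4 * (resolvent a c L)\<^sup>2 \<le> p\<^sup>2 * (resolvent a c p)\<^sup>2" if "L / 2 \<le> p" "p \<le> L"
    proof (intro mult_mono power_mono resolvent_antimono)
      show "L\<^sup>2 / 4 \<le> p\<^sup>2" using power_mono[of "L/2" p 2] that L by (simp add: power_divide)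
    qed (use that L c0 a1 resolvent_pos[of c a L] in auto)
    then show "(L\<^sup>2 / 4 * (resolvent a c L)\<^sup>2) * indicator {L/2..L} p \<le>
        indicator {2..L} p * (p\<^sup>2 * (resolvent a c p)\<^sup>2)"
      using L by (auto simp: indicator_def)
  qed
  then have 1: "L\<^sup>2 / 4 * (resolvent a c L)\<^sup>2 * (L / 2) \<le> truncated_variance L" using L by simp
  have "L powr (3 - 2 * a) / (8 * (1 + c)\<^sup>2) = L\<^sup>2 / 4 * (L powr (- a) / (1 + c))\<^sup>2 * (L / 2)"
  proof -
    have "L powr (3 - 2 * a) = L powr 3 * (L powr (- a) * L powr (- a))" by (simp flip: powr_add)
    also have "L powr 3 = L * L * L" using L by (simp add: powr_numeral power3_eq_cube)
    finally show ?thesis by (simp add: power2_eq_square)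
  qed
  also have "\<dots> \<le> L\<^sup>2 / 4 * (resolvent a c L)\<^sup>2 * (L / 2)"
    using L c0 by (intro mult_right_mono mult_left_mono power_mono resolvent_lower) auto
  finally show ?thesis using 1 by simp
qed

text \<open>Frequencies up to 2 contribute at most 16. Beyond \<open>L\<close> the squared kernel
  weight is at most \<open>L powr (2 - 2 * a) / c\<^sup>2\<close> and the Gaussian has mass at most
  \<open>3 * L\<close>, so that part is a multiple of \<open>L powr (3 - 2 * a)\<close> and hence of
  \<open>truncated_variance L\<close>. Thus the lower bound on the second moment matches the tail
  scale up to constants.\<close>

lemma variance_scale_le_truncated_variance:
  assumes L: "4 \<le> L" and e: "e = 1 / L\<^sup>2"
  shows "variance_scale a c e \<le> 16 + (2 + 24 * (1 + c)\<^sup>2 / c\<^sup>2) * truncated_variance L"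
proof -
  have e0: "0 < e" using L e by simp
  let ?f = "\<lambda>p. indicator {2..L} p * (p\<^sup>2 * (resolvent a c p)\<^sup>2)"
  let ?g = "\<lambda>p::real. exp (- (e * p\<^sup>2 / 2))"
  let ?k = "L powr (2 - 2 * a) / c\<^sup>2"
  have gi: "integrable lborel ?g" using integrable_gauss_moment[OF e0, of 0] by simp
  have fm: "integrable lborel (\<lambda>p. ?f (- p))"
    using lborel_integrable_real_affine[OF truncated_variance_integrable[of L], of "-1" 0] by simp
  have "variance_scale a c e \<le> (LBINT p. 4 * indicator {-2..2} p + (?f p + ?f (- p)) + ?k * ?g p)"
    unfolding variance_scale_def
  proof (intro integral_mono integrable_variance_scale e0 Bochner_Integration.integrable_add
      integrable_mult_right integrable_indicator_Icc gi truncated_variance_integrable fm)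
    fix p :: real
    have delta_deriv: "0 \<le> ?f p" for p by simp
    have k0: "0 \<le> ?k * ?g p" by simp
    have i0: "0 \<le> (4 * indicator {-2..2} p :: real)" by simp
    have r1: "(resolvent a c p)\<^sup>2 \<le> 1" using resolvent_pos[of c a p] resolvent_le1[of c a p] c0
      by (simp add: power_le_one)
    have g1: "?g p \<le> 1" using e0 by simp
    consider "\<bar>p\<bar> \<le> 2" | "2 < \<bar>p\<bar>" "\<bar>p\<bar> \<le> L" | "L < \<bar>p\<bar>" by linarith
    then show "p\<^sup>2 * ?g p * (resolvent a c p)\<^sup>2 \<le> 4 * indicator {-2..2} p + (?f p + ?f (- p)) + ?k *
        ?g p"
    proof cases
      case 1
      have "p\<^sup>2 \<le> 4" using 1 abs_le_square_iff[of p 2] by simp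
      then have "p\<^sup>2 * ?g p * (resolvent a c p)\<^sup>2 \<le> 4 * 1 * 1" using r1 g1 by (intro mult_mono) auto
      moreover have "4 * indicator {-2..2} p = (4::real)"
        using 1 by (auto simp: indicator_def abs_le_iff)
      ultimately show ?thesis using delta_deriv[of p] delta_deriv[of "-p"] k0 by linarith
    next
      case 2
      have "p\<^sup>2 * ?g p * (resolvent a c p)\<^sup>2 \<le> p\<^sup>2 * 1 * (resolvent a c p)\<^sup>2"
        using g1 by (intro mult_right_mono mult_left_mono) auto
      moreover have "p\<^sup>2 * 1 * (resolvent a c p)\<^sup>2 \<le> ?f p + ?f (- p)"
        using 2 by (auto simp: indicator_def abs_if split: if_splits)
      ultimately show ?thesis using i0 k0 by linarith
    next
      case 3
      have p0: "p \<noteq> 0" "0 < \<bar>p\<bar>" using 3 L by auto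
      have "(resolvent a c p)\<^sup>2 \<le> (\<bar>p\<bar> powr (- a) / c)\<^sup>2"
        using resolvent_pos[of c a p] c0 p0 by (intro power_mono resolvent_le_powr) auto
      then have "p\<^sup>2 * (resolvent a c p)\<^sup>2 \<le> p\<^sup>2 * (\<bar>p\<bar> powr (- a) / c)\<^sup>2"
        by (intro mult_left_mono) auto
      also have "\<dots> = \<bar>p\<bar> powr (2 - 2 * a) / c\<^sup>2"
      proof -
        have "p\<^sup>2 * \<bar>p\<bar> powr (- (2 * a)) = \<bar>p\<bar> powr (2 - 2 * a)"
          using p0 by (simp add: powr_diff powr_minus divide_inverse)
        moreover have "(\<bar>p\<bar> powr (- a))\<^sup>2 = \<bar>p\<bar> powr (- (2 * a))"
          by (simp add: power2_eq_square flip: powr_add)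
        ultimately show ?thesis by (simp add: power_divide)
      qed
      also have "\<dots> \<le> ?k" using 3 L a1 by (intro divide_right_mono powr_mono2') auto
      finally have "p\<^sup>2 * (resolvent a c p)\<^sup>2 * ?g p \<le> ?k * ?g p" by (intro mult_right_mono) auto
      then have "p\<^sup>2 * ?g p * (resolvent a c p)\<^sup>2 \<le> ?k * ?g p" by (simp add: mult_ac)
      then show ?thesis using delta_deriv[of p] delta_deriv[of "-p"] i0 by linarith
    qed
  qed (use c0 in auto)
  also have "\<dots> = 16 + 2 * truncated_variance L + ?k * (LBINT p. ?g p)"
  proof -
    have "(LBINT p. ?f (- p)) = truncated_variance L"
      unfolding truncated_variance_def using lborel_integral_real_affine[of "-1" ?f 0] by simp
    moreover have "(LBINT p. 4 * indicator {-2..2::real} p) = (16::real)" by simp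
    ultimately show ?thesis
      using truncated_variance_integrable[of L] fm gi integrable_indicator_Icc[of "-2" 2]
      by (simp add: truncated_variance_def del: integral_indicator)
  qed
  finally have VE: "variance_scale a c e \<le> 16 + 2 * truncated_variance L + ?k * (LBINT p. ?g p)" .
  have "(LBINT p. ?g p) \<le> 3 * L"
  proof -
    have "?g p = sqrt (2 * pi * L\<^sup>2) * normal_density 0 L p" for p
      using L unfolding e normal_density_def by (simp add: field_simps)
    then have "(LBINT p. ?g p) = sqrt (2 * pi * L\<^sup>2)"
      using L integral_normal_density[of L 0] by simp
    also have "\<dots> \<le> 3 * L"
      using L pi_less_4 by (intro real_le_lsqrt) (auto simp: power_mult_distrib)
    finally show ?thesis .
  qed
  then have "?k * (LBINT p. ?g p) \<le> ?k * (3 * L)" by (intro mult_left_mono) auto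
  moreover have "16 + 2 * truncated_variance L + ?k * (3 * L) \<le> 16 + (2 + 24 * (1 + c)\<^sup>2 / c\<^sup>2) *
      truncated_variance L"
  proof -
    have "L powr (2 - 2 * a) * L = L powr (3 - 2 * a)" using L powr_add[of L "2 - 2 * a" 1] by simp
    also have "\<dots> \<le> 8 * (1 + c)\<^sup>2 * truncated_variance L"
      using truncated_variance_lower_scale[OF L] c0 by (simp add: divide_le_eq mult.commute)
    finally have "3 / c\<^sup>2 * (L powr (2 - 2 * a) * L) \<le>
        3 / c\<^sup>2 * (8 * (1 + c)\<^sup>2 * truncated_variance L)"
      by (intro mult_left_mono) auto
    then show ?thesis by (simp add: algebra_simps)
  qed
  ultimately show ?thesis using VE by linarith
qed

text \<open>For \<open>a \<le> 3/2\<close> the integrand decays no faster than a multiple of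
  \<open>1 / p\<close>; the critical index is the one that produces the logarithm.\<close>

lemma truncated_variance_log_lower:
  assumes L: "2 \<le> L" and a: "a \<le> 3/2"
  shows "(ln L - ln 2) / (1 + c)\<^sup>2 \<le> truncated_variance L"
proof -
  have inv: "set_integrable lborel {2..L} (\<lambda>p. 1 / p)"
    by (rule borel_integrable_atLeastAtMost') (auto intro!: continuous_intros)
  have "(LBINT p. (1 / p) * indicator {2..L} p) = ln L - ln 2"
    by (rule integral_FTC_Icc_real) (use L in \<open>auto intro!: derivative_eq_intros continuous_intros\<close>)
  then have "(LBINT p. indicator {2..L} p * (1 / p)) = ln L - ln 2" by (simp only: mult.commute)
  then have "(ln L - ln 2) / (1 + c)\<^sup>2 = (LBINT p. (indicator {2..L} p * (1 / p)) / (1 + c)\<^sup>2)"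
    by (simp only: integral_divide_zero)
  also have "\<dots> \<le> truncated_variance L"
    unfolding truncated_variance_def
  proof (intro integral_mono truncated_variance_integrable integrable_divide)
    show "integrable lborel (\<lambda>p. indicator {2..L} p * (1 / p))"
      using inv by (simp add: set_integrable_def)
    fix p :: real
    have "1 / p / (1 + c)\<^sup>2 \<le> p\<^sup>2 * (resolvent a c p)\<^sup>2" if p: "2 \<le> p"
    proof -
      have "p powr (- 1) \<le> p powr (2 - 2 * a)" using p a by (intro powr_mono) auto
      then have "1 / p / (1 + c)\<^sup>2 \<le> p powr (2 - 2 * a) / (1 + c)\<^sup>2"
        using p by (intro divide_right_mono) (auto simp: powr_minus divide_inverse)
      also have "\<dots> = p\<^sup>2 * (p powr (- a) / (1 + c))\<^sup>2"
      proof -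
        have "p\<^sup>2 * p powr (- (2 * a)) = p powr (2 - 2 * a)"
          using p by (simp add: powr_diff powr_minus divide_inverse)
        moreover have "(p powr (- a))\<^sup>2 = p powr (- (2 * a))"
          by (simp add: power2_eq_square flip: powr_add)
        ultimately show ?thesis by (simp add: power_divide)
      qed
      also have "\<dots> \<le> p\<^sup>2 * (resolvent a c p)\<^sup>2"
        using p c0 by (intro mult_left_mono power_mono resolvent_lower) auto
      finally show ?thesis .
    qed
    then show "indicator {2..L} p * (1 / p) / (1 + c)\<^sup>2 \<le>
        indicator {2..L} p * (p\<^sup>2 * (resolvent a c p)\<^sup>2)"
      by (auto simp: indicator_def)
  qed
  finally show ?thesis .
qed

section \<open>Failure of tightness\<close>

lemma exists_small_tail:
  assumes [measurable]: "f \<in> borel_measurable M" and d: "0 < d"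
  shows "\<exists>m::nat. prob {\<omega>\<in>space M. real m < cmod (f \<omega>)} < d"
proof -
  let ?A = "\<lambda>m::nat. {\<omega>\<in>space M. real m < cmod (f \<omega>)}"
  have "(\<lambda>m. prob (?A m)) \<longlonglongrightarrow> prob (\<Inter>m. ?A m)"
    by (rule finite_Lim_measure_decseq) (auto simp: decseq_def)
  moreover have "(\<Inter>m. ?A m) = {}"
  proof (rule equals0I)
    fix \<omega> assume w: "\<omega> \<in> (\<Inter>m. ?A m)"
    obtain m :: nat where "cmod (f \<omega>) \<le> real m" using real_arch_simple by blast
    moreover have "\<omega> \<in> ?A m" using w by blast
    ultimately show False by simp
  qed
  ultimately have "(\<lambda>m. prob (?A m)) \<longlonglongrightarrow> 0" by simp
  then have "eventually (\<lambda>m. prob (?A m) < d) sequentially" using d by (rule order_tendstoD(2))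
  then show ?thesis by (rule eventually_happens'[OF sequentially_bot])
qed

lemma exp_moment_const_pos: "0 < exp_moment_const"
proof -
  have "0 \<le> (\<Sum>l. exp ((real l + 1) / 4) * (2 * (1/2) ^ l))" 
    by (intro suminf_nonneg exp_moment_of_tail(2)[of "\<lambda>_. 0"]) auto
  then show ?thesis unfolding exp_moment_const_def by (intro add_pos_nonneg) auto
qed

text \<open>With \<open>y = sqrt Y\<close> for the normalised variable \<open>Y\<close>, the eighth
  power of \<open>y / 32 \<le> exp (y / 32)\<close> bounds \<open>Y ^ 4\<close> by
  \<open>32 ^ 8 * exp (y / 4)\<close>, whose expectation is bounded uniformly in
  \<open>e\<close>.\<close>

lemma silt_fourth_moment:
  assumes e: "0 < e"
  shows "expectation (\<lambda>\<omega>. (\<bar>path_silt e \<omega>\<bar> / (tail_const * sqrt (variance_scale a c e))) ^ 4) \<le>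
      32 ^ 8 * exp_moment_const"
    and "integrable M (\<lambda>\<omega>. (\<bar>path_silt e \<omega>\<bar> / (tail_const * sqrt (variance_scale a c e))) ^ k)"
proof -
  let ?Y = "\<lambda>\<omega>. \<bar>path_silt e \<omega>\<bar> / (tail_const * sqrt (variance_scale a c e))"
  have b: "0 < tail_const * sqrt (variance_scale a c e)"
    using tail_const_pos variance_scale_pos'[OF e] by simp
  have [measurable]: "path_silt e \<in> borel_measurable M" using e by (rule path_silt_measurable)
  have Zb: "\<bar>path_silt e \<omega>\<bar> \<le> freq_kernel_norm e" if "\<omega> \<in> space M" for \<omega>
    using grid_silt_bound[OF e] by (intro LIMSEQ_le_const2[OF tendsto_rabs[OF grid_silt_limit[OF e
        that]]]) auto
  show int: "integrable M (\<lambda>\<omega>. ?Y \<omega> ^ k)" for k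
    using b Zb by (intro integrable_const_bound[where B =
        "(freq_kernel_norm e / (tail_const * sqrt (variance_scale a c e))) ^ k"] AE_I2)
      (auto simp: power_abs abs_divide intro!: power_mono divide_right_mono)
  have le: "?Y \<omega> ^ 4 \<le> 32 ^ 8 * exp (sqrt (?Y \<omega>) / 4)" for \<omega>
  proof -
    define y where "y = sqrt (?Y \<omega>)"
    have Y0: "0 \<le> ?Y \<omega>" using b by simp
    have y: "0 \<le> y" "?Y \<omega> = y\<^sup>2" using b by (auto simp: y_def real_sqrt_pow2[OF Y0])
    have "y / 32 \<le> exp (y / 32)" using exp_ge_add_one_self[of "y / 32"] by linarith
    then have "(y / 32) ^ 8 \<le> exp (y / 32) ^ 8" using y by (intro power_mono) auto
    also have "\<dots> = exp (y / 4)" by (simp flip: exp_of_nat_mult)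
    finally have "y ^ 8 \<le> 32 ^ 8 * exp (y / 4)"
      by (simp add: power_divide divide_le_eq mult.commute)
    moreover have "?Y \<omega> ^ 4 = y ^ 8" unfolding y(2) by (simp flip: power_mult)
    ultimately show ?thesis by (simp only: y_def)
  qed
  have "ennreal (expectation (\<lambda>\<omega>. ?Y \<omega> ^ 4)) = (\<integral>\<^sup>+\<omega>. ennreal (?Y \<omega> ^ 4) \<partial>M)"
    using int b by (intro nn_integral_eq_integral[symmetric]) auto
  also have "\<dots> \<le> (\<integral>\<^sup>+\<omega>. ennreal (32 ^ 8) * ennreal (exp (sqrt (?Y \<omega>) / 4)) \<partial>M)"
    using le by (intro nn_integral_mono) (simp only: ennreal_mult'[symmetric] zero_le_numeral
        zero_le_power ennreal_leI)
  also have "\<dots> = ennreal (32 ^ 8) * (\<integral>\<^sup>+\<omega>. ennreal (exp (sqrt (?Y \<omega>) / 4)) \<partial>M)"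
    by (intro nn_integral_cmult) measurable
  also have "\<dots> \<le> ennreal (32 ^ 8) * ennreal exp_moment_const"
    by (intro mult_left_mono silt_exp_moment e) auto
  also have "\<dots> = ennreal (32 ^ 8 * exp_moment_const)" by (simp add: ennreal_mult')
  finally show "expectation (\<lambda>\<omega>. ?Y \<omega> ^ 4) \<le> 32 ^ 8 * exp_moment_const"
    using exp_moment_const_pos by (subst (asm) ennreal_le_iff) auto
qed

text \<open>A normalised variable with second moment at least \<open>\<eta>\<close> and bounded
  fourth moment cannot concentrate near 0. In place of the Cauchy-Schwarz inequality its pointwise
  form \<open>u \<le> s' / 2 * u\<^sup>2 + 1 / (2 * s')\<close> is applied on the event.\<close>

lemma paley_zygmund_silt:
  assumes e: "0 < e" and eta: "0 < \<eta>" and low: "\<eta> * (tail_const\<^sup>2 * variance_scale a c e) \<le>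
      expectation (\<lambda>\<omega>. (path_silt e \<omega>)\<^sup>2)"
  shows "\<eta>\<^sup>2 / (2 * (32 ^ 8 * exp_moment_const)) \<le> prob {\<omega>\<in>space M. sqrt (\<eta> / 4) *
      (tail_const * sqrt (variance_scale a c e)) < \<bar>path_silt e \<omega>\<bar>}"
proof -
  let ?b = "tail_const * sqrt (variance_scale a c e)"
  let ?Y = "\<lambda>\<omega>. \<bar>path_silt e \<omega>\<bar> / ?b"
  let ?K = "32 ^ 8 * exp_moment_const"
  have V: "0 < variance_scale a c e" using e by (rule variance_scale_pos')
  have b: "0 < ?b" using tail_const_pos V by simp
  have K: "0 < ?K" using exp_moment_const_pos by simp
  \<comment> \<open>Makes the fourth-moment term equal to \<open>\<eta> / 4\<close>; the part of the
    second moment off the event takes another quarter, and \<open>\<eta> / 2\<close> is left for the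
    probability.\<close>
  define s' where "s' = \<eta> / (2 * ?K)"
  have s': "0 < s'" using eta K by (simp add: s'_def)
  have [measurable]: "path_silt e \<in> borel_measurable M" using e by (rule path_silt_measurable)
  let ?A = "{\<omega>\<in>space M. sqrt (\<eta> / 4) * ?b < \<bar>path_silt e \<omega>\<bar>}"
  have iA: "integrable M (indicator ?A :: 'a \<Rightarrow> real)"
    by (intro integrable_real_indicator) (auto simp: less_top[symmetric])
  have sq: "(?Y \<omega>)\<^sup>2 = (path_silt e \<omega>)\<^sup>2 / (tail_const\<^sup>2 * variance_scale a c e)" for \<omega>
    using V by (simp add: power_divide power_mult_distrib)
  have "\<eta> \<le> expectation (\<lambda>\<omega>. (?Y \<omega>)\<^sup>2)"
    unfolding sq integral_divide_zero using low tail_const_pos V by (simp add: pos_le_divide_eq)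
  also have "\<dots> \<le> expectation (\<lambda>\<omega>. \<eta> / 4 + (s' / 2 * ?Y \<omega> ^ 4 + 1 / (2 * s') * indicator ?A \<omega>))"
  proof (intro integral_mono Bochner_Integration.integrable_add integrable_mult_right
      silt_fourth_moment(2) e)
    fix \<omega> assume w: "\<omega> \<in> space M"
    show "(?Y \<omega>)\<^sup>2 \<le> \<eta> / 4 + (s' / 2 * ?Y \<omega> ^ 4 + 1 / (2 * s') * indicator ?A \<omega>)"
    proof (cases "\<omega> \<in> ?A")
      case False
      then have "\<bar>path_silt e \<omega>\<bar> \<le> sqrt (\<eta> / 4) * ?b" using w by simp
      then have "?Y \<omega> \<le> sqrt (\<eta> / 4)" using b by (simp add: pos_divide_le_eq)
      then have "(?Y \<omega>)\<^sup>2 \<le> (sqrt (\<eta> / 4))\<^sup>2" using b by (intro power_mono) auto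
      also have "\<dots> = \<eta> / 4" using eta by simp
      finally have "(?Y \<omega>)\<^sup>2 \<le> \<eta> / 4" .
      moreover have "0 \<le> s' / 2 * ?Y \<omega> ^ 4" using s' by simp
      ultimately show ?thesis using False by simp
    next
      case True
      define u where "u = (?Y \<omega>)\<^sup>2"
      have "0 \<le> (s' * u - 1)\<^sup>2" by simp
      then have "2 * (s' * u) \<le> s'\<^sup>2 * u\<^sup>2 + 1" by (simp add: power2_diff power_mult_distrib)
      then have "2 * (s' * u) / (2 * s') \<le> (s'\<^sup>2 * u\<^sup>2 + 1) / (2 * s')"
        using s' by (intro divide_right_mono) auto
      then have "u \<le> s' / 2 * u\<^sup>2 + 1 / (2 * s')"
        using s' by (simp add: add_divide_distrib power2_eq_square)
      moreover have "u\<^sup>2 = ?Y \<omega> ^ 4" unfolding u_def by (simp only: power_mult[symmetric]) simp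
      ultimately have "(?Y \<omega>)\<^sup>2 \<le> s' / 2 * ?Y \<omega> ^ 4 + 1 / (2 * s')" unfolding u_def by simp
      then show ?thesis using True eta by simp
    qed
  qed (use iA in auto)
  also have "\<dots> = \<eta> / 4 + (s' / 2 * expectation (\<lambda>\<omega>. ?Y \<omega> ^ 4) + 1 / (2 * s') * prob ?A)"
  proof -
    have "expectation (\<lambda>\<omega>. s' / 2 * ?Y \<omega> ^ 4 + 1 / (2 * s') * indicator ?A \<omega>) =
      s' / 2 * expectation (\<lambda>\<omega>. ?Y \<omega> ^ 4) + 1 / (2 * s') * expectation (indicator ?A)"
    proof -
      have i4: "integrable M (\<lambda>\<omega>. s' / 2 * ?Y \<omega> ^ 4)"
        by (intro integrable_mult_right silt_fourth_moment(2) e)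
      have iB: "integrable M (\<lambda>\<omega>. 1 / (2 * s') * indicator ?A \<omega>)"
        by (intro integrable_mult_right iA)
      show ?thesis unfolding Bochner_Integration.integral_add[OF i4 iB] integral_mult_right_zero ..
    qed
    moreover have "expectation (indicator ?A) = prob ?A" by simp
    moreover have "expectation (\<lambda>\<omega>. \<eta> / 4 + (s' / 2 * ?Y \<omega> ^ 4 + 1 / (2 * s') * indicator ?A \<omega>)) =
      \<eta> / 4 + expectation (\<lambda>\<omega>. s' / 2 * ?Y \<omega> ^ 4 + 1 / (2 * s') * indicator ?A \<omega>)"
      by (subst Bochner_Integration.integral_add)
         (auto intro!: Bochner_Integration.integrable_add integrable_mult_right
             silt_fourth_moment(2) e iA simp: prob_space simp del: power_divide)
    ultimately show ?thesis by simp
  qed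
  also have "\<dots> \<le> \<eta> / 4 + (s' / 2 * ?K + 1 / (2 * s') * prob ?A)"
    using s' by (intro add_left_mono add_right_mono mult_left_mono silt_fourth_moment(1) e) auto
  also have "s' / 2 * ?K = \<eta> / 4" using K by (simp add: s'_def)
  finally have "\<eta> / 2 \<le> prob ?A / (2 * s')" by simp
  then have "\<eta> * s' \<le> prob ?A" using s' by (simp add: field_simps)
  then show ?thesis by (simp add: s'_def power2_eq_square)
qed

text \<open>In this range the limit that defines \<^const>\<open>is_dsilt\<close> does not exist.\<close>
lemma no_dsilt:
  assumes a32: "a \<le> 3/2" and dsilt: "is_dsilt M X \<theta>"
  shows False
proof -
  have [measurable]: "\<theta> \<in> borel_measurable M" using dsilt by (simp add: is_dsilt_def)
  define D where "D = 2 + 24 * (1 + c)\<^sup>2 / c\<^sup>2"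
  define \<kappa> where "\<kappa> = exp (- (5/2)) * gap_const / 51200"
  \<comment> \<open>The ratio of the lower bound on the second moment to the squared tail scale.
    Neither \<open>\<eta>\<close> nor the probability \<open>\<pi>0\<close> derived from it depends
    on \<open>e\<close>.\<close>
  define \<eta> where "\<eta> = \<kappa> / (tail_const\<^sup>2 * (16 + D))"
  define \<pi>0 where "\<pi>0 = \<eta>\<^sup>2 / (2 * (32 ^ 8 * exp_moment_const))"
  have D: "0 < D" unfolding D_def by (intro add_pos_nonneg divide_nonneg_nonneg) auto
  have \<kappa>: "0 < \<kappa>" using gap_const by (simp add: \<kappa>_def)
  have \<eta>: "0 < \<eta>" using \<kappa> D tail_const_pos by (simp add: \<eta>_def)
  have \<pi>0: "0 < \<pi>0" using \<eta> exp_moment_const_pos by (simp add: \<pi>0_def)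
  \<comment> \<open>With convergence in probability, this level keeps the approximations below
    \<open>m + 1\<close> outside an event of probability less than \<open>\<pi>0\<close>.\<close>
  obtain m :: nat where m: "prob {\<omega>\<in>space M. real m < cmod (\<theta> \<omega>)} < \<pi>0 / 2"
    using exists_small_tail[of \<theta> "\<pi>0 / 2"] \<pi>0 by auto
  \<comment> \<open>So large that \<open>H \<le> truncated_variance L\<close> lifts the
    Paley-Zygmund level above \<open>(m + 1) * (2 * pi)\<close>. The factor \<open>exp 1\<close>
    pays for the damping below \<open>L\<close>.\<close>
  define H where "H = max 1 (((real m + 1) * (2 * pi) / (sqrt (\<eta> / 4) * tail_const))\<^sup>2 * exp 1 + 1)"
  have "\<forall>\<delta>>0. ((\<lambda>e. prob {\<omega>\<in>space M. \<delta> < cmod (dsilt_approx X e \<omega> - \<theta> \<omega>)}) \<longlongrightarrow> 0) (at_right 0)"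
    using dsilt unfolding is_dsilt_def by (rule conjunct2)
  then have "((\<lambda>e. prob {\<omega>\<in>space M. 1 < cmod (dsilt_approx X e \<omega> - \<theta> \<omega>)}) \<longlongrightarrow> 0) (at_right 0)" by simp
  then have "eventually (\<lambda>e. prob {\<omega>\<in>space M. 1 < cmod (dsilt_approx X e \<omega> - \<theta> \<omega>)} < \<pi>0 / 2)
      (at_right 0)"
    using \<pi>0 by (intro order_tendstoD(2)) auto
  \<comment> \<open>Makes \<open>L = 1 / sqrt e\<close> so large that the logarithmic lower bound
    exceeds \<open>H\<close>.\<close>
  moreover define e1 where "e1 = 1 / (max 4 (2 * exp ((1 + c)\<^sup>2 * H)))\<^sup>2"
  have "0 < e1" by (simp add: e1_def)
  then have "eventually (\<lambda>e. e \<in> {0<..<e1}) (at_right (0::real))" by (rule eventually_at_right_real)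
  ultimately have "eventually (\<lambda>e. prob {\<omega>\<in>space M. 1 < cmod (dsilt_approx X e \<omega> - \<theta> \<omega>)} < \<pi>0 / 2 \<and>
      e \<in> {0<..<e1}) (at_right 0)"
    by (rule eventually_conj)
  then obtain e where e: "prob {\<omega>\<in>space M. 1 < cmod (dsilt_approx X e \<omega> - \<theta> \<omega>)} < \<pi>0 / 2" "0 < e"
      "e < e1"
    using eventually_happens'[OF trivial_limit_at_right_real]
    by (metis (no_types, lifting) greaterThanLessThan_iff)
  define L where "L = 1 / sqrt e"
  have eL: "e = 1 / L\<^sup>2" using e by (simp add: L_def power_divide)
  have "sqrt e < sqrt e1" using e by simp
  also have "sqrt e1 = 1 / max 4 (2 * exp ((1 + c)\<^sup>2 * H))"
    unfolding e1_def by (simp add: real_sqrt_divide)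
  finally have "sqrt e < 1 / max 4 (2 * exp ((1 + c)\<^sup>2 * H))" .
  then have "max 4 (2 * exp ((1 + c)\<^sup>2 * H)) < L"
  proof -
    have "x < 1 / y" if "y < 1 / x" "0 < x" "0 < y" for x y :: real
      using that by (simp add: pos_less_divide_eq mult.commute)
    from this[OF \<open>sqrt e < 1 / max 4 (2 * exp ((1 + c)\<^sup>2 * H))\<close>] show ?thesis
      using e by (simp only: L_def) simp
  qed
  then have L: "4 \<le> L" "2 * exp ((1 + c)\<^sup>2 * H) \<le> L" by auto
  have "ln (2 * exp ((1 + c)\<^sup>2 * H)) \<le> ln L" using L by (subst ln_le_cancel_iff) auto
  then have "(1 + c)\<^sup>2 * H \<le> ln L - ln 2" by (simp add: ln_mult)
  moreover have c2: "0 < (1 + c)\<^sup>2" using c0 by (intro zero_less_power add_pos_pos) auto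
  ultimately have "H \<le> (ln L - ln 2) / (1 + c)\<^sup>2" by (simp add: pos_le_divide_eq mult.commute)
  also have "\<dots> \<le> truncated_variance L" using L a32 by (intro truncated_variance_log_lower) auto
  finally have HV: "H \<le> truncated_variance L" .
  moreover have "1 \<le> H" unfolding H_def by (rule max.cobounded1)
  ultimately have V1: "1 \<le> truncated_variance L" by linarith
  have "variance_scale a c e \<le> 16 + D * truncated_variance L"
    unfolding D_def using variance_scale_le_truncated_variance[OF L(1) eL] .
  also have "\<dots> \<le> 16 * truncated_variance L + D * truncated_variance L" using V1 by simp
  finally have variance_scale: "variance_scale a c e \<le> (16 + D) * truncated_variance L"
    by (simp add: algebra_simps)
  have "\<eta> * (tail_const\<^sup>2 * variance_scale a c e) \<le>
      \<eta> * (tail_const\<^sup>2 * ((16 + D) * truncated_variance L))"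
    using \<eta> variance_scale by (intro mult_left_mono) auto
  also have "\<dots> = \<kappa> * truncated_variance L" using D tail_const_pos by (simp add: \<eta>_def)
  also have "\<dots> \<le> expectation (\<lambda>\<omega>. (path_silt e \<omega>)\<^sup>2)"
    unfolding \<kappa>_def using L eL by (intro silt_second_moment_lower) auto
  finally have pz: "\<pi>0 \<le> prob {\<omega>\<in>space M. sqrt (\<eta> / 4) * (tail_const * sqrt (variance_scale a c e))
      < \<bar>path_silt e \<omega>\<bar>}"
    unfolding \<pi>0_def using e \<eta> by (intro paley_zygmund_silt) auto
  \<comment> \<open>Below the cut-off the damping is at least \<open>exp (- 1)\<close>, so the tail
    scale grows along with the truncated variance.\<close>
  have "truncated_variance L * exp (- 1) \<le> variance_scale a c e"
    unfolding truncated_variance_def variance_scale_def integral_mult_left_zero[symmetric]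
  proof (intro integral_mono integrable_mult_left truncated_variance_integrable
      integrable_variance_scale)
    fix p :: real
    have "exp (- 1) \<le> exp (- (e * p\<^sup>2 / 2))" if "2 \<le> p" "p \<le> L"
    proof -
      have "p\<^sup>2 \<le> L\<^sup>2" using that by (intro power_mono) auto
      then have "e * p\<^sup>2 \<le> 1" unfolding eL using L by simp
      then show ?thesis by simp
    qed
    then have "p\<^sup>2 * (resolvent a c p)\<^sup>2 * exp (- 1) \<le> p\<^sup>2 * (resolvent a c p)\<^sup>2 *
        exp (- (e * p\<^sup>2 / 2))" if "2 \<le> p" "p \<le> L"
      using that by (intro mult_left_mono) auto
    then show "indicator {2..L} p * (p\<^sup>2 * (resolvent a c p)\<^sup>2) * exp (- 1) \<le>
        p\<^sup>2 * exp (- (e * p\<^sup>2 / 2)) * (resolvent a c p)\<^sup>2"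
      by (auto simp: indicator_def mult_ac)
  qed (use e c0 in auto)
  moreover have "((real m + 1) * (2 * pi) / (sqrt (\<eta> / 4) * tail_const))\<^sup>2 * exp 1 * exp (- 1) \<le>
      truncated_variance L * exp (- 1)"
  proof (intro mult_right_mono)
    have "((real m + 1) * (2 * pi) / (sqrt (\<eta> / 4) * tail_const))\<^sup>2 * exp 1 + 1 \<le> H"
      unfolding H_def by (rule max.cobounded2)
    then show "((real m + 1) * (2 * pi) / (sqrt (\<eta> / 4) * tail_const))\<^sup>2 * exp 1 \<le>
        truncated_variance L" using HV by linarith
  qed simp
  then have "((real m + 1) * (2 * pi) / (sqrt (\<eta> / 4) * tail_const))\<^sup>2 \<le> truncated_variance L *
      exp (- 1)"
    unfolding mult.assoc exp_add[symmetric] by simp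
  ultimately have "((real m + 1) * (2 * pi) / (sqrt (\<eta> / 4) * tail_const))\<^sup>2 \<le> variance_scale a c e"
    by linarith
  then have "(real m + 1) * (2 * pi) / (sqrt (\<eta> / 4) * tail_const) \<le> sqrt (variance_scale a c e)"
    by (rule real_le_rsqrt)
  then have big: "(real m + 1) * (2 * pi) \<le>
      sqrt (\<eta> / 4) * (tail_const * sqrt (variance_scale a c e))"
    using \<eta> tail_const_pos by (simp add: pos_divide_le_eq mult_ac)
  have [measurable]: "path_silt e \<in> borel_measurable M" "dsilt_approx X e \<in> borel_measurable M"
    using e by (auto intro: path_silt_measurable dsilt_approx_measurable)
  let ?A = "{\<omega>\<in>space M. 1 < cmod (dsilt_approx X e \<omega> - \<theta> \<omega>)}" and ?B =
      "{\<omega>\<in>space M. real m < cmod (\<theta> \<omega>)}"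
  have "{\<omega>\<in>space M. sqrt (\<eta> / 4) * (tail_const * sqrt (variance_scale a c e)) < \<bar>path_silt e \<omega>\<bar>} \<subseteq>
      ?A \<union> ?B"
  proof (rule subsetI, rule ccontr)
    fix \<omega> assume w: "\<omega> \<in> {\<omega>\<in>space M. sqrt (\<eta> / 4) * (tail_const * sqrt (variance_scale a c e)) <
        \<bar>path_silt e \<omega>\<bar>}" "\<omega> \<notin> ?A \<union> ?B"
    have "(real m + 1) * (2 * pi) < \<bar>path_silt e \<omega>\<bar>" using w big by simp
    then have "real m + 1 < cmod (dsilt_approx X e \<omega>)"
      unfolding cmod_dsilt_approx[OF e(2)] by (simp add: pos_less_divide_eq)
    moreover have "cmod (dsilt_approx X e \<omega>) \<le> cmod (\<theta> \<omega>) + cmod (dsilt_approx X e \<omega> - \<theta> \<omega>)"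
      by (metis norm_triangle_sub)
    moreover have "cmod (\<theta> \<omega>) \<le> real m" "cmod (dsilt_approx X e \<omega> - \<theta> \<omega>) \<le> 1" using w by auto
    ultimately show False by linarith
  qed
  then have "prob {\<omega>\<in>space M. sqrt (\<eta> / 4) * (tail_const * sqrt (variance_scale a c e)) < \<bar>path_silt
      e \<omega>\<bar>} \<le> prob (?A \<union> ?B)"
    by (intro finite_measure_mono) auto
  also have "\<dots> \<le> prob ?A + prob ?B" by (intro measure_Un_le) auto
  also have "\<dots> < \<pi>0" using m e(1) by linarith
  finally show False using pz by simp
qed

end

theorem theorem3p1:
  fixes M :: "'a measure" and X :: "real \<Rightarrow> 'a \<Rightarrow> real"
    and \<alpha> \<sigma> \<gamma> :: real and \<theta> :: "'a \<Rightarrow> complex"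
  assumes "sym_stable_process M \<alpha> \<sigma> X"
    and "4/3 < \<alpha>" and "\<alpha> \<le> 2"
    and "is_dsilt M X \<theta>"
    and "0 \<le> \<gamma>" and "\<gamma> < 2 * \<alpha> / (6 + \<alpha>)"
  shows "\<exists>C>0. integrable M (\<lambda>\<omega>. exp (C * cmod (\<theta> \<omega>) powr \<gamma>))"
proof -
  interpret stable_process M X \<alpha> \<sigma>
    by unfold_locales (use assms in auto)
  show ?thesis
  proof (cases "3/2 < \<alpha>")
    case True
    then obtain B where B: "0 < B" "\<And>e. 0 < e \<Longrightarrow> variance_scale \<alpha> (\<sigma> powr \<alpha>) e \<le> B"
      using variance_scale_bounded by blast
    \<comment> \<open>Equivalent to \<open>\<alpha> \<le> 2\<close>, with equality in the Gaussian
      case.\<close>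
    have "2 * \<alpha> / (6 + \<alpha>) \<le> 1/2" using assms by (simp add: divide_le_eq)
    then have "\<gamma> \<le> 1/2" using assms by linarith
    then show ?thesis using bounded_variance_exp_integrable[OF B] assms by blast
  next
    case False
    then show ?thesis using no_dsilt[of \<theta>] assms by auto
  qed
qed

end
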